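(* Let $j\ge1$ be an integer. (i) If $\theta_{\ast}=-\infty$, then almost surely $G_{n,j}\sim C_{\ast}\ln n$ as $n\to\infty$. (ii) Suppose that $-\infty<\theta_{\ast}<0$ and $\varphi(\theta_{\ast})=0$. Then almost surely $G_{n,j}\sim C_{\ast}\ln n$ as $n\to\infty$. More precisely, $$G_{n,j}\ge C_{\ast}\ln n+O(\ln\ln n)\quad\text{a.s.},$$ and this inequality is an equality, i.e. $G_{n,j}=C_{\ast}\ln n+O(\ln\ln n)$ a.s., if there exists $\delta>0$ such that $$\mathrm{L}(-\delta)<\infty\quad\text{and}\quad \int \Big(\sum_{i\in\mathbb N}\mathbf 1_{p_i>0}\Big)^{1+\delta}\nu(\mathrm d\mathbf p)<\infty .$$
   Context: Model. Let $\mathbb N=\{1,2,\dots\}$ and $\mathcal U=\bigcup_{k\ge 0}\mathbb N^k$ with $\mathbb N^0=\{\varnothing\}$; write $|i|=k$ if $i\in\mathbb N^k$ (generation $k$), and $ij\in\mathbb N^{k+1}$ for the $j$-th child of $i\in\mathbb N^k$. Let $\rho=(\rho_1,\rho_2,\dots)$ be a random probability measure on $\mathbb N$, with law $\nu$ (a probability measure on the space of probability measures $\mathbf p=(p_1,p_2,\dots)$ on $\mathbb N$). Standing assumption: $\nu$ is not geometric, i.e. there is no $r\in(0,1)$ such that almost surely all masses of the atoms of $\rho$ belong to $\{r^n:n\in\mathbb Z_+\}$ (in particular $\rho$ is not a.s. a Dirac mass). Let $(\rho(i),i\in\mathcal U)$ be i.i.d. copies of $\rho$, and define $p_\varnothing=1$,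 $p_{ij}=p_i\rho_j(i)$. Each $i$ with $p_i>0$ is a box, of size $p_i$ (individuals with $p_i=0$ are ignored). An infinite sequence of balls is thrown: conditionally on $(\rho(i))_{i\in\mathcal U}$ the balls behave independently, each ball starts in $\varnothing$, and a ball located in box $i$ goes to the sub-box $ij$ with probability $\rho_j(i)=p_{ij}/p_i$ (so each ball occupies exactly one box at each generation). $G_{n,j}$ (saturation level) is the first generation $k$ at which there exists a box (of positive size) containing less than $j$ balls when the first $n$ balls have been thrown. Constants. $\mathrm L(\theta)=\mathbb E\big[\sum_{j\in\mathbb N}\rho_j^\theta\big]$ for $\theta\in\mathbb R$, with the convention $0^\theta=0$ for all $\theta\in\mathbb{R}$; $\underline\theta=\inf\{\theta\in\mathbb R:\mathrm L(\theta)<\infty\}$; $\varphi(\theta)=\ln \mathrm L(\theta)-\theta\,\mathrm L'(\theta)/\mathrm L(\theta)$ for $\theta>\underline\theta$; $\theta_{\ast}=\inf\{\theta>\underline\theta:\varphi(\theta)>0\}$; $C_{\ast}=\lim_{\theta\downarrow\theta_{\ast}}-\mathrm L(\theta)/\mathrm L'(\theta)$ (a decreasing limit). Since $\varphi$ is defined on $(\underline\theta,\infty)$, the condition $\varphi(\theta_{\ast})=0$ includes $\theta_{\ast}>\underline\theta$. Asymptotic notation: $X_n\ge a\ln n+O(\ln\ln n)$ a.s. means that almost surely there is a finite (random) constant $K$ with $X_n\ge a\ln n-K\ln\ln n$ for all large $n$; $X_n=a\ln n+O(\ln\ln n)$ a.s. means that almost surely $|X_n-a\ln n|\le K\ln\ln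 n$ for some finite random $K$ and all large $n$. *)

theory Defs
  imports "HOL-Probability.Probability" "HOL-Library.Landau_Symbols"
begin

text \<open>
  Boxes are words over \<^typ>\<open>nat\<close>, so children are labelled \<open>0, 1, 2, \<dots>\<close> (rather than
  \<open>1, 2, 3, \<dots>\<close>); the \<open>j\<close>-th child of \<open>i\<close> is \<open>i @ [j]\<close> and the generation of \<open>i\<close> is \<open>length i\<close>.
  The space of probability measures on the labels carries the usual \<open>\<sigma>\<close>-algebra, generated by
  the evaluations.
\<close>

abbreviation prob_measures :: "nat measure measure" where
  "prob_measures \<equiv> prob_algebra (count_space UNIV)"

abbreviation mass :: "nat measure \<Rightarrow> nat \<Rightarrow> real" where
  "mass p i \<equiv> measure p {i}"

definition geometric :: "nat measure measure \<Rightarrow> bool" where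
  "geometric \<nu> \<longleftrightarrow>
     (\<exists>r::real. 0 < r \<and> r < 1 \<and>
        (AE p in \<nu>. \<forall>i. mass p i > 0 \<longrightarrow> mass p i \<in> range (\<lambda>n::nat. r ^ n)))"

definition box_size :: "(nat list \<Rightarrow> nat measure) \<Rightarrow> nat list \<Rightarrow> real" where
  "box_size e i = (\<Prod>k<length i. mass (e (take k i)) (i ! k))"

lemma box_size_Nil: "box_size e [] = 1"
  by (simp add: box_size_def)

lemma box_size_child: "box_size e (i @ [j]) = box_size e i * mass (e i) j"
  by (simp add: box_size_def nth_append)

text \<open>
  \<open>X m k\<close> is the box of generation \<open>k\<close> visited by the \<open>m\<close>-th ball (\<open>m = 0, 1, \<dots>\<close>). Conditional
  probabilities given \<open>env\<close>, the \<open>\<sigma>\<close>-algebra generated by all the \<open>\<rho> i\<close>, are conditional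
  expectations of indicators. As the box \<open>X m k\<close> determines the previous ones,
  \<open>ball_step\<close> describes the whole conditional law of the trajectory of a ball.
\<close>

locale nested_boxes = prob_space M
  for M :: "'a measure"
    and \<nu> :: "nat measure measure"
    and \<rho> :: "nat list \<Rightarrow> 'a \<Rightarrow> nat measure"
    and X :: "nat \<Rightarrow> nat \<Rightarrow> 'a \<Rightarrow> nat list" +
  fixes env :: "'a measure"
  defines "env \<equiv> vimage_algebra (space M) (\<lambda>\<omega> i. \<rho> i \<omega>) (\<Pi>\<^sub>M i\<in>UNIV. prob_measures)"
  assumes law: "\<nu> \<in> space (prob_algebra prob_measures)"
    and env_indep: "indep_vars (\<lambda>_. prob_measures) \<rho> UNIV"
    and env_law: "distr M prob_measures (\<rho> i) = \<nu>"
    and ball_measurable: "X m k \<in> M \<rightarrow>\<^sub>M count_space UNIV"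
    and ball_root: "\<omega> \<in> space M \<Longrightarrow> X m 0 \<omega> = []"
    and ball_child: "\<omega> \<in> space M \<Longrightarrow> \<exists>j. X m (Suc k) \<omega> = X m k \<omega> @ [j]"
    and ball_step: "length i = k \<Longrightarrow>
      AE \<omega> in M.
        real_cond_exp M env (indicator {\<omega> \<in> space M. X m (Suc k) \<omega> = i @ [j]}) \<omega>
        = real_cond_exp M env (indicator {\<omega> \<in> space M. X m k \<omega> = i}) \<omega> * mass (\<rho> i \<omega>) j"
    and balls_cond_indep:
      "finite J \<Longrightarrow> (\<And>m. m \<in> J \<Longrightarrow> A m \<in> sets (\<Pi>\<^sub>M k\<in>UNIV. count_space UNIV)) \<Longrightarrow>
      AE \<omega> in M.
        real_cond_exp M env (indicator {\<omega> \<in> space M. \<forall>m\<in>J. (\<lambda>k. X m k \<omega>) \<in> A m}) \<omega>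
        = (\<Prod>m\<in>J. real_cond_exp M env (indicator {\<omega> \<in> space M. (\<lambda>k. X m k \<omega>) \<in> A m}) \<omega>)"

definition balls_in ::
    "(nat \<Rightarrow> nat \<Rightarrow> 'a \<Rightarrow> nat list) \<Rightarrow> nat \<Rightarrow> nat list \<Rightarrow> 'a \<Rightarrow> nat" where
  "balls_in X n i \<omega> = card {m. m < n \<and> X m (length i) \<omega> = i}"

text \<open>
  In a non-geometric model the number of boxes of positive size tends to infinity with the
  generation, so that the minimum below exists almost surely.
\<close>

definition saturation_level ::
    "(nat list \<Rightarrow> 'a \<Rightarrow> nat measure) \<Rightarrow> (nat \<Rightarrow> nat \<Rightarrow> 'a \<Rightarrow> nat list)
      \<Rightarrow> nat \<Rightarrow> nat \<Rightarrow> 'a \<Rightarrow> nat" where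
  "saturation_level \<rho> X n j \<omega> =
     (LEAST k. \<exists>i. length i = k \<and> box_size (\<lambda>u. \<rho> u \<omega>) i > 0 \<and> balls_in X n i \<omega> < j)"

text \<open>Note that \<open>0 powr \<theta> = 0\<close> for every \<open>\<theta>\<close>, including \<open>\<theta> \<le> 0\<close>.\<close>

definition L :: "nat measure measure \<Rightarrow> real \<Rightarrow> ennreal" where
  "L \<nu> \<theta> = (\<integral>\<^sup>+ p. (\<Sum>j. ennreal (mass p j powr \<theta>)) \<partial>\<nu>)"

abbreviation Lr :: "nat measure measure \<Rightarrow> real \<Rightarrow> real" where
  "Lr \<nu> \<theta> \<equiv> enn2real (L \<nu> \<theta>)"

definition theta_low :: "nat measure measure \<Rightarrow> ereal" where
  "theta_low \<nu> = Inf (ereal ` {\<theta>. L \<nu> \<theta> < \<infinity>})"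

text \<open>Only meaningful for \<open>\<theta> > theta_low \<nu>\<close>.\<close>

definition phi :: "nat measure measure \<Rightarrow> real \<Rightarrow> real" where
  "phi \<nu> \<theta> = ln (Lr \<nu> \<theta>) - \<theta> * deriv (Lr \<nu>) \<theta> / Lr \<nu> \<theta>"

definition theta_star :: "nat measure measure \<Rightarrow> ereal" where
  "theta_star \<nu> = Inf (ereal ` {\<theta>. theta_low \<nu> < ereal \<theta> \<and> phi \<nu> \<theta> > 0})"

text \<open>
  The limit as \<open>\<theta>\<close> decreases to \<open>theta_star \<nu>\<close>, which may be \<open>-\<infinity>\<close>; the definition has no meaning
  when \<open>theta_star \<nu> = \<infinity>\<close>.
\<close>

definition C_star :: "nat measure measure \<Rightarrow> real" where
  "C_star \<nu> =
     Lim (if theta_star \<nu> = -\<infinity> then at_bot else at_right (real_of_ereal (theta_star \<nu>)))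
       (\<lambda>\<theta>. - Lr \<nu> \<theta> / deriv (Lr \<nu>) \<theta>)"

definition atoms_moment :: "nat measure measure \<Rightarrow> real \<Rightarrow> ennreal" where
  "atoms_moment \<nu> a =
     (\<integral>\<^sup>+ p. (if finite {i. mass p i > 0}
              then ennreal (real (card {i. mass p i > 0}) powr a) else \<infinity>) \<partial>\<nu>)"

end

theory Submission
  imports Defs "HOL-Real_Asymp.Real_Asymp"
begin

text \<open>
  Let \<open>P k s\<close> be the probability that generation \<open>k\<close> contains a box of size at most \<open>e\<^sup>s\<close>, and
  write \<open>g = ln L\<close>, \<open>h = - L' / L\<close>, so that \<open>\<phi> \<theta> = g \<theta> + \<theta> * h \<theta>\<close> and \<open>C\<^sub>* = lim 1 / h\<close>.

  Lower bound: a box of size \<open>p\<close> holds fewer than \<open>j\<close> of \<open>n\<close> balls with probability at most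
  \<open>c (n p) powr - t\<close> for every \<open>t > 0\<close>, so some box of generation \<open>k\<close> does with probability at most
  \<open>c * n powr - t * L (- t) ^ k\<close>, a first-moment bound which is summed along \<open>n = 2 ^ q\<close>.

  Upper bound: a box of size well below \<open>1 / n\<close> is probably empty, so it suffices that \<open>P k s\<close>
  is close to 1. As every box has a child and some have two, \<open>1 - P\<close> satisfies a recursion which
  turns a lower bound \<open>P k s \<ge> \<epsilon>\<close> into \<open>1 - P (k + m) s \<le> r ^ m / \<epsilon>\<close> with \<open>r < 1\<close>. The lower
  bounds on \<open>P\<close> come from \<open>\<Prod>(1 - u\<^sub>i) \<le> 1 - \<Sum>u\<^sub>i + (\<Sum>u\<^sub>i)\<^sup>2 / 2\<close> applied generation by generation to a
  branching process with truncated offspring. For a speed below the critical one, blocks of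
  generations form a supercritical process. At the critical speed one keeps only
  the lines of descent along which the walk tilted by \<open>\<theta>\<^sub>*\<close> stays nonnegative and ends in
  \<open>[0, K ln k]\<close>; by a rotation argument the probability of this event is at least \<open>k powr - 5\<close>.
\<close>

section \<open>Moments of the offspring law\<close>

text \<open>Independence of the environment enters the upper bound through one inequality only,
  \<open>reach_step\<close>; afterwards \<open>P\<close> is just a function obeying a functional
  inequality, so no branching process, martingale or survival event has to be constructed. The
  obstacle is the second moment: the sum over \<open>j\<close> of \<open>mass p j powr (-t)\<close>
  need not be square integrable. Hence only finitely many labels are used, and at the critical speed
  the weights are also cut at powers of \<open>k\<close>. Such cuts, and crude exponents such as 5,
  are affordable: \<open>k\<close> is of order \<open>ln n\<close>, and a probability that is
  polynomially small in \<open>k\<close> is lifted close to 1 by \<open>O(ln k) = O(ln ln n)\<close>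
  further generations. Being underfull is inherited when balls are removed or the generation grows,
  so the numbers \<open>n = 2 ^ q\<close> suffice, and errors of order \<open>q powr (-2)\<close>
  are summable.\<close>

lemma abs_exp_diff_le:
  fixes a b :: real
  shows "\<bar>exp b - exp a\<bar> \<le> \<bar>b - a\<bar> * max (exp a) (exp b)"
proof -
  have *: "exp v - exp u \<le> (v - u) * exp v" for u v :: real
  proof -
    have "exp v * (1 + (u - v)) \<le> exp v * exp (u - v)"
      by (intro mult_left_mono exp_ge_add_one_self) auto
    also have "\<dots> = exp u" by (simp add: exp_diff)
    finally show ?thesis by (simp add: algebra_simps)
  qed
  show ?thesis
    using *[of b a] *[of a b] by (cases "a \<le> b") (auto simp: max_def abs_if algebra_simps)
qed

text \<open>A logarithm costs an arbitrarily small amount \<delta> of exponent: apply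
  \<open>ln y < y\<close> to \<open>y = x powr (-\<delta>)\<close>.\<close>

lemma powr_abs_ln_le:
  fixes x \<delta> :: real
  assumes "0 \<le> x" "x \<le> 1" "\<delta> > 0"
  shows "x powr (\<theta> + \<delta>) * \<bar>ln x\<bar> \<le> x powr \<theta> / \<delta>"
proof (cases "x = 0")
  case False
  have "ln (x powr (-\<delta>)) \<le> x powr (-\<delta>)" using False assms
    by (intro less_imp_le ln_less_self) auto
  then have "\<delta> * \<bar>ln x\<bar> \<le> x powr (-\<delta>)"
    using False assms by (simp add: ln_powr abs_if)
  then have "x powr \<theta> * x powr \<delta> * (\<delta> * \<bar>ln x\<bar>) \<le> x powr \<theta> * x powr \<delta> * x powr (-\<delta>)"
    by (intro mult_left_mono) auto
  also have "\<dots> = x powr \<theta>" using False assms by (simp flip: powr_add)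
  finally show ?thesis using assms by (simp add: powr_add field_simps)
qed auto

lemma moment_has_derivative:
  fixes m :: "real measure" and \<theta> \<theta>0 :: real
  assumes sets[measurable_cong]: "sets m = sets borel"
    and unit: "AE x in m. 0 \<le> x \<and> x \<le> 1"
    and int0: "integrable m (\<lambda>x. x powr \<theta>0)" and less: "\<theta>0 < \<theta>"
  shows "integrable m (\<lambda>x. x powr \<theta> * ln x)"
    and "((\<lambda>\<theta>. \<integral>x. x powr \<theta> \<partial>m) has_real_derivative (\<integral>x. x powr \<theta> * ln x \<partial>m)) (at \<theta>)"
proof -
  \<comment> \<open>One half of the room above \<open>\<theta>0\<close> keeps the varying exponents
    above \<open>\<theta>0 + \<delta>\<close>, the other half absorbs the logarithm; so
    \<open>x powr \<theta>0 / \<delta>\<close> dominates all difference quotients.\<close>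
  define \<delta> where "\<delta> = (\<theta> - \<theta>0) / 2"
  have \<delta>: "\<delta> > 0" "\<theta>0 + \<delta> + \<delta> = \<theta>" using less by (auto simp: \<delta>_def field_simps)
  let ?w = "\<lambda>x. x powr \<theta>0 / \<delta>"
  have intw: "integrable m ?w" using int0 by simp
  have int: "integrable m (\<lambda>x. x powr \<eta>)" if "\<eta> \<ge> \<theta>0" for \<eta>
    by (rule Bochner_Integration.integrable_bound[OF int0])
      (use unit that in \<open>auto intro: powr_mono'\<close>)
  have *: "x powr \<theta> * \<bar>ln x\<bar> \<le> ?w x" if "0 \<le> x" "x \<le> 1" for x
  proof -
    have "x powr \<theta> * \<bar>ln x\<bar> \<le> x powr (\<theta>0 + \<delta>) * \<bar>ln x\<bar>"
      using that \<delta> by (intro mult_right_mono powr_mono') auto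
    also have "\<dots> \<le> ?w x" using that \<delta> by (intro powr_abs_ln_le) auto
    finally show ?thesis .
  qed
  show "integrable m (\<lambda>x. x powr \<theta> * ln x)"
    by (rule Bochner_Integration.integrable_bound[OF intw])
      (use unit * \<delta> in \<open>auto simp: abs_mult\<close>)
  show "((\<lambda>\<theta>. \<integral>x. x powr \<theta> \<partial>m) has_real_derivative (\<integral>x. x powr \<theta> * ln x \<partial>m)) (at \<theta>)"
    unfolding has_field_derivative_iff tendsto_at_iff_sequentially
  proof safe
    fix X :: "nat \<Rightarrow> real" assume X: "\<forall>i. X i \<in> UNIV - {\<theta>}" "X \<longlonglongrightarrow> \<theta>"
    obtain N where N: "\<And>n. n \<ge> N \<Longrightarrow> \<bar>X n - \<theta>\<bar> < \<delta>"
      using LIMSEQ_D[OF X(2) \<delta>(1)] by auto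
    \<comment> \<open>Domination is required at every index, not only eventually, so the first
      \<open>N\<close> terms are dropped; \<open>LIMSEQ_offset\<close> restores them at the
      end.\<close>
    define Y where "Y n = X (n + N)" for n
    have Y: "Y \<longlonglongrightarrow> \<theta>" "\<And>n. Y n \<noteq> \<theta>" "\<And>n. \<bar>Y n - \<theta>\<bar> < \<delta>"
      using X N LIMSEQ_ignore_initial_segment[OF X(2)] by (auto simp: Y_def[abs_def])
    have Y0: "Y n \<ge> \<theta>0 + \<delta>" for n using Y(3)[of n] \<delta> by linarith
    have "(\<lambda>n. \<integral>x. (x powr Y n - x powr \<theta>) / (Y n - \<theta>) \<partial>m) \<longlonglongrightarrow> (\<integral>x. x powr \<theta> * ln x \<partial>m)"
    proof (rule integral_dominated_convergence[OF _ _ intw])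
      show "AE x in m. (\<lambda>n. (x powr Y n - x powr \<theta>) / (Y n - \<theta>)) \<longlonglongrightarrow> x powr \<theta> * ln x"
        using unit
      proof eventually_elim
        case (elim x)
        show ?case
        proof (cases "x = 0")
          case False
          have "((\<lambda>\<theta>. x powr \<theta>) has_real_derivative x powr \<theta> * ln x) (at \<theta>)"
            using elim False by (auto intro!: derivative_eq_intros)
          then have "((\<lambda>y. (x powr y - x powr \<theta>) / (y - \<theta>)) \<longlongrightarrow> x powr \<theta> * ln x) (at \<theta>)"
            by (simp add: has_field_derivative_iff)
          then show ?thesis
            by (rule filterlim_compose) (use Y in \<open>auto simp: filterlim_at\<close>)
        qed auto
      qed
      show "AE x in m. norm ((x powr Y n - x powr \<theta>) / (Y n - \<theta>)) \<le> ?w x" for n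
        using unit
      proof eventually_elim
        case (elim x)
        show ?case
        proof (cases "x = 0")
          case False
          have "\<bar>x powr Y n - x powr \<theta>\<bar> \<le> \<bar>(Y n - \<theta>) * ln x\<bar> * max (x powr \<theta>) (x powr Y n)"
            using abs_exp_diff_le[of "Y n * ln x" "\<theta> * ln x"] False elim
            by (simp add: powr_def algebra_simps)
          also have "\<dots> \<le> \<bar>(Y n - \<theta>) * ln x\<bar> * x powr (\<theta>0 + \<delta>)"
            using elim Y0[of n] \<delta> by (intro mult_left_mono max.boundedI powr_mono') auto
          also have "\<dots> = \<bar>Y n - \<theta>\<bar> * (x powr (\<theta>0 + \<delta>) * \<bar>ln x\<bar>)"
            by (simp add: abs_mult)
          also have "\<dots> \<le> \<bar>Y n - \<theta>\<bar> * ?w x"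
            using elim \<delta> by (intro mult_left_mono powr_abs_ln_le) auto
          finally show ?thesis using Y(2)[of n] by (simp add: abs_divide field_simps)
        qed (use \<delta> in auto)
      qed
    qed auto
    also have "(\<lambda>n. \<integral>x. (x powr Y n - x powr \<theta>) / (Y n - \<theta>) \<partial>m) =
      (\<lambda>n. ((\<integral>x. x powr Y n \<partial>m) - (\<integral>x. x powr \<theta> \<partial>m)) / (Y n - \<theta>))"
    proof
      fix n
      have "integrable m (\<lambda>x. x powr Y n)" using Y0[of n] \<delta> by (intro int) linarith
      moreover have "integrable m (\<lambda>x. x powr \<theta>)" using less by (intro int) linarith
      ultimately show "(\<integral>x. (x powr Y n - x powr \<theta>) / (Y n - \<theta>) \<partial>m) =
        ((\<integral>x. x powr Y n \<partial>m) - (\<integral>x. x powr \<theta> \<partial>m)) / (Y n - \<theta>)"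
        by simp
    qed
    finally show "((\<lambda>y. ((\<integral>x. x powr y \<partial>m) - (\<integral>x. x powr \<theta> \<partial>m)) / (y - \<theta>)) \<circ> X)
       \<longlonglongrightarrow> (\<integral>x. x powr \<theta> * ln x \<partial>m)"
      unfolding Y_def o_def by (rule LIMSEQ_offset)
  qed
qed

text \<open>Log-convexity of moments in tangent form, by Jensen: \<open>exp\<close> lies above its
  tangent at \<open>v\<close>, the tilted mean of \<open>(\<eta> - \<theta>) * ln x\<close>, and
  with this choice the linear term integrates to zero. It stands in for second derivatives
  below.\<close>

lemma moment_tangent:
  fixes m :: "real measure" and \<theta> \<eta> :: real
  assumes sets[measurable_cong]: "sets m = sets borel"
    and nonneg: "AE x in m. 0 \<le> x"
    and int: "integrable m (\<lambda>x. x powr \<theta>)" "integrable m (\<lambda>x. x powr \<theta> * ln x)"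
      "integrable m (\<lambda>x. x powr \<eta>)"
    and pos: "(\<integral>x. x powr \<theta> \<partial>m) > 0"
  defines "d \<equiv> (\<integral>x. x powr \<theta> * ln x \<partial>m) / (\<integral>x. x powr \<theta> \<partial>m)"
  shows "(\<integral>x. x powr \<eta> \<partial>m) \<ge> (\<integral>x. x powr \<theta> \<partial>m) * exp ((\<eta> - \<theta>) * d)"
proof -
  define v where "v = (\<eta> - \<theta>) * d"
  have "(\<integral>x. x powr \<eta> \<partial>m) \<ge> (\<integral>x. exp v * ((1 - v) * x powr \<theta> + (\<eta> - \<theta>) * (x powr \<theta> * ln x)) \<partial>m)"
  proof (rule integral_mono_AE)
    show "AE x in m. exp v * ((1 - v) * x powr \<theta> + (\<eta> - \<theta>) * (x powr \<theta> * ln x)) \<le> x powr \<eta>"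
      using nonneg
    proof eventually_elim
      case (elim x)
      show ?case
      proof (cases "x = 0")
        case False
        have "x powr \<theta> * exp v * (1 + ((\<eta> - \<theta>) * ln x - v)) \<le> x powr \<theta> * exp v * exp ((\<eta> - \<theta>) * ln x - v)"
          by (intro mult_left_mono exp_ge_add_one_self) auto
        also have "\<dots> = x powr \<theta> * x powr (\<eta> - \<theta>)"
          using False elim by (simp add: exp_diff powr_def)
        also have "\<dots> = x powr \<eta>" using elim False by (simp flip: powr_add)
        finally show ?thesis by (simp add: algebra_simps)
      qed auto
    qed
  qed (use int in auto)
  also have "(\<integral>x. exp v * ((1 - v) * x powr \<theta> + (\<eta> - \<theta>) * (x powr \<theta> * ln x)) \<partial>m) =
     exp v * ((1 - v) * (\<integral>x. x powr \<theta> \<partial>m) + (\<eta> - \<theta>) * (\<integral>x. x powr \<theta> * ln x \<partial>m))"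
    using int by (simp add: Bochner_Integration.integral_add)
  also have "\<dots> = exp v * (\<integral>x. x powr \<theta> \<partial>m)"
    using pos by (simp add: v_def d_def field_simps)
  finally show ?thesis by (simp add: v_def mult.commute)
qed

section \<open>The offspring law seen as a measure on the line, and the convex function
  \<open>ln L\<close>\<close>

locale box_law =
  fixes \<nu> :: "nat measure measure"
  assumes law: "\<nu> \<in> space (prob_algebra prob_measures)"
begin

sublocale prob_space \<nu>
  using law by (simp add: space_prob_algebra)

lemma sets_law[measurable_cong]: "sets \<nu> = sets prob_measures"
  using law by (simp add: space_prob_algebra)

lemma space_law: "space \<nu> = space prob_measures"
  by (rule sets_eq_imp_space_eq[OF sets_law])

lemma mass_measurable[measurable]: "(\<lambda>p. mass p j) \<in> borel_measurable \<nu>"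
  by measurable

lemma mass_sums:
  assumes "p \<in> space \<nu>"
  shows "(\<lambda>j. mass p j) sums 1"
proof -
  interpret p: prob_space p using assms by (simp add: space_law space_prob_algebra)
  have sp: "sets p = UNIV" using assms by (simp add: space_law space_prob_algebra)
  then have "space p = UNIV" using sets_eq_imp_space_eq[of p "count_space UNIV"] by simp
  moreover have "(\<lambda>j. mass p j) sums measure p (\<Union>j. {j})"
    by (rule p.finite_measure_UNION) (auto simp: sp disjoint_family_on_def)
  ultimately show ?thesis using p.prob_space by simp
qed

lemma mass_le_1: "p \<in> space \<nu> \<Longrightarrow> mass p j \<le> 1"
  by (simp add: space_law space_prob_algebra prob_space.prob_le_1)

lemma mass_pos_ex:
  assumes "p \<in> space \<nu>" shows "\<exists>j. mass p j > 0"
proof (rule ccontr)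
  assume "\<nexists>j. mass p j > 0"
  then have "mass p j = 0" for j by (simp add: zero_less_measure_iff)
  with mass_sums[OF assms] have "(\<lambda>_::nat. 0::real) sums 1" by simp
  then show False using sums_unique2[OF sums_zero] by fastforce
qed

text \<open>Turns \<open>L \<nu> \<theta>\<close> into the moment of order \<theta> of one measure
  on the line. This measure need not be sigma-finite, since all labels of mass 0 contribute to
  \<open>{0}\<close>; there \<open>x powr \<theta>\<close> vanishes.\<close>

definition intensity :: "real measure" where
  "intensity = distr (\<nu> \<Otimes>\<^sub>M count_space UNIV) borel (\<lambda>(p, j). mass p j)"

lemma sets_intensity[measurable_cong]: "sets intensity = sets borel"
  by (simp add: intensity_def)

lemma mass_pair_measurable[measurable]:
  "(\<lambda>(p, j). mass p j) \<in> borel_measurable (\<nu> \<Otimes>\<^sub>M count_space UNIV)"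
proof -
  have "(\<lambda>z. mass (fst z) (snd z)) \<in> borel_measurable (\<nu> \<Otimes>\<^sub>M count_space UNIV)"
    by (rule measurable_compose_countable'[where f="\<lambda>j z. mass (fst z) j" and g=snd and I=UNIV]) auto
  then show ?thesis by (simp add: case_prod_beta')
qed

lemma nn_integral_intensity:
  assumes [measurable]: "f \<in> borel_measurable borel"
  shows "(\<integral>\<^sup>+x. f x \<partial>intensity) = (\<integral>\<^sup>+p. (\<Sum>j. f (mass p j)) \<partial>\<nu>)"
proof -
  interpret c: sigma_finite_measure "count_space (UNIV :: nat set)"
    by (rule sigma_finite_measure_count_space)
  have "(\<integral>\<^sup>+x. f x \<partial>intensity) = (\<integral>\<^sup>+z. f ((\<lambda>(p, j). mass p j) z) \<partial>(\<nu> \<Otimes>\<^sub>M count_space UNIV))"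
    unfolding intensity_def by (rule nn_integral_distr) measurable
  also have "\<dots> = (\<integral>\<^sup>+p. \<integral>\<^sup>+j. f (mass p j) \<partial>count_space UNIV \<partial>\<nu>)"
    by (subst c.nn_integral_fst[symmetric]) (auto intro!: nn_integral_cong simp: case_prod_beta')
  finally show ?thesis by (simp add: nn_integral_count_space_nat)
qed

lemma AE_intensity_iff:
  assumes [measurable]: "Measurable.pred borel P"
  shows "(AE x in intensity. P x) \<longleftrightarrow> (AE p in \<nu>. \<forall>j. P (mass p j))"
proof -
  have "(AE x in intensity. P x) \<longleftrightarrow> (\<integral>\<^sup>+x. indicator {x. \<not> P x} x \<partial>intensity) = 0"
    by (subst nn_integral_0_iff_AE) (auto simp: indicator_def)
  also have "(\<integral>\<^sup>+x. indicator {x. \<not> P x} x \<partial>intensity) =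
      (\<integral>\<^sup>+p. (\<Sum>j. indicator {x. \<not> P x} (mass p j)) \<partial>\<nu>)"
    by (rule nn_integral_intensity) measurable
  also have "\<dots> = 0 \<longleftrightarrow> (AE p in \<nu>. (\<Sum>j. indicator {x. \<not> P x} (mass p j) :: ennreal) = 0)"
    by (rule nn_integral_0_iff_AE) measurable
  also have "\<dots> \<longleftrightarrow> (AE p in \<nu>. \<forall>j. P (mass p j))"
    by (intro AE_cong) (auto simp: suminf_eq_zero_iff[OF summableI] indicator_def)
  finally show ?thesis .
qed

lemma AE_intensity_unit: "AE x in intensity. 0 \<le> x \<and> x \<le> 1"
  by (subst AE_intensity_iff) (auto intro!: AE_I2 mass_le_1)

lemma L_eq: "L \<nu> \<theta> = (\<integral>\<^sup>+x. ennreal (x powr \<theta>) \<partial>intensity)"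
  unfolding L_def by (rule nn_integral_intensity[symmetric]) measurable

lemma integrable_intensity_iff: "integrable intensity (\<lambda>x. x powr \<theta>) \<longleftrightarrow> L \<nu> \<theta> < \<infinity>"
  unfolding L_eq by (subst integrable_iff_bounded) auto

lemma Lr_eq: "Lr \<nu> \<theta> = (\<integral>x. x powr \<theta> \<partial>intensity)"
  unfolding L_eq by (rule integral_eq_nn_integral[symmetric]) auto

lemma L_antimono: "\<theta> \<le> \<eta> \<Longrightarrow> L \<nu> \<eta> \<le> L \<nu> \<theta>"
  unfolding L_eq using AE_intensity_unit
  by (intro nn_integral_mono_AE) (auto intro!: ennreal_leI powr_mono')

lemma L_pos: "L \<nu> \<theta> > 0"
proof (rule ccontr)
  assume "\<not> L \<nu> \<theta> > 0"
  then have "L \<nu> \<theta> = 0" by simp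
  then have "AE x in intensity. ennreal (x powr \<theta>) = 0"
    unfolding L_eq by (subst (asm) nn_integral_0_iff_AE) auto
  then have "AE x in intensity. x = 0"
    by eventually_elim (auto simp: ennreal_eq_0_iff powr_def split: if_splits)
  then have "AE p in \<nu>. \<forall>j. mass p j = 0"
    by (subst (asm) AE_intensity_iff) auto
  then have "AE p in \<nu>. False"
    using AE_space by eventually_elim (use mass_pos_ex in fastforce)
  then show False by simp
qed

lemma Lr_pos: "L \<nu> \<theta> < \<infinity> \<Longrightarrow> Lr \<nu> \<theta> > 0"
  using L_pos by (simp add: enn2real_positive_iff)

lemma L_eq_Lr: "L \<nu> \<theta> < \<infinity> \<Longrightarrow> L \<nu> \<theta> = ennreal (Lr \<nu> \<theta>)"
  by simp

text \<open>Provides room to the left of \<theta>, which differentiation under the integral and the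
  exponential moments of the tilted walk consume. The midpoint makes the new exponent lie strictly
  above \<open>theta_low \<nu>\<close> too.\<close>

lemma theta_low_less:
  assumes "theta_low \<nu> < ereal \<theta>"
  obtains \<theta>0 where "\<theta>0 < \<theta>" "L \<nu> \<theta>0 < \<infinity>" "theta_low \<nu> < ereal \<theta>0"
proof -
  obtain \<eta> where \<eta>: "\<eta> < \<theta>" "L \<nu> \<eta> < \<infinity>"
    using assms unfolding theta_low_def by (auto simp: Inf_less_iff)
  define \<theta>0 where "\<theta>0 = (\<eta> + \<theta>) / 2"
  have "\<theta>0 < \<theta>" "\<eta> < \<theta>0" using \<eta> by (auto simp: \<theta>0_def)
  moreover have "theta_low \<nu> \<le> ereal \<eta>" unfolding theta_low_def using \<eta> by (intro Inf_lower) auto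
  moreover have "L \<nu> \<theta>0 < \<infinity>" using L_antimono[of \<eta> \<theta>0] \<eta> \<open>\<eta> < \<theta>0\<close> by (auto simp: order.strict_trans1)
  moreover from calculation have "theta_low \<nu> < ereal \<theta>0" by (metis ereal_less_eq(3) leD leI order.strict_trans1 ereal_less(1) less_ereal.simps(1))
  ultimately show ?thesis using that[of \<theta>0] by blast
qed

lemma L_finite: "theta_low \<nu> < ereal \<theta> \<Longrightarrow> L \<nu> \<theta> < \<infinity>"
  using L_antimono[of _ \<theta>] by (metis theta_low_less less_imp_le order.strict_trans1)

definition loglap :: "real \<Rightarrow> real" where
  "loglap \<theta> = ln (Lr \<nu> \<theta>)"

text \<open>The mean of \<open>- ln x\<close> under the law with density
  \<open>x powr \<theta> / Lr \<nu> \<theta>\<close> with respect to \<open>intensity\<close>: the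
  rate at which sizes decrease exponentially along a typical \<theta>-tilted line of
  descent.\<close>

definition speed :: "real \<Rightarrow> real" where
  "speed \<theta> = - deriv (Lr \<nu>) \<theta> / Lr \<nu> \<theta>"

lemma phi_eq: "phi \<nu> \<theta> = loglap \<theta> + \<theta> * speed \<theta>"
  by (simp add: phi_def loglap_def speed_def)

lemma
  assumes "theta_low \<nu> < ereal \<theta>"
  shows integrable_powr_ln: "integrable intensity (\<lambda>x. x powr \<theta> * ln x)"
    and deriv_Lr: "deriv (Lr \<nu>) \<theta> = (\<integral>x. x powr \<theta> * ln x \<partial>intensity)"
    and loglap_deriv: "(loglap has_real_derivative - speed \<theta>) (at \<theta>)"
proof -
  obtain \<theta>0 where \<theta>0: "\<theta>0 < \<theta>" "L \<nu> \<theta>0 < \<infinity>" using theta_low_less[OF assms] by metis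
  note D = moment_has_derivative[OF sets_intensity AE_intensity_unit
      \<theta>0(2)[folded integrable_intensity_iff] \<theta>0(1)]
  show "integrable intensity (\<lambda>x. x powr \<theta> * ln x)" by (rule D(1))
  have d: "(Lr \<nu> has_real_derivative (\<integral>x. x powr \<theta> * ln x \<partial>intensity)) (at \<theta>)"
    using D(2) by (simp add: Lr_eq[abs_def])
  show *: "deriv (Lr \<nu>) \<theta> = (\<integral>x. x powr \<theta> * ln x \<partial>intensity)"
    by (rule DERIV_imp_deriv[OF d])
  have "Lr \<nu> \<theta> > 0" using assms by (intro Lr_pos L_finite)
  then show "(loglap has_real_derivative - speed \<theta>) (at \<theta>)"
    unfolding loglap_def[abs_def] speed_def *
    by (auto intro!: derivative_eq_intros d simp: divide_inverse)
qed

lemma loglap_tangent: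
  assumes "theta_low \<nu> < ereal \<theta>" "L \<nu> \<eta> < \<infinity>"
  shows "loglap \<eta> \<ge> loglap \<theta> - (\<eta> - \<theta>) * speed \<theta>"
proof -
  have pos: "Lr \<nu> \<theta> > 0" "Lr \<nu> \<eta> > 0" using Lr_pos[OF L_finite[OF assms(1)]] Lr_pos[OF assms(2)] by auto
  have "Lr \<nu> \<theta> * exp ((\<eta> - \<theta>) * (- speed \<theta>)) \<le> Lr \<nu> \<eta>"
    using moment_tangent[OF sets_intensity, of \<theta> \<eta>] AE_intensity_unit assms pos L_finite[OF assms(1)]
    by (simp add: Lr_eq[symmetric] speed_def deriv_Lr integrable_intensity_iff integrable_powr_ln)
  then have "ln (Lr \<nu> \<theta> * exp ((\<eta> - \<theta>) * (- speed \<theta>))) \<le> loglap \<eta>"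
    unfolding loglap_def using pos by (subst ln_le_cancel_iff) auto
  then show ?thesis using pos by (simp add: ln_mult loglap_def)
qed

text \<open>Sum of the two tangent inequalities at \<theta> and \<eta>.\<close>

lemma speed_antimono:
  assumes "theta_low \<nu> < ereal \<theta>" "\<theta> \<le> \<eta>"
  shows "speed \<eta> \<le> speed \<theta>"
proof (cases "\<theta> = \<eta>")
  case False
  have \<eta>: "theta_low \<nu> < ereal \<eta>" using assms by (auto intro: order.strict_trans2)
  have "0 \<le> (\<eta> - \<theta>) * (speed \<theta> - speed \<eta>)"
    using loglap_tangent[OF assms(1) L_finite[OF \<eta>]] loglap_tangent[OF \<eta> L_finite[OF assms(1)]]
    by (simp add: algebra_simps)
  then show ?thesis using False assms by (simp add: zero_le_mult_iff)
qed auto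

text \<open>\<open>phi \<nu> \<theta>\<close> is the value at 0 of the tangent to
  \<open>loglap\<close> at \<theta>. For a convex function this value increases as the point of
  contact approaches 0 from the left.\<close>

lemma phi_mono:
  assumes "theta_low \<nu> < ereal \<theta>" "\<theta> \<le> \<eta>" "\<eta> \<le> 0"
  shows "phi \<nu> \<theta> \<le> phi \<nu> \<eta>"
proof -
  have \<eta>: "theta_low \<nu> < ereal \<eta>" using assms by (auto intro: order.strict_trans2)
  have "\<eta> * (speed \<eta> - speed \<theta>) \<ge> 0"
    using speed_antimono[OF assms(1,2)] assms(3) by (intro mult_nonpos_nonpos) auto
  then show ?thesis
    using loglap_tangent[OF assms(1) L_finite[OF \<eta>]] by (simp add: phi_eq algebra_simps)
qed

text \<open>Masses 0 and 1 fit every ratio, 1 being its power of exponent 0; the ratio 1/2 is an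
  arbitrary choice.\<close>

lemma not_dirac:
  assumes "\<not> geometric \<nu>"
  shows "\<not> (AE p in \<nu>. \<forall>j. mass p j = 0 \<or> mass p j = 1)"
proof
  assume "AE p in \<nu>. \<forall>j. mass p j = 0 \<or> mass p j = 1"
  then have "AE p in \<nu>. \<forall>i. mass p i > 0 \<longrightarrow> mass p i \<in> range (\<lambda>n::nat. (1/2::real) ^ n)"
  proof eventually_elim
    case (elim p)
    have "(1::real) = (1/2) ^ (0::nat)" by simp
    then have "(1::real) \<in> range (\<lambda>n::nat. (1/2::real) ^ n)" by (rule range_eqI)
    with elim show ?case by (metis less_irrefl)
  qed
  then show False using assms unfolding geometric_def
    by (auto dest!: spec[of _ "1/2"])
qed

lemma speed_pos:
  assumes "\<not> geometric \<nu>" "theta_low \<nu> < ereal \<theta>"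
  shows "speed \<theta> > 0"
proof -
  let ?f = "\<lambda>x::real. - (x powr \<theta> * ln x)"
  have nn: "AE x in intensity. 0 \<le> ?f x"
    using AE_intensity_unit
    by eventually_elim (auto simp: le_less mult_less_0_iff)
  have i: "integrable intensity ?f" using integrable_powr_ln[OF assms(2)] by simp
  have "(\<integral>x. ?f x \<partial>intensity) \<noteq> 0"
  proof
    assume "(\<integral>x. ?f x \<partial>intensity) = 0"
    then have "AE x in intensity. ?f x = 0"
      using integral_nonneg_eq_0_iff_AE[OF i nn] by simp
    then have "AE x in intensity. x = 0 \<or> x = 1"
      using AE_intensity_unit by eventually_elim (metis mult_eq_0_iff neg_equal_0_iff_equal powr_eq_0_iff ln_eq_zero_iff le_less)
    then have "AE p in \<nu>. \<forall>j. mass p j = 0 \<or> mass p j = 1"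
      by (subst (asm) AE_intensity_iff) auto
    then show False using not_dirac assms by simp
  qed
  moreover have "(\<integral>x. ?f x \<partial>intensity) \<ge> 0" by (rule integral_nonneg_AE[OF nn])
  ultimately have "- deriv (Lr \<nu>) \<theta> > 0"
    using deriv_Lr[OF assms(2)] by simp
  then show ?thesis
    unfolding speed_def using Lr_pos[OF L_finite[OF assms(2)]] by (simp add: divide_neg_pos)
qed

lemma theta_star_approx:
  assumes "theta_star \<nu> < ereal y"
  obtains \<theta> where "\<theta> < y" "theta_low \<nu> < ereal \<theta>" "phi \<nu> \<theta> > 0" "theta_star \<nu> \<le> ereal \<theta>"
proof -
  obtain \<theta> where \<theta>: "\<theta> < y" "theta_low \<nu> < ereal \<theta>" "phi \<nu> \<theta> > 0"
    using assms unfolding theta_star_def by (auto simp: Inf_less_iff)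
  moreover have "theta_star \<nu> \<le> ereal \<theta>" unfolding theta_star_def using \<theta> by (intro Inf_lower) auto
  ultimately show ?thesis using that by blast
qed

lemma C_star_eq_Lim:
  "C_star \<nu> = Lim (if theta_star \<nu> = -\<infinity> then at_bot else at_right (real_of_ereal (theta_star \<nu>)))
       (\<lambda>\<theta>. 1 / speed \<theta>)"
  by (simp add: C_star_def speed_def)

text \<open>What the proof of \<open>G \<sim> (1 / H) ln n\<close> needs to know about \<open>H = 1 / C\<^sub>*\<close>; it covers \<open>\<theta>\<^sub>* = - \<infinity>\<close> as well.\<close>

definition critical :: "real \<Rightarrow> bool" where
  "critical H \<longleftrightarrow> H > 0 \<and>
     (\<forall>\<kappa>. \<kappa> < 1 / H \<longrightarrow> (\<exists>t>0. L \<nu> (-t) < \<infinity> \<and> \<kappa> * loglap (-t) < t)) \<and>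
     (\<forall>\<alpha>. \<alpha> < H \<longrightarrow> (\<exists>t>0. theta_low \<nu> < ereal (-t) \<and> phi \<nu> (-t) > 0 \<and> \<alpha> < speed (-t)))"

text \<open>Here \<open>phi\<close> is positive on all of the negative axis, and \<open>H\<close> is
  the supremum of the speeds, which is also their limit at minus infinity by monotonicity.\<close>

lemma critical_infinite:
  assumes ng: "\<not> geometric \<nu>" and inf: "theta_star \<nu> = -\<infinity>"
  shows "\<exists>H. C_star \<nu> = 1 / H \<and> critical H"
proof -
  have low: "theta_low \<nu> < ereal \<theta>" for \<theta>
    using theta_star_approx[of \<theta>] inf by (metis ereal_less(6) ereal_less_eq(3) less_imp_le MInfty_neq_ereal(1) ereal_infty_less(2) order.strict_trans2)
  have fin: "L \<nu> \<theta> < \<infinity>" for \<theta> by (rule L_finite[OF low])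
  have phi_pos: "phi \<nu> \<theta> > 0" if "\<theta> \<le> 0" for \<theta>
  proof -
    obtain \<theta>' where \<theta>': "\<theta>' < \<theta>" "phi \<nu> \<theta>' > 0" using theta_star_approx[of \<theta>] inf by auto
    then show ?thesis using phi_mono[OF low, of \<theta>' \<theta>] that by linarith
  qed
  \<comment> \<open>Positivity of \<open>phi\<close> gives
    \<open>speed \<theta> < loglap \<theta> / (- \<theta>)\<close>; inserting this into the tangent
    at \<theta>, evaluated at -1, gives
    \<open>loglap \<theta> / (- \<theta>) \<le> loglap (-1)\<close>.\<close>
  have bd: "speed \<theta> \<le> loglap (-1)" if "\<theta> \<le> -1" for \<theta>
  proof -
    have "speed \<theta> * (- \<theta>) < loglap \<theta>" using phi_pos[of \<theta>] that by (simp add: phi_eq algebra_simps)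
    then have s: "speed \<theta> < loglap \<theta> / (- \<theta>)" using that by (simp add: field_simps)
    have "loglap (-1) \<ge> loglap \<theta> - (-1 - \<theta>) * speed \<theta>" by (rule loglap_tangent[OF low fin])
    moreover have "(-1 - \<theta>) * speed \<theta> \<le> (-1 - \<theta>) * (loglap \<theta> / (- \<theta>))"
      using s that by (intro mult_left_mono) auto
    moreover have "loglap \<theta> - (-1 - \<theta>) * (loglap \<theta> / (- \<theta>)) = loglap \<theta> / (- \<theta>)"
      using that by (simp add: field_simps)
    ultimately show ?thesis using s by linarith
  qed
  have bdd: "bdd_above (range speed)"
  proof (rule bdd_aboveI2)
    fix \<theta>
    show "speed \<theta> \<le> loglap (-1)"
      using bd[of "min \<theta> (-1)"] speed_antimono[OF low, of "min \<theta> (-1)" \<theta>] by linarith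
  qed
  define H where "H = (SUP \<theta>. speed \<theta>)"
  have le: "speed \<theta> \<le> H" for \<theta> unfolding H_def using bdd by (rule cSUP_upper2) auto
  have "H > 0" using le[of 0] speed_pos[OF ng low, of 0] by linarith
  have appr: "\<exists>\<theta>0. \<forall>\<theta>\<le>\<theta>0. speed \<theta> > \<alpha>" if "\<alpha> < H" for \<alpha>
  proof -
    obtain \<theta>0 where "speed \<theta>0 > \<alpha>" using \<open>\<alpha> < H\<close> less_cSUP_iff[OF _ bdd, of \<alpha>] unfolding H_def by blast
    then show ?thesis using speed_antimono[OF low] by (intro exI[of _ \<theta>0]) (auto intro: order.strict_trans2)
  qed
  have "(speed \<longlongrightarrow> H) at_bot"
  proof (rule order_tendstoI)
    fix a assume "a < H"
    then show "\<forall>\<^sub>F x in at_bot. a < speed x" using appr by (auto simp: eventually_at_bot_linorder)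
  next
    fix a assume "H < a"
    then show "\<forall>\<^sub>F x in at_bot. speed x < a" using le by (intro always_eventually allI) (rule order.strict_trans1)
  qed
  then have "((\<lambda>\<theta>. 1 / speed \<theta>) \<longlongrightarrow> 1 / H) at_bot"
    using \<open>H > 0\<close> by (intro tendsto_intros) auto
  then have "C_star \<nu> = 1 / H"
    unfolding C_star_eq_Lim using inf by (auto intro!: tendsto_Lim)
  moreover have "critical H"
    unfolding critical_def
  proof (intro conjI allI impI)
    fix \<kappa> assume \<kappa>: "\<kappa> < 1 / H"
    \<comment> \<open>As \<open>loglap (-t) \<le> loglap 0 + t * H\<close> and \<kappa> * H < 1, a
      large \<open>t\<close> beats the constant term. Writing \<open>max 0 \<kappa>\<close> covers
      negative \<kappa>, because \<open>loglap (-t)\<close> is nonnegative.\<close>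
    define t where "t = max 1 (\<bar>\<kappa>\<bar> * loglap 0 / (1 - max 0 \<kappa> * H) + 1)"
    have k: "max 0 \<kappa> * H < 1" using \<kappa> \<open>H > 0\<close> by (auto simp: max_def field_simps)
    have "t > 0" by (simp add: t_def)
    have l0: "loglap 0 > 0" using phi_pos[of 0] by (simp add: phi_eq)
    have "t > \<bar>\<kappa>\<bar> * loglap 0 / (1 - max 0 \<kappa> * H)" by (simp add: t_def less_max_iff_disj)
    then have t: "\<bar>\<kappa>\<bar> * loglap 0 < t * (1 - max 0 \<kappa> * H)" using k by (simp add: field_simps)
    have "loglap (-t) \<le> loglap 0 + t * H"
    proof -
      have "t * speed (-t) \<le> t * H" using \<open>t > 0\<close> le by (intro mult_left_mono) auto
      moreover have "loglap (-t) - t * speed (-t) \<le> loglap 0"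
        using phi_mono[OF low, of "-t" 0] \<open>t > 0\<close> by (simp add: phi_eq)
      ultimately show ?thesis by linarith
    qed
    then have "max 0 \<kappa> * loglap (-t) \<le> max 0 \<kappa> * (loglap 0 + t * H)"
      by (intro mult_left_mono) auto
    also have "\<dots> \<le> \<bar>\<kappa>\<bar> * loglap 0 + t * (max 0 \<kappa> * H)"
      using l0 by (simp add: algebra_simps mult_right_mono)
    also have "\<dots> < t" using t by (simp add: algebra_simps)
    finally have "max 0 \<kappa> * loglap (-t) < t" .
    moreover have "loglap (-t) \<ge> 0"
    proof -
      have "t * speed (-t) \<ge> 0" using \<open>t > 0\<close> speed_pos[OF ng low] by (simp add: less_imp_le)
      then show ?thesis using phi_pos[of "-t"] \<open>t > 0\<close> by (simp add: phi_eq)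
    qed
    ultimately have "\<kappa> * loglap (-t) < t"
      by (metis max.cobounded2 mult_right_mono order.strict_trans1)
    then show "\<exists>t>0. L \<nu> (-t) < \<infinity> \<and> \<kappa> * loglap (-t) < t" using fin \<open>t > 0\<close> by blast
  next
    fix \<alpha> assume "\<alpha> < H"
    then obtain \<theta>0 where "\<forall>\<theta>\<le>\<theta>0. speed \<theta> > \<alpha>" using appr by blast
    then show "\<exists>t>0. theta_low \<nu> < ereal (-t) \<and> phi \<nu> (-t) > 0 \<and> \<alpha> < speed (-t)"
      using phi_pos low by (intro exI[of _ "max 1 (-\<theta>0)"]) (auto simp: max_def)
  qed fact
  ultimately show ?thesis by blast
qed

text \<open>Follows from differentiability at \<theta> and convexity alone:
  \<open>speed (\<theta> + d)\<close> is at least minus the slope of the chord over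
  \<open>[\<theta> + d, \<theta> + 2 * d]\<close>, and that slope is
  \<open>2 * ?q (2 * d) - ?q d\<close>, with \<open>?q\<close> the difference quotient at
  \<theta>.\<close>

lemma speed_tendsto_right:
  assumes "theta_low \<nu> < ereal \<theta>"
  shows "(speed \<longlongrightarrow> speed \<theta>) (at_right \<theta>)"
proof -
  have low: "theta_low \<nu> < ereal (\<theta> + d)" if "d \<ge> 0" for d
    by (rule order.strict_trans2[OF assms]) (use that in auto)
  let ?q = "\<lambda>d. (loglap (\<theta> + d) - loglap \<theta>) / d"
  have q: "(?q \<longlongrightarrow> - speed \<theta>) (at_right 0)"
    using loglap_deriv[OF assms] unfolding DERIV_def by (rule tendsto_mono[rotated]) (auto simp: at_within_le_at)
  have "filterlim (\<lambda>d::real. 2 * d) (at_right 0) (at_right 0)" by real_asymp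
  from filterlim_compose[OF q this]
  have q2: "((\<lambda>d. 2 * ?q (2 * d) - ?q d) \<longlongrightarrow> 2 * - speed \<theta> - - speed \<theta>) (at_right 0)"
    by (intro tendsto_intros q) simp
  have "((\<lambda>d. speed (\<theta> + d)) \<longlongrightarrow> speed \<theta>) (at_right 0)"
  proof (rule tendsto_sandwich[where h="\<lambda>_. speed \<theta>"])
    show "((\<lambda>d. - (2 * ?q (2 * d) - ?q d)) \<longlongrightarrow> speed \<theta>) (at_right 0)"
      using tendsto_minus[OF q2] by simp
    show "\<forall>\<^sub>F d in at_right 0. speed (\<theta> + d) \<le> speed \<theta>"
      using speed_antimono[OF assms] by (auto simp: eventually_at_right_less eventually_at_filter)
    have "- (2 * ?q (2 * d) - ?q d) \<le> speed (\<theta> + d)" if "d > 0" for d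
    proof -
      have "loglap (\<theta> + 2 * d) \<ge> loglap (\<theta> + d) - (\<theta> + 2 * d - (\<theta> + d)) * speed (\<theta> + d)"
        using that by (intro loglap_tangent L_finite low) auto
      then show ?thesis using that by (simp add: field_simps)
    qed
    then show "\<forall>\<^sub>F d in at_right 0. - (2 * ?q (2 * d) - ?q d) \<le> speed (\<theta> + d)"
      by (auto simp: eventually_at_filter)
  qed auto
  then show ?thesis by (subst filterlim_at_right_to_0) (simp add: add.commute)
qed

text \<open>With \<open>-t\<close> equal to \<open>theta_star \<nu>\<close>, the equation
  \<open>phi = 0\<close> says that the tangent at \<open>-t\<close> passes through the origin. So
  this single \<open>t\<close> serves every \<kappa>, while every \<alpha> is reached by points
  slightly to the right of \<open>-t\<close> at which \<open>phi\<close> is positive.\<close>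

lemma critical_finite:
  assumes ng: "\<not> geometric \<nu>" and fin: "-\<infinity> < theta_star \<nu>" "theta_star \<nu> < 0"
    and low: "theta_low \<nu> < theta_star \<nu>" and phi0: "phi \<nu> (real_of_ereal (theta_star \<nu>)) = 0"
  obtains t where "t > 0" "theta_low \<nu> < ereal (-t)" "C_star \<nu> = 1 / speed (-t)" "speed (-t) > 0"
    "critical (speed (-t))" "loglap (-t) = t * speed (-t)"
proof -
  define t where "t = - real_of_ereal (theta_star \<nu>)"
  have ts: "theta_star \<nu> = ereal (-t)" using fin by (cases "theta_star \<nu>") (auto simp: t_def)
  have t: "t > 0" "theta_low \<nu> < ereal (-t)" using fin low ts by auto
  have sp: "speed (-t) > 0" by (rule speed_pos[OF ng t(2)])
  have g: "loglap (-t) = t * speed (-t)" using phi0 by (simp add: phi_eq ts)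
  have "((\<lambda>\<theta>. 1 / speed \<theta>) \<longlongrightarrow> 1 / speed (-t)) (at_right (-t))"
    using sp speed_tendsto_right[OF t(2)] by (intro tendsto_intros) auto
  then have C: "C_star \<nu> = 1 / speed (-t)"
    unfolding C_star_eq_Lim using ts by (auto intro!: tendsto_Lim)
  have "critical (speed (-t))"
    unfolding critical_def
  proof (intro conjI allI impI)
    fix \<kappa> assume "\<kappa> < 1 / speed (-t)"
    then have "\<kappa> * speed (-t) < 1" using sp by (simp add: field_simps)
    then have "t * (\<kappa> * speed (-t)) < t * 1" using t by (intro mult_strict_left_mono) auto
    then have "\<kappa> * loglap (-t) < t" by (simp add: g algebra_simps)
    then show "\<exists>t>0. L \<nu> (-t) < \<infinity> \<and> \<kappa> * loglap (-t) < t" using t L_finite by blast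
  next
    fix \<alpha> assume "\<alpha> < speed (-t)"
    then have "eventually (\<lambda>\<theta>. \<alpha> < speed \<theta>) (at_right (-t))"
      using speed_tendsto_right[OF t(2)] by (simp add: order_tendsto_iff)
    then obtain y where y: "y > -t" "\<And>\<theta>. -t < \<theta> \<Longrightarrow> \<theta> < y \<Longrightarrow> \<alpha> < speed \<theta>"
      by (auto simp: eventually_at_right_field)
    have "theta_star \<nu> < ereal (min y 0)" using ts y t by auto
    then obtain \<theta> where \<theta>: "\<theta> < min y 0" "theta_low \<nu> < ereal \<theta>" "phi \<nu> \<theta> > 0" "-t \<le> \<theta>"
      by (rule theta_star_approx) (simp add: ts)
    have "\<theta> \<noteq> -t" using \<theta>(3) phi0 by (auto simp: ts)
    then show "\<exists>t>0. theta_low \<nu> < ereal (-t) \<and> phi \<nu> (-t) > 0 \<and> \<alpha> < speed (-t)"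
      using \<theta> y by (intro exI[of _ "-\<theta>"]) auto
  qed fact
  then show ?thesis using that t sp C g by blast
qed

end

section \<open>Centred random walks staying nonnegative\<close>

text \<open>For the walk with steps \<mu> started at \<open>x\<close>: the probability that it is
  nonnegative at times 0 to \<open>l\<close> and ends in \<open>[0, c]\<close>. The recursion over
  the first step is the form that can be compared with the tree.\<close>

primrec survival :: "real measure \<Rightarrow> real \<Rightarrow> nat \<Rightarrow> real \<Rightarrow> real" where
  "survival \<mu> c 0 x = indicator {0..c} x"
| "survival \<mu> c (Suc l) x = indicator {0..} x * (\<integral>\<xi>. survival \<mu> c l (x + \<xi>) \<partial>\<mu>)"

lemma sum_rotate:
  fixes \<omega> :: "nat \<Rightarrow> real"
  assumes "r < k" "l \<le> k"
  shows "(\<Sum>i<l. \<omega> ((i + r) mod k)) =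
     (if r + l \<le> k then (\<Sum>i<r+l. \<omega> i) - (\<Sum>i<r. \<omega> i)
      else (\<Sum>i<k. \<omega> i) - (\<Sum>i<r. \<omega> i) + (\<Sum>i<r+l-k. \<omega> i))"
  using assms(2)
proof (induction l)
  case (Suc l)
  show ?case
  proof (cases "r + l < k")
    case True
    then show ?thesis using Suc by (auto simp: add.commute)
  next
    case False
    then have "(l + r) mod k = r + l - k"
      using Suc.prems assms(1) by (simp add: le_mod_geq add.commute)
    moreover have "r + Suc l - k = Suc (r + l - k)" using False by simp
    ultimately show ?thesis using Suc False by auto
  qed
qed (use assms in auto)

text \<open>Rotating a finite sequence so that it starts right after its minimal partial sum makes all
  partial sums nonnegative.\<close>

lemma rotation_exists:
  fixes \<omega> :: "nat \<Rightarrow> real"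
  assumes "k > 0" and total: "(\<Sum>i<k. \<omega> i) \<ge> 0"
  shows "\<exists>r<k. \<forall>l\<le>k. (\<Sum>i<l. \<omega> ((i + r) mod k)) \<ge> 0"
proof -
  let ?W = "\<lambda>l. \<Sum>i<l. \<omega> i"
  obtain r where r: "r < k" "\<And>l. l < k \<Longrightarrow> ?W r \<le> ?W l"
    using ex_min_if_finite[of "?W ` {..<k}"] assms by (auto simp: not_less lessThan_empty_iff)
  \<comment> \<open>The minimum was taken over indices below \<open>k\<close>; the index
    \<open>k\<close> is covered because the total is at least \<open>?W 0 = 0\<close>.\<close>
  have r': "?W r \<le> ?W l" if "l \<le> k" for l
    using r(2)[of l] r(2)[of 0] that total assms by (cases "l = k") auto
  have "(\<Sum>i<l. \<omega> ((i + r) mod k)) \<ge> 0" if "l \<le> k" for l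
  proof -
    have "r + l - k \<le> k" using r(1) that by linarith
    then show ?thesis
      unfolding sum_rotate[OF r(1) that]
      using r'[of "r + l"] r'[of "r + l - k"] total by auto
  qed
  then show ?thesis using r(1) by blast
qed

locale centered_step = prob_space \<mu> for \<mu> :: "real measure" +
  assumes sets_step[measurable_cong]: "sets \<mu> = sets borel"
    and square_integrable: "integrable \<mu> (\<lambda>x. x\<^sup>2)"
    and mean_zero: "(\<integral>x. x \<partial>\<mu>) = 0"
    and nondegenerate: "\<not> (AE x in \<mu>. x = 0)"
begin

sublocale seq: sequence_space \<mu> by standard

abbreviation "S \<equiv> seq.S"

definition window :: "nat \<Rightarrow> nat \<Rightarrow> (nat \<Rightarrow> real) \<Rightarrow> real" where
  "window r k \<omega> = (\<Sum>i<k. \<omega> (r + i))"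

lemma window_measurable[measurable]: "window r k \<in> borel_measurable S"
  unfolding window_def[abs_def] by measurable

lemma space_step: "space \<mu> = UNIV"
  using sets_eq_imp_space_eq[OF sets_step] by simp

lemma space_S: "space S = UNIV"
  by (simp add: space_PiM space_step PiE_UNIV_domain)

lemma step_integrable: "integrable \<mu> (\<lambda>x. x)"
  by (rule square_integrable_imp_integrable[OF _ square_integrable]) measurable

definition "mean_abs = (\<integral>x. \<bar>x\<bar> \<partial>\<mu>)"
definition "step_var = (\<integral>x. x\<^sup>2 \<partial>\<mu>)"

lemma mean_abs_pos: "mean_abs > 0"
proof -
  have "mean_abs \<noteq> 0"
    using nondegenerate integral_nonneg_eq_0_iff_AE[of \<mu> "\<lambda>x. \<bar>x\<bar>"] step_integrable
    unfolding mean_abs_def by auto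
  moreover have "mean_abs \<ge> 0" unfolding mean_abs_def by simp
  ultimately show ?thesis by simp
qed

lemma step_var_pos: "step_var > 0"
proof -
  have "step_var \<noteq> 0"
    using nondegenerate integral_nonneg_eq_0_iff_AE[OF square_integrable]
    unfolding step_var_def by auto
  moreover have "step_var \<ge> 0" unfolding step_var_def by simp
  ultimately show ?thesis by simp
qed

lemma nn_integral_iter:
  assumes [measurable]: "f \<in> borel_measurable S"
  shows "(\<integral>\<^sup>+\<omega>. f \<omega> \<partial>S) = (\<integral>\<^sup>+x. \<integral>\<^sup>+\<omega>. f (case_nat x \<omega>) \<partial>S \<partial>\<mu>)"
proof -
  have "(\<integral>\<^sup>+\<omega>. f \<omega> \<partial>S) = (\<integral>\<^sup>+\<omega>. f \<omega> \<partial>distr (\<mu> \<Otimes>\<^sub>M S) S (\<lambda>(s, \<omega>). case_nat s \<omega>))"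
    by (simp only: seq.PiM_iter)
  also have "\<dots> = (\<integral>\<^sup>+z. f ((\<lambda>(s, \<omega>). case_nat s \<omega>) z) \<partial>(\<mu> \<Otimes>\<^sub>M S))"
    by (rule nn_integral_distr) measurable
  also have "\<dots> = (\<integral>\<^sup>+x. \<integral>\<^sup>+\<omega>. f (case_nat x \<omega>) \<partial>S \<partial>\<mu>)"
    by (subst seq.P.nn_integral_fst[symmetric]) (auto simp: case_prod_beta')
  finally show ?thesis .
qed

lemma window_case_nat: "window 0 (Suc k) (case_nat x \<omega>) = x + window 0 k \<omega>"
  unfolding window_def by (subst sum.lessThan_Suc_shift) simp

lemma coordinate:
  "integrable S (\<lambda>\<omega>. \<omega> i)" "(\<integral>\<omega>. \<omega> i \<partial>S) = 0"
  "A \<in> sets borel \<Longrightarrow> seq.P.prob {\<omega>. \<omega> i \<in> A} = prob A"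
proof -
  have d: "distr S \<mu> (\<lambda>\<omega>. \<omega> i) = \<mu>"
    by (rule distr_PiM_component) (auto intro: prob_space_axioms)
  have "integrable (distr S \<mu> (\<lambda>\<omega>. \<omega> i)) (\<lambda>x. x)" unfolding d by (rule step_integrable)
  then show "integrable S (\<lambda>\<omega>. \<omega> i)" by (subst (asm) integrable_distr_eq) auto
  have "(\<integral>x. x \<partial>distr S \<mu> (\<lambda>\<omega>. \<omega> i)) = 0" unfolding d by (rule mean_zero)
  then show "(\<integral>\<omega>. \<omega> i \<partial>S) = 0" by (subst (asm) integral_distr) auto
  show "seq.P.prob {\<omega>. \<omega> i \<in> A} = prob A" if "A \<in> sets borel"
  proof -
    have "prob A = measure (distr S \<mu> (\<lambda>\<omega>. \<omega> i)) A" unfolding d ..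
    also have "\<dots> = seq.P.prob {\<omega>. \<omega> i \<in> A}"
      using that by (subst measure_distr) (auto simp: sets_step space_S vimage_def)
    finally show ?thesis ..
  qed
qed

lemma window_mean: "integrable S (window r k)" "(\<integral>\<omega>. window r k \<omega> \<partial>S) = 0"
  unfolding window_def[abs_def] using coordinate by auto

lemma window_square:
  "integrable S (\<lambda>\<omega>. (window 0 k \<omega>)\<^sup>2)" "(\<integral>\<omega>. (window 0 k \<omega>)\<^sup>2 \<partial>S) = k * step_var"
proof -
  have *: "(\<integral>\<^sup>+\<omega>. ennreal ((window 0 k \<omega>)\<^sup>2) \<partial>S) = ennreal (k * step_var)" for k
  proof (induction k)
    case 0
    show ?case by (simp add: window_def)
  next
    case (Suc k)
    have i: "integrable S (\<lambda>\<omega>. (window 0 k \<omega>)\<^sup>2)"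
      using Suc by (intro integrableI_bounded) auto
    have I: "(\<integral>\<omega>. (window 0 k \<omega>)\<^sup>2 \<partial>S) = k * step_var"
      using Suc step_var_pos by (subst integral_eq_nn_integral) auto
    have "(\<integral>\<^sup>+\<omega>. ennreal ((window 0 (Suc k) \<omega>)\<^sup>2) \<partial>S) =
        (\<integral>\<^sup>+x. \<integral>\<^sup>+\<omega>. ennreal ((x + window 0 k \<omega>)\<^sup>2) \<partial>S \<partial>\<mu>)"
      by (subst nn_integral_iter) (auto simp: window_case_nat)
    also have "\<dots> = (\<integral>\<^sup>+x. ennreal (x\<^sup>2 + k * step_var) \<partial>\<mu>)"
    proof (intro nn_integral_cong)
      fix x
      have eq: "(x + window 0 k \<omega>)\<^sup>2 = x\<^sup>2 + 2 * x * window 0 k \<omega> + (window 0 k \<omega>)\<^sup>2" for \<omega>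
        by (simp add: power2_sum)
      have int: "integrable S (\<lambda>\<omega>. (x + window 0 k \<omega>)\<^sup>2)"
        unfolding eq using i window_mean by auto
      have "(\<integral>\<omega>. (x + window 0 k \<omega>)\<^sup>2 \<partial>S) = x\<^sup>2 + k * step_var"
        unfolding eq using i window_mean I by (simp add: seq.P.prob_space)
      then show "(\<integral>\<^sup>+\<omega>. ennreal ((x + window 0 k \<omega>)\<^sup>2) \<partial>S) = ennreal (x\<^sup>2 + k * step_var)"
        using nn_integral_eq_integral[OF int] by simp
    qed
    also have "\<dots> = ennreal (\<integral>x. x\<^sup>2 + k * step_var \<partial>\<mu>)"
      using square_integrable step_var_pos by (intro nn_integral_eq_integral) auto
    also have "(\<integral>x. x\<^sup>2 + k * step_var \<partial>\<mu>) = Suc k * step_var"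
      using square_integrable by (simp add: prob_space step_var_def algebra_simps)
    finally show ?case .
  qed
  show "integrable S (\<lambda>\<omega>. (window 0 k \<omega>)\<^sup>2)"
    using *[of k] by (intro integrableI_bounded) auto
  show "(\<integral>\<omega>. (window 0 k \<omega>)\<^sup>2 \<partial>S) = k * step_var"
    using * step_var_pos by (subst integral_eq_nn_integral) auto
qed

text \<open>Condition on the first step: the remaining ones have mean zero, so by Jensen averaging
  over them cannot decrease the absolute value.\<close>

lemma window_abs:
  assumes "k > 0"
  shows "(\<integral>\<omega>. \<bar>window 0 k \<omega>\<bar> \<partial>S) \<ge> mean_abs"
proof -
  obtain l where k: "k = Suc l" using assms by (cases k) auto
  have "ennreal mean_abs = (\<integral>\<^sup>+x. ennreal \<bar>x\<bar> \<partial>\<mu>)"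
    unfolding mean_abs_def using step_integrable by (subst nn_integral_eq_integral) auto
  also have "\<dots> \<le> (\<integral>\<^sup>+x. \<integral>\<^sup>+\<omega>. ennreal \<bar>x + window 0 l \<omega>\<bar> \<partial>S \<partial>\<mu>)"
  proof (intro nn_integral_mono)
    fix x
    have "\<bar>x\<bar> = \<bar>\<integral>\<omega>. x + window 0 l \<omega> \<partial>S\<bar>"
      using window_mean by (simp add: seq.P.prob_space)
    also have "\<dots> \<le> (\<integral>\<omega>. \<bar>x + window 0 l \<omega>\<bar> \<partial>S)" by (rule integral_abs_bound)
    finally have "ennreal \<bar>x\<bar> \<le> ennreal (\<integral>\<omega>. \<bar>x + window 0 l \<omega>\<bar> \<partial>S)" by (rule ennreal_leI)
    also have "\<dots> = (\<integral>\<^sup>+\<omega>. ennreal \<bar>x + window 0 l \<omega>\<bar> \<partial>S)"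
      using window_mean by (subst nn_integral_eq_integral) auto
    finally show "ennreal \<bar>x\<bar> \<le> (\<integral>\<^sup>+\<omega>. ennreal \<bar>x + window 0 l \<omega>\<bar> \<partial>S)" .
  qed
  also have "\<dots> = (\<integral>\<^sup>+\<omega>. ennreal \<bar>window 0 k \<omega>\<bar> \<partial>S)"
    unfolding k by (subst nn_integral_iter) (auto simp: window_case_nat)
  also have "\<dots> = ennreal (\<integral>\<omega>. \<bar>window 0 k \<omega>\<bar> \<partial>S)"
    using window_mean by (subst nn_integral_eq_integral) auto
  finally show ?thesis by (simp add: integral_nonneg_AE ennreal_le_iff)
qed

definition "sign_prob = mean_abs\<^sup>2 / (16 * step_var)"

lemma sign_prob_pos: "sign_prob > 0"
  unfolding sign_prob_def using mean_abs_pos step_var_pos by simp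

text \<open>A Paley-Zygmund type argument: either signed part of the position has mean at least
  \<open>mean_abs / 2\<close>, while the second moment is only \<open>k * step_var\<close>, so
  neither sign can be too rare.\<close>

lemma window_sign:
  assumes "k > 0" "s = 1 \<or> s = -1"
  shows "seq.P.prob {\<omega>. s * window 0 k \<omega> \<ge> 0} \<ge> sign_prob / k"
proof -
  \<comment> \<open>Truncation level at which the second-moment term \<open>k * step_var / R\<close>
    is \<open>mean_abs / 4\<close>, that is half of \<open>mean_abs / 2\<close>; the rest must come
    from \<open>R\<close> times the probability.\<close>
  define R where "R = 4 * k * step_var / mean_abs"
  have R: "R > 0" using assms mean_abs_pos step_var_pos by (simp add: R_def)
  let ?A = "{\<omega>. s * window 0 k \<omega> \<ge> 0}"
  have A: "?A \<in> sets S"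
  proof -
    have "{\<omega>\<in>space S. s * window 0 k \<omega> \<ge> 0} \<in> sets S" by measurable
    then show ?thesis by (simp add: space_S)
  qed
  have intA: "integrable S (indicator ?A :: _ \<Rightarrow> real)" using A by (simp add: seq.P.emeasure_eq_measure)
  have "mean_abs / 2 \<le> (\<integral>\<omega>. (\<bar>window 0 k \<omega>\<bar> + s * window 0 k \<omega>) / 2 \<partial>S)"
    using window_mean window_abs[OF assms(1)] by simp
  also have "\<dots> \<le> (\<integral>\<omega>. R * indicator ?A \<omega> + (window 0 k \<omega>)\<^sup>2 / R \<partial>S)"
  proof (rule integral_mono)
    show "integrable S (\<lambda>\<omega>. R * indicator ?A \<omega> + (window 0 k \<omega>)\<^sup>2 / R)"
      using window_square intA by auto
    fix \<omega>
    let ?w = "window 0 k \<omega>"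
    have *: "\<bar>?w\<bar> \<le> R + ?w\<^sup>2 / R"
    proof (cases "\<bar>?w\<bar> \<le> R")
      case False
      then have "R * \<bar>?w\<bar> \<le> \<bar>?w\<bar> * \<bar>?w\<bar>" by (intro mult_right_mono) auto
      then have "\<bar>?w\<bar> \<le> ?w\<^sup>2 / R" using R by (simp add: field_simps power2_eq_square)
      then show ?thesis using R by linarith
    qed (use R in \<open>auto intro: add_increasing2\<close>)
    show "(\<bar>?w\<bar> + s * ?w) / 2 \<le> R * indicator ?A \<omega> + ?w\<^sup>2 / R"
    proof (cases "s * ?w \<ge> 0")
      case True
      then have "s * ?w = \<bar>?w\<bar>" using assms(2) by auto
      then show ?thesis using * True by simp
    next
      case False
      then have "s * ?w = - \<bar>?w\<bar>" using assms(2) by auto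
      then show ?thesis using False R by simp
    qed
  qed (use window_mean in auto)
  also have "\<dots> = R * seq.P.prob ?A + k * step_var / R"
    using window_square intA A by (simp add: space_S)
  also have "k * step_var / R = mean_abs / 4" using assms mean_abs_pos step_var_pos by (simp add: R_def)
  finally have "mean_abs / 4 \<le> R * seq.P.prob ?A" by simp
  then have "mean_abs / 4 / R \<le> seq.P.prob ?A" using R by (simp add: field_simps)
  moreover have "mean_abs / 4 / R = sign_prob / k"
    using assms mean_abs_pos step_var_pos by (simp add: R_def sign_prob_def power2_eq_square)
  ultimately show ?thesis by simp
qed

text \<open>\<open>comb_seq r\<close> follows the first sequence for \<open>r\<close> coordinates
  and then the second one, so this is independence of the first \<open>r\<close> steps from the
  later ones.\<close>

lemma prob_comb:
  assumes [measurable]: "Measurable.pred S P" "Measurable.pred S Q"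
    and comb: "\<And>\<omega> \<omega>'. R (comb_seq r \<omega> \<omega>') \<longleftrightarrow> P \<omega> \<and> Q \<omega>'"
    and [measurable]: "Measurable.pred S R"
  shows "seq.P.prob {\<omega>. R \<omega>} = seq.P.prob {\<omega>. P \<omega>} * seq.P.prob {\<omega>. Q \<omega>}"
proof -
  have m: "{\<omega>. P \<omega>} \<in> sets S" "{\<omega>. Q \<omega>} \<in> sets S" "{\<omega>. R \<omega>} \<in> sets S"
    using assms(1,2,4) by (simp_all add: pred_def space_S)
  have "emeasure S {\<omega>. R \<omega>} = emeasure (distr (S \<Otimes>\<^sub>M S) S (\<lambda>(\<omega>, \<omega>'). comb_seq r \<omega> \<omega>')) {\<omega>. R \<omega>}"
    by (simp only: seq.PiM_comb_seq)
  also have "\<dots> = emeasure (S \<Otimes>\<^sub>M S) ({\<omega>. P \<omega>} \<times> {\<omega>. Q \<omega>})"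
    using m by (subst emeasure_distr[OF measurable_comb_seq])
      (auto simp: space_pair_measure space_S comb intro!: arg_cong[where f="emeasure (S \<Otimes>\<^sub>M S)"])
  also have "\<dots> = emeasure S {\<omega>. P \<omega>} * emeasure S {\<omega>. Q \<omega>}"
    using m by (intro seq.P.emeasure_pair_measure_Times) auto
  finally show ?thesis
    by (simp add: seq.P.emeasure_eq_measure flip: ennreal_mult')
qed

lemma window_shift:
  assumes [measurable]: "A \<in> sets borel"
  shows "seq.P.prob {\<omega>. window r k \<omega> \<in> A} = seq.P.prob {\<omega>. window 0 k \<omega> \<in> A}"
proof -
  have "seq.P.prob {\<omega>. window r k \<omega> \<in> A} =
      seq.P.prob {\<omega>. True} * seq.P.prob {\<omega>. window 0 k \<omega> \<in> A}"
    by (rule prob_comb[where r=r]) (auto simp: window_def comb_seq_def)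
  then show ?thesis using seq.P.prob_space by (simp add: space_S)
qed

definition "tail u = prob {x. \<bar>x\<bar> > u}"

text \<open>The windows \<open>window r k\<close> (\<open>0 \<le> r \<le> k\<close>) interpolate between two independent copies
  of the \<open>k\<close>-th position of the walk; if these have opposite signs, then some window is close to
  zero. This replaces a local limit theorem.\<close>

lemma prob_near_zero:
  assumes k: "k > 0"
  shows "seq.P.prob {\<omega>. window 0 k \<omega> \<in> {0..c}} \<ge> (sign_prob\<^sup>2 / (real k)\<^sup>2 - 2 * real k * tail (c / 2)) / k"
proof -
  let ?E = "{\<omega>. window 0 k \<omega> \<le> 0 \<and> window k k \<omega> \<ge> 0}"
  let ?F = "\<lambda>r. {\<omega>. window r k \<omega> \<in> {0..c}}"
  let ?T = "\<lambda>i. {\<omega> :: nat \<Rightarrow> real. \<bar>\<omega> i\<bar> > c / 2}"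
  have meas: "?F r \<in> sets S" "?T i \<in> sets S" for r i
  proof -
    have "{\<omega>\<in>space S. window r k \<omega> \<in> {0..c}} \<in> sets S" "{\<omega>\<in>space S. \<bar>\<omega> i\<bar> > c / 2} \<in> sets S"
      by measurable
    then show "?F r \<in> sets S" "?T i \<in> sets S" by (simp_all add: space_S)
  qed
  have "seq.P.prob ?E = seq.P.prob {\<omega>. window 0 k \<omega> \<le> 0} * seq.P.prob {\<omega>. window 0 k \<omega> \<ge> 0}"
  proof (rule prob_comb[where r=k])
    fix \<omega> \<omega>' :: "nat \<Rightarrow> real"
    have "window 0 k (comb_seq k \<omega> \<omega>') = window 0 k \<omega>"
      "window k k (comb_seq k \<omega> \<omega>') = window 0 k \<omega>'"
      by (auto simp: window_def comb_seq_def intro!: sum.cong)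
    then show "window 0 k (comb_seq k \<omega> \<omega>') \<le> 0 \<and> 0 \<le> window k k (comb_seq k \<omega> \<omega>') \<longleftrightarrow>
      window 0 k \<omega> \<le> 0 \<and> 0 \<le> window 0 k \<omega>'" by simp
  qed measurable
  moreover have "\<dots> \<ge> (sign_prob / k) * (sign_prob / k)"
    using window_sign[OF k, of 1] window_sign[OF k, of "-1"] sign_prob_pos by (intro mult_mono) auto
  ultimately have 1: "seq.P.prob ?E \<ge> sign_prob\<^sup>2 / (real k)\<^sup>2" by (simp add: power2_eq_square)
  have "?E \<subseteq> (\<Union>r\<in>{1..k}. ?F r) \<union> (\<Union>i\<in>{..<2*k}. ?T i)"
  proof (rule subsetI, rule ccontr)
    fix \<omega> assume E: "\<omega> \<in> ?E" and n: "\<omega> \<notin> (\<Union>r\<in>{1..k}. ?F r) \<union> (\<Union>i\<in>{..<2*k}. ?T i)"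
    have \<omega>: "window 0 k \<omega> \<le> 0" "window k k \<omega> \<ge> 0" using E by auto
    have nF: "\<not> (0 \<le> window r k \<omega> \<and> window r k \<omega> \<le> c)" if "r \<in> {1..k}" for r
      using n that by auto
    have nT: "\<bar>\<omega> i\<bar> \<le> c / 2" if "i < 2 * k" for i
      using n that by (auto simp: not_less)
    have step: "window (Suc r) k \<omega> = window r k \<omega> + \<omega> (r + k) - \<omega> r" for r
    proof -
      have "window r (Suc k) \<omega> = window r k \<omega> + \<omega> (r + k)" by (simp add: window_def)
      moreover have "window r (Suc k) \<omega> = \<omega> r + window (Suc r) k \<omega>"
        unfolding window_def by (subst sum.lessThan_Suc_shift) simp
      ultimately show ?thesis by simp
    qed
    \<comment> \<open>Consecutive windows differ by two steps, hence by at most \<open>c\<close>,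
      and cannot jump over \<open>[0, c]\<close>. Strictness is claimed for \<open>r > 0\<close>
      only: \<open>window 0 k\<close> may be 0 and is not among the excluded windows.\<close>
    have "r \<le> k \<Longrightarrow> window r k \<omega> \<le> 0 \<and> (r > 0 \<longrightarrow> window r k \<omega> < 0)" for r
    proof (induction r)
      case (Suc r)
      have "window (Suc r) k \<omega> \<le> c"
        using Suc nT[of "r + k"] nT[of r] unfolding step by linarith
      then show ?case using nF[of "Suc r"] Suc.prems by force
    qed (use \<omega> in auto)
    from this[of k] show False using \<omega> k by auto
  qed
  then have "seq.P.prob ?E \<le> seq.P.prob ((\<Union>r\<in>{1..k}. ?F r) \<union> (\<Union>i\<in>{..<2*k}. ?T i))"
    using meas by (intro seq.P.finite_measure_mono) auto
  also have "\<dots> \<le> seq.P.prob (\<Union>r\<in>{1..k}. ?F r) + seq.P.prob (\<Union>i\<in>{..<2*k}. ?T i)"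
    using meas by (intro measure_Un_le) auto
  also have "\<dots> \<le> (\<Sum>r\<in>{1..k}. seq.P.prob (?F r)) + (\<Sum>i\<in>{..<2*k}. seq.P.prob (?T i))"
    using meas by (intro add_mono seq.P.finite_measure_subadditive_finite) auto
  also have "\<dots> = k * seq.P.prob (?F 0) + 2 * real k * tail (c / 2)"
  proof -
    have "seq.P.prob (?T i) = tail (c / 2)" for i
      using coordinate(3)[of "{x. \<bar>x\<bar> > c / 2}" i] by (simp add: tail_def)
    moreover have "(\<Sum>r\<in>{1..k}. seq.P.prob (?F r)) = (\<Sum>r\<in>{1..k}. seq.P.prob (?F 0))"
      by (intro sum.cong refl window_shift) simp
    ultimately show ?thesis by simp
  qed
  finally have "sign_prob\<^sup>2 / (real k)\<^sup>2 - 2 * real k * tail (c / 2) \<le> k * seq.P.prob (?F 0)" using 1 by simp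
  then show ?thesis using k by (simp add: field_simps)
qed

text \<open>Exchangeability of an i.i.d. sequence: the rotation of the first \<open>k\<close>
  coordinates, continued by the identity, is an injective reindexing.\<close>

lemma prob_rotate:
  assumes [measurable]: "Measurable.pred S P" and "r < k"
  shows "seq.P.prob {\<omega>. P (\<lambda>n. \<omega> (if n < k then (n + r) mod k else n))} = seq.P.prob {\<omega>. P \<omega>}"
proof -
  let ?f = "\<lambda>n. if n < k then (n + r) mod k else n"
  have inj: "inj ?f"
  proof (rule injI)
    fix m n assume eq: "?f m = ?f n"
    have lt: "(m + r) mod k < k" "(n + r) mod k < k" using assms by auto
    show "m = n"
    proof (cases "m < k \<and> n < k")
      case True
      have m: "(l + r) mod k = (if l + r < k then l + r else l + r - k)" if "l < k" for l
        using that assms(2) by (simp add: le_mod_geq)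
      show ?thesis using True eq assms(2) by (auto simp: m split: if_splits)
    qed (use eq lt in \<open>auto split: if_splits\<close>)
  qed
  have "distr S S (\<lambda>\<omega>. \<lambda>n\<in>UNIV. \<omega> (?f n)) = S"
    using distr_PiM_reindex[of UNIV "\<lambda>_. \<mu>" ?f UNIV] inj prob_space_axioms by simp
  moreover have "(\<lambda>\<omega> :: nat \<Rightarrow> real. \<lambda>n\<in>UNIV. \<omega> (?f n)) = (\<lambda>\<omega> n. \<omega> (?f n))"
    by (intro ext) (simp only: restrict_UNIV)
  ultimately have d: "distr S S (\<lambda>\<omega> n. \<omega> (?f n)) = S" by argo
  have [measurable]: "(\<lambda>\<omega> n. \<omega> (?f n)) \<in> S \<rightarrow>\<^sub>M S"
    by (rule measurable_PiM_single') (auto simp: space_PiM space_step)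
  have m: "{\<omega>. P \<omega>} \<in> sets S" using assms(1) by (simp add: pred_def space_S)
  have "seq.P.prob {\<omega>. P \<omega>} = measure (distr S S (\<lambda>\<omega> n. \<omega> (?f n))) {\<omega>. P \<omega>}"
    unfolding d ..
  also have "\<dots> = seq.P.prob {\<omega>. P (\<lambda>n. \<omega> (?f n))}"
    using m by (subst measure_distr) (auto simp: space_S vimage_def)
  finally show ?thesis ..
qed

text \<open>Every path ending in \<open>[0, c]\<close> has a rotation that stays nonnegative.
  Rotations keep the endpoint and the law, so the union bound over \<open>k\<close> equally likely
  events costs only the factor \<open>1 / k\<close>.\<close>

lemma prob_stay_nonneg:
  assumes k: "k > 0"
  shows "seq.P.prob {\<omega>. (\<forall>l\<le>k. window 0 l \<omega> \<ge> 0) \<and> window 0 k \<omega> \<le> c} \<ge>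
    seq.P.prob {\<omega>. window 0 k \<omega> \<in> {0..c}} / k"
proof -
  define good where "good \<omega> \<longleftrightarrow> (\<forall>l\<le>k. window 0 l \<omega> \<ge> 0) \<and> window 0 k \<omega> \<le> c" for \<omega>
  define rot where "rot r n = (if n < k then (n + r) mod k else n)" for r n
  have [measurable]: "Measurable.pred S good" unfolding good_def by measurable
  have [measurable]: "(\<lambda>\<omega> n. \<omega> (rot r n)) \<in> S \<rightarrow>\<^sub>M S" for r
    by (rule measurable_PiM_single') (auto simp: space_PiM space_step)
  have m: "{\<omega>. good (\<lambda>n. \<omega> (rot r n))} \<in> sets S" for r
  proof -
    have "{\<omega>\<in>space S. good (\<lambda>n. \<omega> (rot r n))} \<in> sets S" by measurable
    then show ?thesis by (simp add: space_S)
  qed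
  have "{\<omega>. window 0 k \<omega> \<in> {0..c}} \<subseteq> (\<Union>r<k. {\<omega>. good (\<lambda>n. \<omega> (rot r n))})"
  proof safe
    fix \<omega> assume \<omega>: "window 0 k \<omega> \<in> {0..c}"
    obtain r where r: "r < k" "\<And>l. l \<le> k \<Longrightarrow> (\<Sum>i<l. \<omega> ((i + r) mod k)) \<ge> 0"
      using rotation_exists[OF k, of \<omega>] \<omega> by (auto simp: window_def)
    have w: "window 0 l (\<lambda>n. \<omega> (rot r n)) = (\<Sum>i<l. \<omega> ((i + r) mod k))" if "l \<le> k" for l
      unfolding window_def rot_def using that by (intro sum.cong) auto
    have "window 0 k (\<lambda>n. \<omega> (rot r n)) = window 0 k \<omega>"
      unfolding w[OF order_refl] sum_rotate[OF r(1) order_refl] by (auto simp: window_def)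
    then have "good (\<lambda>n. \<omega> (rot r n))"
      unfolding good_def using w r \<omega> by auto
    then show "\<omega> \<in> (\<Union>r<k. {\<omega>. good (\<lambda>n. \<omega> (rot r n))})" using r by auto
  qed
  then have "seq.P.prob {\<omega>. window 0 k \<omega> \<in> {0..c}} \<le> seq.P.prob (\<Union>r<k. {\<omega>. good (\<lambda>n. \<omega> (rot r n))})"
    using m by (intro seq.P.finite_measure_mono) auto
  also have "\<dots> \<le> (\<Sum>r<k. seq.P.prob {\<omega>. good (\<lambda>n. \<omega> (rot r n))})"
    using m by (intro seq.P.finite_measure_subadditive_finite) auto
  also have "\<dots> = (\<Sum>r<k. seq.P.prob {\<omega>. good \<omega>})"
    by (intro sum.cong refl) (auto simp: rot_def prob_rotate)
  finally show ?thesis using k unfolding good_def by (simp add: field_simps)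
qed

lemma survival_bounds:
  "survival \<mu> c l \<in> borel_measurable borel \<and> (\<forall>x. 0 \<le> survival \<mu> c l x \<and> survival \<mu> c l x \<le> 1)"
proof (induction l)
  case 0
  have "survival \<mu> c 0 = indicator {0..c}" by (rule ext) simp
  then show ?case by (auto simp: indicator_def)
next
  case (Suc l)
  then have [measurable]: "survival \<mu> c l \<in> borel_measurable borel" by blast
  have "survival \<mu> c (Suc l) = (\<lambda>x. indicator {0..} x * (\<integral>\<xi>. survival \<mu> c l (x + \<xi>) \<partial>\<mu>))"
    by (rule ext) simp
  moreover have "(\<lambda>x. indicator {0..} x * (\<integral>\<xi>. survival \<mu> c l (x + \<xi>) \<partial>\<mu>)) \<in> borel_measurable borel"
    by measurable
  moreover have "0 \<le> (\<integral>\<xi>. survival \<mu> c l (x + \<xi>) \<partial>\<mu>)" for x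
    using Suc by (intro integral_nonneg_AE) auto
  moreover have "(\<integral>\<xi>. survival \<mu> c l (x + \<xi>) \<partial>\<mu>) \<le> 1" for x
    using Suc by (intro integral_le_const integrable_const_bound[where B=1]) auto
  ultimately show ?case by (auto simp: indicator_def)
qed

lemma survival_eq_prob:
  "survival \<mu> c k x = seq.P.prob {\<omega>. (\<forall>l\<le>k. x + window 0 l \<omega> \<ge> 0) \<and> x + window 0 k \<omega> \<le> c}"
proof (induction k arbitrary: x)
  case 0
  have "space S = UNIV" by (rule space_S)
  then show ?case using seq.P.prob_space by (auto simp: window_def indicator_def)
next
  case (Suc k)
  let ?G = "\<lambda>k x \<omega>. (\<forall>l\<le>k. x + window 0 l \<omega> \<ge> 0) \<and> x + window 0 k \<omega> \<le> c"
  have mG: "{\<omega>. ?G k x \<omega>} \<in> sets S" for k x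
  proof -
    have "{\<omega>\<in>space S. ?G k x \<omega>} \<in> sets S" by measurable
    then show ?thesis by (simp add: space_S)
  qed
  have all: "(\<forall>l\<le>Suc k. Q l) \<longleftrightarrow> Q 0 \<and> (\<forall>l\<le>k. Q (Suc l))" for Q
    by (simp only: less_Suc_eq_le[symmetric] All_less_Suc2)
  have G: "?G (Suc k) x (case_nat \<xi> \<omega>) \<longleftrightarrow> x \<ge> 0 \<and> ?G k (x + \<xi>) \<omega>" for \<xi> \<omega>
    unfolding all by (simp add: window_case_nat) (simp add: window_def add.assoc)
  have "emeasure S {\<omega>. ?G (Suc k) x \<omega>} = (\<integral>\<^sup>+\<omega>. indicator {\<omega>. ?G (Suc k) x \<omega>} \<omega> \<partial>S)"
    using mG by simp
  also have "\<dots> = (\<integral>\<^sup>+\<xi>. \<integral>\<^sup>+\<omega>. indicator {\<omega>. ?G (Suc k) x \<omega>} (case_nat \<xi> \<omega>) \<partial>S \<partial>\<mu>)"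
    using mG by (intro nn_integral_iter) simp
  also have "\<dots> = (\<integral>\<^sup>+\<xi>. ennreal (indicator {0..} x * survival \<mu> c k (x + \<xi>)) \<partial>\<mu>)"
  proof (intro nn_integral_cong)
    fix \<xi>
    have "(\<integral>\<^sup>+\<omega>. indicator {\<omega>. ?G (Suc k) x \<omega>} (case_nat \<xi> \<omega>) \<partial>S) =
        (\<integral>\<^sup>+\<omega>. indicator {0..} x * indicator {\<omega>. ?G k (x + \<xi>) \<omega>} \<omega> \<partial>S)"
      using G by (intro nn_integral_cong) (auto simp: indicator_def)
    also have "\<dots> = indicator {0..} x * emeasure S {\<omega>. ?G k (x + \<xi>) \<omega>}"
      using mG by (simp add: nn_integral_cmult)
    also have "\<dots> = ennreal (indicator {0..} x * survival \<mu> c k (x + \<xi>))"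
      unfolding Suc.IH by (simp add: seq.P.emeasure_eq_measure indicator_def)
    finally show "(\<integral>\<^sup>+\<omega>. indicator {\<omega>. ?G (Suc k) x \<omega>} (case_nat \<xi> \<omega>) \<partial>S) =
      ennreal (indicator {0..} x * survival \<mu> c k (x + \<xi>))" .
  qed
  also have "\<dots> = ennreal (\<integral>\<xi>. indicator {0..} x * survival \<mu> c k (x + \<xi>) \<partial>\<mu>)"
  proof (intro nn_integral_eq_integral)
    have [measurable]: "survival \<mu> c k \<in> borel_measurable borel" using survival_bounds by blast
    show "integrable \<mu> (\<lambda>\<xi>. indicator {0..} x * survival \<mu> c k (x + \<xi>))"
      using survival_bounds by (intro integrable_const_bound[where B=1]) (auto simp: indicator_def)
  qed (use survival_bounds in auto)
  also have "(\<integral>\<xi>. indicator {0..} x * survival \<mu> c k (x + \<xi>) \<partial>\<mu>) = survival \<mu> c (Suc k) x"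
    by simp
  finally show ?case
    using survival_bounds[of c "Suc k"] by (simp add: seq.P.emeasure_eq_measure)
qed

lemma survival_lower_bound:
  assumes "k > 0"
  shows "survival \<mu> c k 0 \<ge> (sign_prob\<^sup>2 / (real k)\<^sup>2 - 2 * real k * tail (c / 2)) / (real k)\<^sup>2"
proof -
  have "(sign_prob\<^sup>2 / (real k)\<^sup>2 - 2 * real k * tail (c / 2)) / (real k)\<^sup>2 = (sign_prob\<^sup>2 / (real k)\<^sup>2 - 2 * real k * tail (c / 2)) / k / k"
    by (simp add: power2_eq_square)
  also have "\<dots> \<le> seq.P.prob {\<omega>. window 0 k \<omega> \<in> {0..c}} / k"
    by (rule divide_right_mono[OF prob_near_zero[OF assms]]) simp
  also have "\<dots> \<le> survival \<mu> c k 0"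
    using prob_stay_nonneg[OF assms, of c] by (simp add: survival_eq_prob)
  finally show ?thesis .
qed

end

section \<open>The tree of boxes\<close>

lemma box_size_Cons: "box_size e (j # i) = mass (e []) j * box_size (\<lambda>u. e (j # u)) i"
  unfolding box_size_def length_Cons by (subst prod.lessThan_Suc_shift) simp

lemma box_size_nonneg: "box_size e i \<ge> 0"
  unfolding box_size_def by (intro prod_nonneg) auto

lemma measurable_mass_prob_measures[measurable]:
  "f \<in> N \<rightarrow>\<^sub>M prob_measures \<Longrightarrow> (\<lambda>x. mass (f x) j) \<in> borel_measurable N"
  by (rule measurable_compose[OF _ measurable_measure_prob_algebra]) auto

lemma measurable_box_size[measurable (raw)]:
  assumes "\<And>u. (\<lambda>x. f x u) \<in> N \<rightarrow>\<^sub>M prob_measures"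
  shows "(\<lambda>x. box_size (f x) i) \<in> borel_measurable N"
  unfolding box_size_def using assms by measurable

text \<open>The threshold is on a logarithmic scale, so that passing to the \<open>j\<close>-th
  child shifts it by minus the logarithm of that child's mass.\<close>

definition has_small :: "nat \<Rightarrow> real \<Rightarrow> (nat list \<Rightarrow> nat measure) \<Rightarrow> bool" where
  "has_small k s e \<longleftrightarrow> (\<exists>i. length i = k \<and> 0 < box_size e i \<and> box_size e i \<le> exp s)"

lemma measurable_has_small[measurable (raw)]:
  assumes [measurable]: "\<And>u. (\<lambda>x. f x u) \<in> N \<rightarrow>\<^sub>M prob_measures"
  shows "Measurable.pred N (\<lambda>x. has_small k s (f x))"
  unfolding has_small_def by measurable

lemma has_small_Cons:
  assumes "mass (e []) j > 0" "has_small k (s - ln (mass (e []) j)) (\<lambda>u. e (j # u))"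
  shows "has_small (Suc k) s e"
proof -
  obtain i where i: "length i = k" "0 < box_size (\<lambda>u. e (j # u)) i"
    "box_size (\<lambda>u. e (j # u)) i \<le> exp (s - ln (mass (e []) j))"
    using assms(2) by (auto simp: has_small_def)
  have "mass (e []) j * box_size (\<lambda>u. e (j # u)) i \<le> mass (e []) j * exp (s - ln (mass (e []) j))"
    using i assms(1) by (intro mult_left_mono) auto
  also have "\<dots> = exp s" using assms(1) by (simp add: exp_diff)
  finally show ?thesis
    unfolding has_small_def using i assms(1) by (intro exI[of _ "j # i"]) (simp add: box_size_Cons)
qed

locale box_tree = prob_space M + law: box_law \<nu>
  for M :: "'a measure" and \<nu> :: "nat measure measure" +
  fixes \<rho> :: "nat list \<Rightarrow> 'a \<Rightarrow> nat measure"
  assumes env_indep: "indep_vars (\<lambda>_. prob_measures) \<rho> UNIV"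
    and env_law: "distr M prob_measures (\<rho> i) = \<nu>"
begin

lemma env_measurable[measurable]: "\<rho> i \<in> M \<rightarrow>\<^sub>M prob_measures"
  using env_indep by (simp add: indep_vars_def)

lemma env_joint_measurable[measurable]:
  "(\<lambda>\<omega> i. \<rho> i \<omega>) \<in> M \<rightarrow>\<^sub>M (\<Pi>\<^sub>M i\<in>UNIV. prob_measures)"
  by (rule measurable_PiM_single') (auto simp: space_PiM intro: measurable_space[OF env_measurable])

lemma env_space: "\<omega> \<in> space M \<Longrightarrow> \<rho> i \<omega> \<in> space \<nu>"
  using measurable_space[OF env_measurable, of \<omega> i] by (simp add: law.space_law)

abbreviation size_at :: "'a \<Rightarrow> nat list \<Rightarrow> real" where
  "size_at \<omega> \<equiv> box_size (\<lambda>u. \<rho> u \<omega>)"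

lemma env_joint_law:
  "distr M (\<Pi>\<^sub>M i\<in>UNIV. prob_measures) (\<lambda>\<omega> i. \<rho> i \<omega>) = (\<Pi>\<^sub>M i\<in>UNIV. \<nu>)"
proof -
  have "distr M (\<Pi>\<^sub>M i\<in>UNIV. prob_measures) (\<lambda>\<omega>. \<lambda>i\<in>UNIV. \<rho> i \<omega>) = (\<Pi>\<^sub>M i\<in>UNIV. \<nu>)"
    using env_indep indep_vars_iff_distr_eq_PiM[of UNIV \<rho> "\<lambda>_. prob_measures"]
    by (simp add: env_law)
  moreover have "(\<lambda>\<omega>. \<lambda>i\<in>UNIV. \<rho> i \<omega>) = (\<lambda>\<omega> i. \<rho> i \<omega>)"
    by (intro ext) (simp only: restrict_UNIV)
  ultimately show ?thesis by argo
qed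

lemma sets_PiM_law: "sets (\<Pi>\<^sub>M i\<in>I. \<nu>) = sets (\<Pi>\<^sub>M i\<in>I. prob_measures)"
  by (rule sets_PiM_cong) (auto simp: law.sets_law)

text \<open>Prefixing words with \<open>j\<close> is an injective reindexing of an i.i.d. family, so
  every subtree below the root is a copy of the whole tree.\<close>

lemma subtree_law:
  "distr M (\<Pi>\<^sub>M i\<in>UNIV. prob_measures) (\<lambda>\<omega> i. \<rho> (j # i) \<omega>) = (\<Pi>\<^sub>M i\<in>UNIV. \<nu>)"
proof -
  let ?P = "\<Pi>\<^sub>M i\<in>UNIV. prob_measures" and ?N = "\<Pi>\<^sub>M i\<in>(UNIV :: nat list set). \<nu>"
  have [measurable]: "(\<lambda>e i. e (j # i)) \<in> ?P \<rightarrow>\<^sub>M ?P"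
    by (rule measurable_PiM_single') (auto simp: space_PiM)
  have "distr ?N ?N (\<lambda>e. \<lambda>n\<in>UNIV. e (j # n)) = ?N"
    using distr_PiM_reindex[of UNIV "\<lambda>_. \<nu>" "(#) j" UNIV] law.prob_space_axioms by simp
  moreover have "(\<lambda>e :: nat list \<Rightarrow> nat measure. \<lambda>n\<in>UNIV. e (j # n)) = (\<lambda>e i. e (j # i))"
    by (intro ext) (simp only: restrict_UNIV)
  ultimately have "?N = distr ?N ?N (\<lambda>e i. e (j # i))" by argo
  also have "\<dots> = distr ?N ?P (\<lambda>e i. e (j # i))"
    by (rule distr_cong) (simp_all add: sets_PiM_law)
  also have "\<dots> = distr (distr M ?P (\<lambda>\<omega> i. \<rho> i \<omega>)) ?P (\<lambda>e i. e (j # i))"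
    by (simp only: env_joint_law)
  also have "\<dots> = distr M ?P (\<lambda>\<omega> i. \<rho> (j # i) \<omega>)"
    by (subst distr_distr) (auto simp: comp_def)
  finally show ?thesis ..
qed

definition reach :: "nat \<Rightarrow> real \<Rightarrow> real" where
  "reach k s = prob {\<omega>\<in>space M. has_small k s (\<lambda>u. \<rho> u \<omega>)}"

lemma subtree_reach: "prob {\<omega>\<in>space M. has_small k s (\<lambda>u. \<rho> (j # u) \<omega>)} = reach k s"
proof -
  let ?P = "\<Pi>\<^sub>M i\<in>UNIV. prob_measures"
  let ?A = "{e\<in>space ?P. has_small k s e}"
  have A: "?A \<in> sets ?P" by measurable
  have [measurable]: "(\<lambda>\<omega> i. \<rho> (j # i) \<omega>) \<in> M \<rightarrow>\<^sub>M ?P"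
    by (rule measurable_PiM_single') (auto simp: space_PiM intro: measurable_space[OF env_measurable])
  have "prob {\<omega>\<in>space M. has_small k s (\<lambda>u. \<rho> (j # u) \<omega>)} = measure (distr M ?P (\<lambda>\<omega> i. \<rho> (j # i) \<omega>)) ?A"
    using A by (subst measure_distr)
      (auto intro!: arg_cong[where f=prob] simp: space_PiM measurable_space[OF env_measurable])
  also have "\<dots> = measure (distr M ?P (\<lambda>\<omega> i. \<rho> i \<omega>)) ?A"
    by (simp only: subtree_law env_joint_law)
  also have "\<dots> = reach k s"
    using A unfolding reach_def by (subst measure_distr)
      (auto intro!: arg_cong[where f=prob] simp: space_PiM measurable_space[OF env_measurable])
  finally show ?thesis .
qed

lemma reach_bounds: "0 \<le> reach k s" "reach k s \<le> 1"
  by (simp_all add: reach_def)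

lemma reach_mono: "s \<le> s' \<Longrightarrow> reach k s \<le> reach k s'"
  unfolding reach_def
  by (intro finite_measure_mono) (auto simp: has_small_def intro: order.trans)

lemma reach_measurable[measurable]: "reach k \<in> borel_measurable borel"
  by (rule borel_measurable_mono) (simp add: mono_def reach_mono)

lemma reach_0: "s \<ge> 0 \<Longrightarrow> reach 0 s = 1"
  unfolding reach_def by (simp add: has_small_def box_size_Nil prob_space)

lemma subtrees_indep:
  "prob {\<omega>\<in>space M. \<forall>j\<in>I. \<not> has_small k (s j) (\<lambda>u. \<rho> (j # u) \<omega>)} = (\<Prod>j\<in>I. 1 - reach k (s j))"
  if "finite I"
proof (cases "I = {}")
  case False
  let ?K = "\<lambda>j. range ((#) j)"
  let ?P = "\<lambda>j. Pi\<^sub>M (?K j) (\<lambda>_. prob_measures)"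
  let ?Y = "\<lambda>j \<omega>. restrict (\<lambda>i. \<rho> i \<omega>) (?K j)"
  let ?A = "\<lambda>j. {r\<in>space (?P j). \<not> has_small k (s j) (\<lambda>u. r (j # u))}"
  have ind: "indep_vars ?P ?Y I"
    by (rule indep_vars_restrict[OF env_indep]) (auto simp: disjoint_family_on_def)
  have A: "?A j \<in> sets (?P j)" for j by measurable
  have Y: "?Y j \<omega> \<in> space (?P j)" if "\<omega> \<in> space M" for j \<omega>
    using that by (auto simp: space_PiM measurable_space[OF env_measurable])
  have eq: "?Y j -` ?A j \<inter> space M = {\<omega>\<in>space M. \<not> has_small k (s j) (\<lambda>u. \<rho> (j # u) \<omega>)}" for j
    using Y by auto
  have "prob (\<Inter>j\<in>I. ?Y j -` ?A j \<inter> space M) = (\<Prod>j\<in>I. prob (?Y j -` ?A j \<inter> space M))"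
    using A by (intro indep_varsD_finite[OF ind False that]) auto
  also have "\<dots> = (\<Prod>j\<in>I. 1 - reach k (s j))"
    unfolding eq by (intro prod.cong refl) (simp add: prob_neg subtree_reach)
  also have "(\<Inter>j\<in>I. ?Y j -` ?A j \<inter> space M) =
      {\<omega>\<in>space M. \<forall>j\<in>I. \<not> has_small k (s j) (\<lambda>u. \<rho> (j # u) \<omega>)}"
    unfolding eq using False by auto
  finally show ?thesis .
qed (simp add: prob_space)

lemma nn_integral_root:
  assumes [measurable]: "f \<in> borel_measurable prob_measures"
  shows "(\<integral>\<^sup>+\<omega>. f (\<rho> i \<omega>) \<partial>M) = (\<integral>\<^sup>+p. f p \<partial>\<nu>)"
  by (subst env_law[symmetric, of i], subst nn_integral_distr) auto

text \<open>Given the root, the subtrees of its children are independent copies of the tree, and a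
  small box in any of them is a small box of the tree. Watching only the labels below
  \<open>J\<close> gives an inequality with a finite product.\<close>

lemma reach_step:
  "1 - reach (Suc k) s \<le>
    (\<integral>p. (\<Prod>j<J. if mass p j > 0 then 1 - reach k (s - ln (mass p j)) else 1) \<partial>\<nu>)"
proof -
  let ?g = "\<lambda>p. \<Prod>j<J. if mass p j > 0 then 1 - reach k (s - ln (mass p j)) else 1"
  have g01: "0 \<le> ?g p" "?g p \<le> 1" for p
    using reach_bounds by (auto intro!: prod_nonneg prod_le_1)
  have [measurable]: "?g \<in> borel_measurable \<nu>" by measurable
  let ?RP = "Pi\<^sub>M {[] :: nat list} (\<lambda>_. prob_measures)" and ?SP = "Pi\<^sub>M (-{[] :: nat list}) (\<lambda>_. prob_measures)"
  let ?R = "\<lambda>\<omega>. restrict (\<lambda>i. \<rho> i \<omega>) {[]}" and ?S = "\<lambda>\<omega>. restrict (\<lambda>i. \<rho> i \<omega>) (-{[]})"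
  \<comment> \<open>The thresholds of the subtrees depend on the root, so the event is written with
    products of sizes, which are jointly measurable; the fact \<open>F\<close> below translates it
    back to \<open>has_small\<close>.\<close>
  define F where "F z \<longleftrightarrow> (\<forall>j<J. mass (fst z []) j > 0 \<longrightarrow>
      \<not> (\<exists>i. length i = k \<and> 0 < box_size (\<lambda>u. snd z (j # u)) i \<and>
         mass (fst z []) j * box_size (\<lambda>u. snd z (j # u)) i \<le> exp s))"
    for z :: "(nat list \<Rightarrow> nat measure) \<times> (nat list \<Rightarrow> nat measure)"
  have [measurable]: "(\<lambda>z. fst z []) \<in> ?RP \<Otimes>\<^sub>M ?SP \<rightarrow>\<^sub>M prob_measures" by measurable
  have [measurable]: "(\<lambda>z. snd z (j # u)) \<in> ?RP \<Otimes>\<^sub>M ?SP \<rightarrow>\<^sub>M prob_measures" for j u by measurable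
  have [measurable]: "Measurable.pred (?RP \<Otimes>\<^sub>M ?SP) F" unfolding F_def by measurable
  have mF: "(indicator {z. F z} :: _ \<Rightarrow> ennreal) \<in> borel_measurable (?RP \<Otimes>\<^sub>M ?SP)" by measurable
  have F: "F z \<longleftrightarrow> (\<forall>j\<in>{j. j < J \<and> mass (fst z []) j > 0}.
      \<not> has_small k (s - ln (mass (fst z []) j)) (\<lambda>u. snd z (j # u)))" for z
    unfolding F_def has_small_def by (auto simp: exp_diff field_simps)
  \<comment> \<open>The root variable is independent of all the others. Fubini then allows the root
    to be frozen at \<omega> while the subtrees are driven by a separate \<omega>'.\<close>
  have ind: "indep_var ?RP ?R ?SP ?S"
    by (rule indep_var_restrict[OF env_indep]) auto
  have [measurable]: "?R \<in> M \<rightarrow>\<^sub>M ?RP" "?S \<in> M \<rightarrow>\<^sub>M ?SP"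
    by (auto intro!: measurable_restrict)
  have d: "distr M ?RP ?R \<Otimes>\<^sub>M distr M ?SP ?S = distr M (?RP \<Otimes>\<^sub>M ?SP) (\<lambda>\<omega>. (?R \<omega>, ?S \<omega>))"
    using ind by (simp add: indep_var_distribution_eq)
  interpret DS: prob_space "distr M ?SP ?S" by (rule prob_space_distr) measurable
  have "emeasure M {\<omega>\<in>space M. \<not> has_small (Suc k) s (\<lambda>u. \<rho> u \<omega>)}
      \<le> emeasure M {\<omega>\<in>space M. F (?R \<omega>, ?S \<omega>)}"
  proof (rule emeasure_mono)
    show "{\<omega>\<in>space M. F (?R \<omega>, ?S \<omega>)} \<in> sets M" by measurable
    show "{\<omega>\<in>space M. \<not> has_small (Suc k) s (\<lambda>u. \<rho> u \<omega>)} \<subseteq> {\<omega>\<in>space M. F (?R \<omega>, ?S \<omega>)}"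
      unfolding F using has_small_Cons[where e="\<lambda>u. \<rho> u _"] by auto
  qed
  also have "\<dots> = (\<integral>\<^sup>+\<omega>. indicator {z. F z} (?R \<omega>, ?S \<omega>) \<partial>M)"
  proof -
    have "(\<integral>\<^sup>+\<omega>. indicator {z. F z} (?R \<omega>, ?S \<omega>) \<partial>M) =
        (\<integral>\<^sup>+\<omega>. indicator {\<omega>\<in>space M. F (?R \<omega>, ?S \<omega>)} \<omega> \<partial>M)"
      by (intro nn_integral_cong) (simp add: indicator_def)
    then show ?thesis by simp
  qed
  also have "\<dots> = (\<integral>\<^sup>+z. indicator {z. F z} z \<partial>distr M (?RP \<Otimes>\<^sub>M ?SP) (\<lambda>\<omega>. (?R \<omega>, ?S \<omega>)))"
    by (subst nn_integral_distr) auto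
  also have "\<dots> = (\<integral>\<^sup>+a. \<integral>\<^sup>+b. indicator {z. F z} (a, b) \<partial>distr M ?SP ?S \<partial>distr M ?RP ?R)"
    unfolding d[symmetric]
    by (rule DS.nn_integral_fst[symmetric]) measurable
  also have "\<dots> = (\<integral>\<^sup>+\<omega>. \<integral>\<^sup>+\<omega>'. indicator {z. F z} (?R \<omega>, ?S \<omega>') \<partial>M \<partial>M)"
  proof (subst nn_integral_distr)
    have "(\<integral>\<^sup>+b. indicator {z. F z} (?R \<omega>, b) \<partial>distr M ?SP ?S) =
        (\<integral>\<^sup>+\<omega>'. indicator {z. F z} (?R \<omega>, ?S \<omega>') \<partial>M)" if "\<omega> \<in> space M" for \<omega>
    proof (rule nn_integral_distr)
      have m: "(\<lambda>b. (?R \<omega>, b)) \<in> ?SP \<rightarrow>\<^sub>M ?RP \<Otimes>\<^sub>M ?SP"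
        using that by (intro measurable_Pair1') (auto simp: space_PiM measurable_space[OF env_measurable])
      show "(\<lambda>b. indicator {z. F z} (?R \<omega>, b) :: ennreal) \<in> borel_measurable (distr M ?SP ?S)"
        using measurable_compose[OF m mF] by (simp add: comp_def)
    qed measurable
    then show "(\<integral>\<^sup>+\<omega>. \<integral>\<^sup>+b. indicator {z. F z} (?R \<omega>, b) \<partial>distr M ?SP ?S \<partial>M) =
        (\<integral>\<^sup>+\<omega>. \<integral>\<^sup>+\<omega>'. indicator {z. F z} (?R \<omega>, ?S \<omega>') \<partial>M \<partial>M)"
      by (rule nn_integral_cong)
    have "sets (?RP \<Otimes>\<^sub>M distr M ?SP ?S) = sets (?RP \<Otimes>\<^sub>M ?SP)"
      by (rule sets_pair_measure_cong) simp_all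
    then have "(indicator {z. F z} :: _ \<Rightarrow> ennreal) \<in> borel_measurable (?RP \<Otimes>\<^sub>M distr M ?SP ?S)"
      using mF measurable_cong_sets by blast
    then show "(\<lambda>a. \<integral>\<^sup>+b. (indicator {z. F z} (a, b) :: ennreal) \<partial>distr M ?SP ?S) \<in> borel_measurable (distr M ?RP ?R)"
      using DS.borel_measurable_nn_integral_fst by simp
  qed measurable
  also have "\<dots> = (\<integral>\<^sup>+\<omega>. ennreal (?g (\<rho> [] \<omega>)) \<partial>M)"
  proof (intro nn_integral_cong)
    fix \<omega> assume "\<omega> \<in> space M"
    let ?I = "{j. j < J \<and> mass (\<rho> [] \<omega>) j > 0}"
    have "(\<integral>\<^sup>+\<omega>'. indicator {z. F z} (?R \<omega>, ?S \<omega>') \<partial>M) =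
        emeasure M {\<omega>'\<in>space M. \<forall>j\<in>?I. \<not> has_small k (s - ln (mass (\<rho> [] \<omega>) j)) (\<lambda>u. \<rho> (j # u) \<omega>')}"
      (is "_ = emeasure M ?B")
    proof -
      have "?B \<in> sets M" by measurable
      then have "emeasure M ?B = (\<integral>\<^sup>+\<omega>'. indicator ?B \<omega>' \<partial>M)" by simp
      also have "\<dots> = (\<integral>\<^sup>+\<omega>'. indicator {z. F z} (?R \<omega>, ?S \<omega>') \<partial>M)"
        by (intro nn_integral_cong) (simp add: indicator_def F)
      finally show ?thesis ..
    qed
    also have "\<dots> = ennreal (\<Prod>j\<in>?I. 1 - reach k (s - ln (mass (\<rho> [] \<omega>) j)))"
      by (subst emeasure_eq_measure, subst subtrees_indep) auto
    also have "(\<Prod>j\<in>?I. 1 - reach k (s - ln (mass (\<rho> [] \<omega>) j))) = ?g (\<rho> [] \<omega>)"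
      by (rule prod.mono_neutral_cong_left) auto
    finally show "(\<integral>\<^sup>+\<omega>'. indicator {z. F z} (?R \<omega>, ?S \<omega>') \<partial>M) = ennreal (?g (\<rho> [] \<omega>))" .
  qed
  also have "\<dots> = (\<integral>\<^sup>+p. ennreal (?g p) \<partial>\<nu>)"
    by (rule nn_integral_root) measurable
  also have "\<dots> = ennreal (\<integral>p. ?g p \<partial>\<nu>)"
    using g01 by (intro nn_integral_eq_integral law.integrable_const_bound[where B=1]) auto
  finally have "prob {\<omega>\<in>space M. \<not> has_small (Suc k) s (\<lambda>u. \<rho> u \<omega>)} \<le> (\<integral>p. ?g p \<partial>\<nu>)"
    using g01 by (simp add: emeasure_eq_measure integral_nonneg_AE)
  then show ?thesis by (simp add: prob_neg reach_def)
qed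

end

section \<open>Consequences of the one-step inequality: first moments, second-order lower bounds,
  and the boost\<close>

lemma prod_one_minus_le:
  fixes u :: "'i \<Rightarrow> real"
  assumes "finite I" "\<And>i. i \<in> I \<Longrightarrow> 0 \<le> u i" "\<And>i. i \<in> I \<Longrightarrow> u i \<le> 1"
  shows "(\<Prod>i\<in>I. 1 - u i) \<le> 1 - (\<Sum>i\<in>I. u i) + (\<Sum>i\<in>I. u i)\<^sup>2 / 2"
proof -
  let ?s = "\<Sum>i\<in>I. u i"
  have s: "?s \<ge> 0" using assms by (intro sum_nonneg) auto
  have "(\<Prod>i\<in>I. 1 - u i) \<le> (\<Prod>i\<in>I. exp (- u i))"
  proof (intro prod_mono)
    fix i assume "i \<in> I"
    then show "0 \<le> 1 - u i \<and> 1 - u i \<le> exp (- u i)"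
      using assms exp_ge_add_one_self[of "- u i"] by simp
  qed
  also have "\<dots> = exp (- ?s)" using assms by (simp add: exp_sum sum_negf[symmetric])
  also have "\<dots> \<le> 1 - ?s + ?s\<^sup>2 / 2"
  proof -
    let ?f = "\<lambda>x :: real. 1 - x + x\<^sup>2 / 2 - exp (- x)"
    have "?f 0 \<le> ?f ?s"
    proof (rule DERIV_nonneg_imp_nondecreasing[OF s])
      fix x :: real assume "0 \<le> x"
      show "\<exists>y. (?f has_real_derivative y) (at x) \<and> 0 \<le> y"
        using exp_ge_add_one_self[of "-x"]
        by (intro exI[of _ "-1 + x + exp (-x)"]) (auto intro!: derivative_eq_intros)
    qed
    then show ?thesis by simp
  qed
  finally show ?thesis .
qed

text \<open>Bounds the power by an affine expression in the indicators of \<open>n = 0\<close> and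
  of \<open>2 \<le> n0\<close>, whose expectation involves two probabilities only. Here
  \<open>n\<close> and \<open>n0\<close> will count the children of positive mass below
  \<open>J\<close> and \<open>J0\<close>.\<close>

lemma power_le_of_bool:
  fixes q :: real and n n0 :: nat
  assumes "0 \<le> q" "q \<le> 1" "n0 \<le> n"
  shows "q ^ n \<le> of_bool (n = 0) + (q + of_bool (2 \<le> n0) * (q\<^sup>2 - q))"
proof -
  have sq: "q\<^sup>2 \<le> q" using assms by (simp add: power2_eq_square mult_left_le)
  consider "n = 0" | "n = 1" | "n \<ge> 2" by linarith
  then show ?thesis
  proof cases
    case 1
    then show ?thesis using assms by simp
  next
    case 2
    then show ?thesis using assms by simp
  next
    case 3
    have "q ^ n \<le> q\<^sup>2" using 3 assms by (intro power_decreasing) auto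
    also have "\<dots> \<le> q + of_bool (2 \<le> n0) * (q\<^sup>2 - q)" using sq by (cases "2 \<le> n0") simp_all
    finally show ?thesis by (simp add: add_increasing)
  qed
qed

lemma bij_betw_Cons_length:
  "bij_betw (\<lambda>(j, i). j # i) (UNIV \<times> {i. length i = k}) {i. length i = Suc k}"
  by (rule bij_betwI[where g="\<lambda>i. (hd i, tl i)"]) (auto simp: length_Suc_conv)

text \<open>The distributive law for the \<open>k\<close>-th power of a series, with the terms
  indexed by words of length \<open>k\<close>.\<close>

lemma nn_integral_lists_prod:
  fixes c :: "nat \<Rightarrow> ennreal"
  shows "(\<integral>\<^sup>+i. (\<Prod>l<k. c (i ! l)) \<partial>count_space {i. length i = k}) = (\<Sum>j. c j) ^ k"
proof (induction k)
  case 0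
  have "{i :: nat list. length i = 0} = {[]}" by auto
  then show ?case by (simp add: nn_integral_count_space_finite)
next
  case (Suc k)
  let ?A = "{i :: nat list. length i = k}"
  interpret A: sigma_finite_measure "count_space ?A"
    by (rule sigma_finite_measure_count_space_countable) simp
  have "(\<integral>\<^sup>+i. (\<Prod>l<Suc k. c (i ! l)) \<partial>count_space {i. length i = Suc k}) =
      (\<integral>\<^sup>+z. (\<Prod>l<Suc k. c ((case z of (j, i) \<Rightarrow> j # i) ! l)) \<partial>count_space (UNIV \<times> ?A))"
    by (rule nn_integral_bij_count_space[OF bij_betw_Cons_length, symmetric])
  also have "\<dots> = (\<integral>\<^sup>+z. c (fst z) * (\<Prod>l<k. c (snd z ! l)) \<partial>(count_space UNIV \<Otimes>\<^sub>M count_space ?A))"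
    by (subst pair_measure_countable)
      (auto intro!: nn_integral_cong simp: case_prod_beta' prod.lessThan_Suc_shift simp del: prod.lessThan_Suc)
  also have "\<dots> = (\<integral>\<^sup>+j. \<integral>\<^sup>+i. c j * (\<Prod>l<k. c (i ! l)) \<partial>count_space ?A \<partial>count_space UNIV)"
    by (subst A.nn_integral_fst[symmetric]) (auto simp: pair_measure_countable)
  also have "\<dots> = (\<integral>\<^sup>+j. c j * (\<Sum>j. c j) ^ k \<partial>count_space UNIV)"
    by (simp add: nn_integral_cmult Suc)
  also have "\<dots> = (\<Sum>j. c j) ^ Suc k"
    by (simp add: nn_integral_multc nn_integral_count_space_nat)
  finally show ?case .
qed

context box_tree
begin

text \<open>The ancestors of \<open>i\<close> are pairwise distinct prefixes, so the masses
  multiplied along the line of descent are independent.\<close>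

lemma nn_integral_size_powr:
  assumes "length i = k"
  shows "(\<integral>\<^sup>+\<omega>. ennreal (size_at \<omega> i powr \<theta>) \<partial>M) =
    (\<Prod>l<k. \<integral>\<^sup>+p. ennreal (mass p (i ! l) powr \<theta>) \<partial>\<nu>)"
proof -
  let ?I = "(\<lambda>l. take l i) ` {..<k}"
  have inj: "inj_on (\<lambda>l. take l i) {..<k}"
    using assms by (auto simp: inj_on_def dest: arg_cong[where f=length])
  have "(\<integral>\<^sup>+\<omega>. ennreal (size_at \<omega> i powr \<theta>) \<partial>M) =
      (\<integral>\<^sup>+\<omega>. (\<Prod>u\<in>?I. ennreal (mass (\<rho> u \<omega>) (i ! length u) powr \<theta>)) \<partial>M)"
    using assms inj
    by (intro nn_integral_cong)
      (simp add: box_size_def prod_powr_distrib prod_ennreal prod.reindex)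
  also have "\<dots> = (\<Prod>u\<in>?I. \<integral>\<^sup>+\<omega>. ennreal (mass (\<rho> u \<omega>) (i ! length u) powr \<theta>) \<partial>M)"
  proof (rule indep_vars_nn_integral)
    show "indep_vars (\<lambda>_. borel) (\<lambda>u \<omega>. ennreal (mass (\<rho> u \<omega>) (i ! length u) powr \<theta>)) ?I"
      by (rule indep_vars_compose2[OF indep_vars_subset[OF env_indep]]) auto
  qed auto
  also have "\<dots> = (\<Prod>u\<in>?I. \<integral>\<^sup>+p. ennreal (mass p (i ! length u) powr \<theta>) \<partial>\<nu>)"
    by (intro prod.cong refl nn_integral_root[where f="\<lambda>p. ennreal (mass p _ powr \<theta>)"]) measurable
  also have "\<dots> = (\<Prod>l<k. \<integral>\<^sup>+p. ennreal (mass p (i ! l) powr \<theta>) \<partial>\<nu>)"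
    using inj assms by (simp add: prod.reindex)
  finally show ?thesis .
qed

lemma mean_powr:
  "(\<integral>\<^sup>+i. \<integral>\<^sup>+\<omega>. ennreal (size_at \<omega> i powr \<theta>) \<partial>M \<partial>count_space {i. length i = k}) = L \<nu> \<theta> ^ k"
proof -
  have "(\<integral>\<^sup>+i. \<integral>\<^sup>+\<omega>. ennreal (size_at \<omega> i powr \<theta>) \<partial>M \<partial>count_space {i. length i = k}) =
      (\<integral>\<^sup>+i. (\<Prod>l<k. \<integral>\<^sup>+p. ennreal (mass p (i ! l) powr \<theta>) \<partial>\<nu>) \<partial>count_space {i. length i = k})"
    by (intro nn_integral_cong) (simp add: nn_integral_size_powr)
  also have "\<dots> = (\<Sum>j. \<integral>\<^sup>+p. ennreal (mass p j powr \<theta>) \<partial>\<nu>) ^ k"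
    by (rule nn_integral_lists_prod)
  also have "(\<Sum>j. \<integral>\<^sup>+p. ennreal (mass p j powr \<theta>) \<partial>\<nu>) = L \<nu> \<theta>"
    unfolding L_def by (subst nn_integral_suminf) auto
  finally show ?thesis .
qed

text \<open>The form of the recursion used at both speeds: \<open>u j\<close> is any nonnegative
  minorant of the success probability of the \<open>j\<close>-th subtree. The quadratic term is the
  reason why offspring sums must be bounded.\<close>

lemma reach_Suc_ge:
  fixes u :: "nat \<Rightarrow> nat measure \<Rightarrow> real"
  assumes [measurable]: "\<And>j. u j \<in> borel_measurable \<nu>"
    and nonneg: "\<And>p j. p \<in> space \<nu> \<Longrightarrow> 0 \<le> u j p"
    and zero: "\<And>p j. p \<in> space \<nu> \<Longrightarrow> mass p j = 0 \<Longrightarrow> u j p = 0"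
    and le: "\<And>p j. p \<in> space \<nu> \<Longrightarrow> mass p j > 0 \<Longrightarrow> u j p \<le> reach k (s - ln (mass p j))"
  shows "reach (Suc k) s \<ge> (\<integral>p. (\<Sum>j<J. u j p) - (\<Sum>j<J. u j p)\<^sup>2 / 2 \<partial>\<nu>)"
proof -
  have u1: "u j p \<le> 1" if "p \<in> space \<nu>" for p j
    using zero[OF that, of j] le[OF that, of j] reach_bounds(2)[of k "s - ln (mass p j)"]
    by (cases "mass p j = 0") (auto simp: zero_less_measure_iff)
  let ?g = "\<lambda>p. \<Prod>j<J. if mass p j > 0 then 1 - reach k (s - ln (mass p j)) else 1"
  have g01: "0 \<le> ?g p" "?g p \<le> 1" for p
    using reach_bounds by (auto intro!: prod_nonneg prod_le_1)
  have intg: "integrable \<nu> ?g"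
    using g01 by (intro law.integrable_const_bound[where B=1]) auto
  have sumb: "0 \<le> (\<Sum>j<J. u j p) \<and> (\<Sum>j<J. u j p) \<le> J" if "p \<in> space \<nu>" for p
    using sum_bounded_above[of "{..<J}" "\<lambda>j. u j p" 1] u1[OF that] nonneg[OF that]
    by (auto intro!: sum_nonneg)
  have int1: "integrable \<nu> (\<lambda>p. \<Sum>j<J. u j p)"
    using sumb by (intro law.integrable_const_bound[where B=J]) auto
  have int2: "integrable \<nu> (\<lambda>p. (\<Sum>j<J. u j p)\<^sup>2)"
    using sumb by (intro law.integrable_const_bound[where B="(real J)\<^sup>2"]) (auto intro!: power_mono)
  have "1 - reach (Suc k) s \<le> (\<integral>p. ?g p \<partial>\<nu>)" by (rule reach_step)
  also have "\<dots> \<le> (\<integral>p. 1 - ((\<Sum>j<J. u j p) - (\<Sum>j<J. u j p)\<^sup>2 / 2) \<partial>\<nu>)"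
  proof (rule integral_mono[OF intg])
    fix p assume p: "p \<in> space \<nu>"
    have "?g p \<le> (\<Prod>j<J. 1 - u j p)"
      using le[OF p] zero[OF p] u1[OF p] reach_bounds
      by (intro prod_mono) (auto simp: zero_less_measure_iff)
    also have "\<dots> \<le> 1 - (\<Sum>j<J. u j p) + (\<Sum>j<J. u j p)\<^sup>2 / 2"
      using nonneg[OF p] u1[OF p] by (intro prod_one_minus_le) auto
    finally show "?g p \<le> 1 - ((\<Sum>j<J. u j p) - (\<Sum>j<J. u j p)\<^sup>2 / 2)" by simp
  qed (use int1 int2 in auto)
  also have "\<dots> = 1 - (\<integral>p. (\<Sum>j<J. u j p) - (\<Sum>j<J. u j p)\<^sup>2 / 2 \<partial>\<nu>)"
    using int1 int2 by (simp add: law.prob_space)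
  finally show ?thesis by simp
qed

text \<open>Masses are at most 1, so the threshold only becomes easier in a subtree. One child
  reproduces the failure probability \<open>Q\<close>, two children give at most \<open>Q\<close>
  squared; \<open>\<beta>\<close> is the probability that at least two labels below a fixed
  \<open>J0\<close> have positive mass.\<close>

lemma reach_Suc_boost:
  assumes "\<not> geometric \<nu>"
  obtains \<beta> where "\<beta> > 0" "\<beta> \<le> 1"
    "\<And>k s. 1 - reach (Suc k) s \<le> (1 - \<beta>) * (1 - reach k s) + \<beta> * (1 - reach k s)\<^sup>2"
proof -
  let ?N = "\<lambda>J p. card {j. j < J \<and> mass p j > 0}"
  have cardN: "?N J p = (\<Sum>j<J. if mass p j > 0 then 1 else 0)" for J p
    by (simp add: sum.If_cases Int_def conj_commute)
  have Nm[measurable]: "?N J \<in> measurable \<nu> (count_space UNIV)" for J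
    unfolding cardN by measurable
  define none where "none J = law.prob {p\<in>space \<nu>. ?N J p = 0}" for J
  define two where "two J = law.prob {p\<in>space \<nu>. ?N J p \<ge> 2}" for J
  have none0: "none \<longlonglongrightarrow> 0"
  proof -
    define A where "A J = {p\<in>space \<nu>. ?N J p = 0}" for J
    have "(\<Inter>J. A J) = {}"
    proof safe
      fix p assume p: "p \<in> (\<Inter>J. A J)"
      then have "p \<in> space \<nu>" by (simp add: A_def)
      then obtain j where "mass p j > 0" using law.mass_pos_ex by blast
      then have "?N (Suc j) p \<noteq> 0" by auto
      moreover have "p \<in> A (Suc j)" using p by blast
      ultimately show "p \<in> {}" by (simp add: A_def) blast
    qed
    moreover have "decseq A"
      unfolding decseq_def A_def by fastforce
    moreover have "A J \<in> sets \<nu>" for J unfolding A_def by measurable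
    then have "range A \<subseteq> sets \<nu>" by blast
    ultimately have "(\<lambda>J. law.prob (A J)) \<longlonglongrightarrow> law.prob {}"
      using law.finite_Lim_measure_decseq[of A] by simp
    then show ?thesis by (simp add: none_def[abs_def] A_def)
  qed
  have "\<exists>J. two J > 0"
  proof (rule ccontr)
    assume "\<nexists>J. two J > 0"
    then have "two J = 0" for J by (simp add: two_def zero_less_measure_iff)
    then have "AE p in \<nu>. \<not> ?N J p \<ge> 2" for J
      unfolding two_def by (subst (asm) law.prob_eq_0) auto
    then have "AE p in \<nu>. \<forall>J. \<not> ?N J p \<ge> 2" by (subst AE_all_countable) auto
    then have "AE p in \<nu>. \<forall>j. mass p j = 0 \<or> mass p j = 1"
      using AE_space
    proof eventually_elim
      case (elim p)
      obtain i where i: "mass p i > 0" using law.mass_pos_ex elim by blast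
      have z: "mass p j = 0" if "j \<noteq> i" for j
      proof (rule ccontr)
        assume "mass p j \<noteq> 0"
        then have "{i, j} \<subseteq> {l. l < Suc (i + j) \<and> mass p l > 0}" using i by (auto simp: zero_less_measure_iff)
        then have "card {i, j} \<le> ?N (Suc (i + j)) p" by (intro card_mono) auto
        moreover have "card {i, j} = 2" using that by (simp add: card_2_iff')
        ultimately show False using elim by metis
      qed
      have "(\<lambda>j. mass p j) sums (\<Sum>j\<in>{i}. mass p j)" using z by (intro sums_finite) auto
      then have "mass p i = 1" using sums_unique2[OF law.mass_sums[of p]] elim by simp
      then show ?case using z by metis
    qed
    then show False using law.not_dirac assms by blast
  qed
  then obtain J0 where J0: "two J0 > 0" by blast
  show ?thesis
  proof (rule that[of "two J0"])
    fix k s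
    let ?Q = "1 - reach k s"
    have Q: "0 \<le> ?Q" "?Q \<le> 1" using reach_bounds by auto
    have main: "1 - reach (Suc k) s \<le> none J + ((1 - two J0) * ?Q + two J0 * ?Q\<^sup>2)" if J: "J \<ge> J0" for J
    proof -
      let ?g = "\<lambda>p. \<Prod>j<J. if mass p j > 0 then 1 - reach k (s - ln (mass p j)) else 1"
      let ?b = "\<lambda>p. indicator {p\<in>space \<nu>. ?N J p = 0} p + (?Q + indicator {p\<in>space \<nu>. ?N J0 p \<ge> 2} p * (?Q\<^sup>2 - ?Q))"
      have g01: "0 \<le> ?g p" "?g p \<le> 1" for p
        using reach_bounds by (auto intro!: prod_nonneg prod_le_1)
      have "1 - reach (Suc k) s \<le> (\<integral>p. ?g p \<partial>\<nu>)" by (rule reach_step)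
      also have "\<dots> \<le> (\<integral>p. ?b p \<partial>\<nu>)"
      proof (rule integral_mono)
        show "integrable \<nu> ?g"
          using g01 by (intro law.integrable_const_bound[where B=1]) auto
        fix p assume p: "p \<in> space \<nu>"
        have "?g p \<le> (\<Prod>j<J. if mass p j > 0 then ?Q else 1)"
        proof (intro prod_mono conjI)
          fix j
          have "mass p j > 0 \<Longrightarrow> reach k s \<le> reach k (s - ln (mass p j))"
            using law.mass_le_1[OF p, of j] by (intro reach_mono) simp
          then show "(if mass p j > 0 then 1 - reach k (s - ln (mass p j)) else 1) \<le> (if mass p j > 0 then ?Q else 1)"
            by auto
        qed (use reach_bounds in auto)
        also have "\<dots> = ?Q ^ ?N J p"
          by (simp add: prod.If_cases Int_def conj_commute)
        also have "\<dots> \<le> of_bool (?N J p = 0) + (?Q + of_bool (2 \<le> ?N J0 p) * (?Q\<^sup>2 - ?Q))"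
          using J by (intro power_le_of_bool Q card_mono) auto
        also have "\<dots> = ?b p" using p by (simp only: indicator_def mem_Collect_eq simp_thms)
        finally show "?g p \<le> ?b p" .
      qed (auto simp: law.emeasure_eq_measure)
      also have "\<dots> = none J + (?Q + two J0 * (?Q\<^sup>2 - ?Q))"
        by (simp add: none_def two_def law.prob_space law.emeasure_eq_measure Int_def conj_commute)
      finally show ?thesis by (simp add: algebra_simps)
    qed
    \<comment> \<open>Only the event that no label below \<open>J\<close> carries mass spoils the
      bound; it disappears as \<open>J\<close> grows with \<open>J0\<close> fixed.\<close>
    have "(\<lambda>J. none J + ((1 - two J0) * ?Q + two J0 * ?Q\<^sup>2)) \<longlonglongrightarrow> 0 + ((1 - two J0) * ?Q + two J0 * ?Q\<^sup>2)"
      by (intro tendsto_intros none0)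
    then have "1 - reach (Suc k) s \<le> 0 + ((1 - two J0) * ?Q + two J0 * ?Q\<^sup>2)"
      by (rule LIMSEQ_le_const) (use main in blast)
    then show "1 - reach (Suc k) s \<le> (1 - two J0) * ?Q + two J0 * ?Q\<^sup>2" by simp
  qed (use J0 in \<open>auto simp: two_def\<close>)
qed

text \<open>The factor by which \<open>Q\<close> contracts tends to 1 as \<open>Q\<close> tends to
  1, so \<open>Q\<close> itself gives no uniform rate when \<open>reach\<close> is tiny. The odds
  \<open>Q / (1 - Q)\<close> do contract uniformly, even when success starts out very
  unlikely.\<close>

lemma reach_boost:
  assumes "\<not> geometric \<nu>"
  obtains r where "0 < r" "r < 1"
    "\<And>k m s. reach k s > 0 \<Longrightarrow> 1 - reach (k + m) s \<le> r ^ m / reach k s"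
    "\<And>k m s. reach k s \<le> reach (k + m) s"
proof -
  obtain \<beta> where \<beta>: "\<beta> > 0" "\<beta> \<le> 1"
    and step: "\<And>k s. 1 - reach (Suc k) s \<le> (1 - \<beta>) * (1 - reach k s) + \<beta> * (1 - reach k s)\<^sup>2"
    using reach_Suc_boost[OF assms] by metis
  \<comment> \<open>The odds are multiplied by at most
    \<open>(1 - \<beta> + \<beta> * Q) / (1 + \<beta> * Q)\<close>, which for
    \<open>Q \<le> 1\<close> does not exceed its value \<open>1 / (1 + \<beta>)\<close> at
    \<open>Q = 1\<close>.\<close>
  define r where "r = 1 / (1 + \<beta>)"
  have r: "0 < r" "r < 1" using \<beta> by (auto simp: r_def)
  have inc: "reach k s \<le> reach (Suc k) s" for k s
  proof -
    let ?Q = "1 - reach k s"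
    have "?Q\<^sup>2 \<le> ?Q" using reach_bounds[of k s] by (simp add: power2_eq_square mult_left_le)
    then have "\<beta> * ?Q\<^sup>2 \<le> \<beta> * ?Q" using \<beta> by simp
    then show ?thesis using step[of k s] by (simp add: algebra_simps)
  qed
  have mono: "reach k s \<le> reach (k + m) s" for k m s
    by (induction m) (auto intro: order.trans[OF _ inc])
  have odds: "(1 - reach (k + m) s) / reach (k + m) s \<le> r ^ m * ((1 - reach k s) / reach k s)"
    if "reach k s > 0" for k m s
  proof (induction m)
    case (Suc m)
    define Q where "Q = 1 - reach (k + m) s"
    define Q' where "Q' = 1 - reach (k + Suc m) s"
    have Q: "0 \<le> Q" "Q < 1" "0 \<le> Q'" "Q' < 1"
      using reach_bounds[of "k + m" s] reach_bounds[of "k + Suc m" s] mono[of k s m] mono[of k s "Suc m"] that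
      by (auto simp: Q_def Q'_def)
    have st: "Q' \<le> Q * (1 - \<beta> + \<beta> * Q)"
      using step[of "k + m" s] by (simp add: Q_def Q'_def power2_eq_square algebra_simps)
    have pos: "1 - Q * (1 - \<beta> + \<beta> * Q) = (1 - Q) * (1 + \<beta> * Q)" by (simp add: algebra_simps)
    have pos': "(1 - Q) * (1 + \<beta> * Q) > 0" using Q \<beta> by (intro mult_pos_pos add_pos_nonneg) auto
    have "Q' / (1 - Q') \<le> Q * (1 - \<beta> + \<beta> * Q) / ((1 - Q) * (1 + \<beta> * Q))"
      using st Q pos pos' \<beta> by (intro frac_le) auto
    also have "\<dots> = (Q / (1 - Q)) * ((1 - \<beta> + \<beta> * Q) / (1 + \<beta> * Q))" by simp
    also have "\<dots> \<le> (Q / (1 - Q)) * r"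
    proof (rule mult_left_mono)
      have "\<beta> * \<beta> * Q \<le> \<beta> * \<beta>" using Q \<beta> by (intro mult_left_le) auto
      moreover have "1 + \<beta> * Q > 0" using Q \<beta> by (intro add_pos_nonneg) auto
      ultimately show "(1 - \<beta> + \<beta> * Q) / (1 + \<beta> * Q) \<le> r"
        using \<beta> unfolding r_def by (simp add: field_simps)
    qed (use Q in auto)
    also have "\<dots> \<le> r ^ Suc m * ((1 - reach k s) / reach k s)"
      using mult_right_mono[OF Suc.IH, of r] r by (simp add: Q_def mult_ac)
    finally show ?case by (simp add: Q'_def)
  qed simp
  show ?thesis
  proof (rule that[OF r])
    fix k m s assume pos: "reach k s > 0"
    have "1 - reach (k + m) s \<le> (1 - reach (k + m) s) / reach (k + m) s"
    proof -
      have "reach (k + m) s > 0" using mono[of k s m] pos by linarith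
      then show ?thesis
        using reach_bounds[of "k + m" s] by (subst pos_le_divide_eq) (auto intro: mult_left_le)
    qed
    also have "\<dots> \<le> r ^ m * ((1 - reach k s) / reach k s)" by (rule odds[OF pos])
    also have "\<dots> \<le> r ^ m * (1 / reach k s)"
      using reach_bounds[of k s] r pos by (intro mult_left_mono divide_right_mono) auto
    finally show "1 - reach (k + m) s \<le> r ^ m / reach k s" by simp
  qed (rule mono)
qed

end

section \<open>Throwing the balls\<close>

lemma powr_times_exp_bounded:
  fixes t :: real
  assumes "t > 0"
  shows "\<exists>c>0. \<forall>x>0. exp (- x) \<le> c * x powr (- t)"
proof -
  define m where "m = nat \<lceil>t\<rceil>"
  have "exp (- x) \<le> fact m * x powr (- t)" if t: "t > 0" and x: "x > 0" for x :: real
  proof -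
    have "x powr t \<le> fact m * exp x"
    proof (cases "x \<le> 1")
      case True
      have "x powr t \<le> 1 * 1" using True x t by (simp add: powr_le1)
      also have "\<dots> \<le> fact m * exp x" using x by (intro mult_mono fact_ge_1) auto
      finally show ?thesis .
    next
      case False
      have "x powr t \<le> x powr (real m)" using False unfolding m_def by (intro powr_mono) linarith+
      also have "\<dots> = fact m * (x ^ m / fact m)" using x by (simp add: powr_realpow)
      also have "\<dots> \<le> fact m * exp x" 
      proof (intro mult_left_mono)
        have "x ^ m / fact m \<le> (\<Sum>n\<le>m. x ^ n / fact n)"
          using x by (intro member_le_sum) auto
        also have "\<dots> \<le> exp x"
          using x summable_exp_generic[of x]
          by (auto simp: exp_def divide_inverse ac_simps intro!: sum_le_suminf)
        finally show "x ^ m / fact m \<le> exp x" .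
      qed simp
      finally show ?thesis .
    qed
    then have "exp (- x) * (x powr t) \<le> exp (- x) * (fact m * exp x)"
      by (intro mult_left_mono) auto
    also have "\<dots> = fact m" by (simp add: exp_minus)
    finally show ?thesis using x by (simp add: powr_minus field_simps)
  qed
  then show ?thesis using assms by (intro exI[of _ "fact m"]) auto
qed

section \<open>The conditional law of the balls given the environment\<close>

context nested_boxes
begin

sublocale box_tree M \<nu> \<rho>
  by unfold_locales (use law env_indep env_law in auto)

lemma env_map_measurable: "(\<lambda>\<omega> i. \<rho> i \<omega>) \<in> env \<rightarrow>\<^sub>M (\<Pi>\<^sub>M i\<in>UNIV. prob_measures)"
  unfolding env_def
  by (rule measurable_vimage_algebra1) (use measurable_space[OF env_joint_measurable] in blast)

lemma env_component_measurable[measurable]: "\<rho> i \<in> env \<rightarrow>\<^sub>M prob_measures"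
  using measurable_compose[OF env_map_measurable measurable_component_singleton[of i UNIV]] by simp

lemma space_env: "space env = space M"
  by (simp add: env_def)

lemma space_in_env: "space M \<in> sets env"
  using sets.top[of env] by (simp add: space_env)

lemma subalgebra_env: "subalgebra M env"
proof -
  have "sets env \<subseteq> sets M"
    unfolding env_def
    by (subst sets_vimage_algebra2)
      (use measurable_space[OF env_joint_measurable] measurable_sets[OF env_joint_measurable] in auto)
  then show ?thesis by (simp add: subalgebra_def space_env)
qed

sublocale cond: finite_measure_subalgebra M env
  by unfold_locales (rule subalgebra_env)

lemma env_sets: "B \<in> sets env \<Longrightarrow> B \<in> sets M"
  using subalgebra_env by (auto simp: subalgebra_def)

lemma size_bounds: "0 \<le> size_at \<omega> i" "\<omega> \<in> space M \<Longrightarrow> size_at \<omega> i \<le> 1"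
proof -
  show "0 \<le> size_at \<omega> i" by (rule box_size_nonneg)
  show "size_at \<omega> i \<le> 1" if "\<omega> \<in> space M"
    unfolding box_size_def using law.mass_le_1[OF env_space[OF that]] by (intro prod_le_1) auto
qed

lemma hit_measurable[measurable]: "{\<omega>\<in>space M. X m k \<omega> = i} \<in> sets M"
proof -
  have [measurable]: "X m k \<in> M \<rightarrow>\<^sub>M count_space UNIV" by (rule ball_measurable)
  show ?thesis by measurable
qed

lemma integrable_indicator_events: "A \<in> sets M \<Longrightarrow> integrable M (indicator A :: 'a \<Rightarrow> real)"
  by (simp add: emeasure_eq_measure)

lemma hit_cond:
  "length i = k \<Longrightarrow>
    AE \<omega> in M. real_cond_exp M env (indicator {\<omega>\<in>space M. X m k \<omega> = i}) \<omega> = size_at \<omega> i"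
proof (induction k arbitrary: i)
  case 0
  have "AE \<omega> in M. real_cond_exp M env (indicator (space M)) \<omega> = (indicator (space M) \<omega> :: real)"
    by (rule cond.real_cond_exp_F_meas)
      (auto intro: integrable_indicator_events borel_measurable_indicator space_in_env)
  moreover have "{\<omega>\<in>space M. X m 0 \<omega> = i} = space M" using 0 ball_root by auto
  ultimately show ?case using 0 AE_space by (auto simp: box_size_Nil)
next
  case (Suc k)
  then obtain i' j where i: "i = i' @ [j]" "length i' = k"
    by (metis length_Suc_conv_rev)
  show ?case
    using ball_step[OF i(2), of m j] Suc.IH[OF i(2)]
    by eventually_elim (simp add: i box_size_child)
qed

lemma size_measurable_env[measurable]: "(\<lambda>\<omega>. size_at \<omega> i) \<in> borel_measurable env"
  by measurable

lemma size_measurable[measurable]: "(\<lambda>\<omega>. size_at \<omega> i) \<in> borel_measurable M"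
  by measurable

lemma integrable_size: "integrable M (\<lambda>\<omega>. f (size_at \<omega> i))"
  if [measurable]: "f \<in> borel_measurable borel" and "\<And>x. 0 \<le> x \<Longrightarrow> x \<le> 1 \<Longrightarrow> \<bar>f x\<bar> \<le> 1" for f :: "real \<Rightarrow> real"
  by (rule integrable_const_bound[where B=1]) (use that size_bounds in auto)

text \<open>The conditional probability \<open>size_at \<omega> i\<close>, integrated over an event
  of the environment. In this form, and that of \<open>miss_prob\<close>, conditional expectations
  no longer appear in the sequel.\<close>

lemma hit_prob:
  assumes i: "length i = k" and B: "B \<in> sets env"
  shows "prob (B \<inter> {\<omega>\<in>space M. X m k \<omega> = i}) = (\<integral>\<omega>\<in>B. size_at \<omega> i \<partial>M)"
proof -
  let ?H = "{\<omega>\<in>space M. X m k \<omega> = i}"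
  have [measurable]: "B \<in> sets M" using B by (rule env_sets)
  have "prob (B \<inter> ?H) = (\<integral>\<omega>\<in>B. indicator ?H \<omega> \<partial>M)"
    unfolding set_lebesgue_integral_def by (simp add: indicator_inter_arith[symmetric] Int_assoc)
  also have "\<dots> = (\<integral>\<omega>\<in>B. real_cond_exp M env (indicator ?H) \<omega> \<partial>M)"
    using B by (intro cond.real_cond_exp_intA integrable_indicator_events) auto
  also have "\<dots> = (\<integral>\<omega>\<in>B. size_at \<omega> i \<partial>M)"
    unfolding set_lebesgue_integral_def using hit_cond[OF i, of m]
    by (intro integral_cong_AE) (auto elim: eventually_mono)
  finally show ?thesis .
qed

lemma miss_prob:
  assumes i: "length i = k" and J: "finite J" and B: "B \<in> sets env"
  shows "prob (B \<inter> {\<omega>\<in>space M. \<forall>m\<in>J. X m k \<omega> \<noteq> i}) = (\<integral>\<omega>\<in>B. (1 - size_at \<omega> i) ^ card J \<partial>M)"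
proof -
  let ?H = "\<lambda>m. {\<omega>\<in>space M. X m k \<omega> = i}"
  let ?A = "{x :: nat \<Rightarrow> nat list. x k \<noteq> i}"
  let ?E = "{\<omega>\<in>space M. \<forall>m\<in>J. X m k \<omega> \<noteq> i}"
  have [measurable]: "X m k \<in> M \<rightarrow>\<^sub>M count_space UNIV" for m by (rule ball_measurable)
  have [measurable]: "B \<in> sets M" using B by (rule env_sets)
  have E[measurable]: "?E \<in> sets M" using J by measurable
  have A: "?A \<in> sets (\<Pi>\<^sub>M k\<in>UNIV. count_space UNIV)"
  proof -
    have "{x\<in>space (\<Pi>\<^sub>M k\<in>(UNIV :: nat set). count_space (UNIV :: nat list set)). x k \<noteq> i} \<in> sets (\<Pi>\<^sub>M k\<in>UNIV. count_space UNIV)"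
      by measurable
    then show ?thesis by (simp add: space_PiM)
  qed
  have eq: "{\<omega>\<in>space M. (\<lambda>k. X m k \<omega>) \<in> ?A} = space M - ?H m" for m by auto
  have miss: "AE \<omega> in M. real_cond_exp M env (indicator {\<omega>\<in>space M. (\<lambda>k. X m k \<omega>) \<in> ?A}) \<omega> = 1 - size_at \<omega> i" for m
  proof -
    have 1: "AE \<omega> in M. real_cond_exp M env (indicator (space M)) \<omega> = (indicator (space M) \<omega> :: real)"
      by (rule cond.real_cond_exp_F_meas)
        (auto intro: integrable_indicator_events borel_measurable_indicator space_in_env)
    have 2: "AE \<omega> in M. real_cond_exp M env (\<lambda>\<omega>. indicator (space M) \<omega> - indicator (?H m) \<omega>) \<omega> =
        real_cond_exp M env (indicator (space M)) \<omega> - real_cond_exp M env (indicator (?H m)) \<omega>"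
      by (rule cond.real_cond_exp_diff) (auto intro: integrable_indicator_events)
    have 3: "(indicator (space M - ?H m) :: 'a \<Rightarrow> real) = (\<lambda>\<omega>. indicator (space M) \<omega> - indicator (?H m) \<omega>)"
      by (auto simp: indicator_def fun_eq_iff)
    show ?thesis
      unfolding eq 3 using 1 2 hit_cond[OF i, of m] AE_space by eventually_elim auto
  qed
  have "AE \<omega> in M. real_cond_exp M env (indicator {\<omega>\<in>space M. \<forall>m\<in>J. (\<lambda>k. X m k \<omega>) \<in> ?A}) \<omega> =
      (\<Prod>m\<in>J. real_cond_exp M env (indicator {\<omega>\<in>space M. (\<lambda>k. X m k \<omega>) \<in> ?A}) \<omega>)"
    by (rule balls_cond_indep[OF J]) (rule A)
  moreover have "AE \<omega> in M. \<forall>m\<in>J. real_cond_exp M env (indicator {\<omega>\<in>space M. (\<lambda>k. X m k \<omega>) \<in> ?A}) \<omega> = 1 - size_at \<omega> i"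
    using J miss by (intro AE_finite_allI) auto
  ultimately have cond_eq: "AE \<omega> in M. real_cond_exp M env (indicator ?E) \<omega> = (1 - size_at \<omega> i) ^ card J"
    by eventually_elim simp
  have "prob (B \<inter> ?E) = (\<integral>\<omega>\<in>B. indicator ?E \<omega> \<partial>M)"
    unfolding set_lebesgue_integral_def by (simp add: indicator_inter_arith[symmetric] Int_assoc)
  also have "\<dots> = (\<integral>\<omega>\<in>B. real_cond_exp M env (indicator ?E) \<omega> \<partial>M)"
    using B E by (intro cond.real_cond_exp_intA integrable_indicator_events) auto
  also have "\<dots> = (\<integral>\<omega>\<in>B. (1 - size_at \<omega> i) ^ card J \<partial>M)"
    unfolding set_lebesgue_integral_def using cond_eq
    by (intro integral_cong_AE) (auto elim: eventually_mono)
  finally show ?thesis .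
qed

definition underfull :: "nat \<Rightarrow> nat \<Rightarrow> nat \<Rightarrow> 'a \<Rightarrow> bool" where
  "underfull j n k \<omega> \<longleftrightarrow> (\<exists>i. length i = k \<and> 0 < size_at \<omega> i \<and> balls_in X n i \<omega> < j)"

lemma balls_in_measurable[measurable]: "(\<lambda>\<omega>. balls_in X n i \<omega>) \<in> M \<rightarrow>\<^sub>M count_space UNIV"
proof -
  have [measurable]: "X m k \<in> M \<rightarrow>\<^sub>M count_space UNIV" for m k by (rule ball_measurable)
  have eq: "balls_in X n i \<omega> = (\<Sum>m<n. if X m (length i) \<omega> = i then 1 else 0)" for \<omega>
    by (simp add: balls_in_def sum.If_cases Int_def conj_commute)
  show ?thesis unfolding eq by measurable
qed

lemma underfull_measurable[measurable]: "Measurable.pred M (underfull j n k)"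
  unfolding underfull_def by measurable

text \<open>Pigeonhole: among \<open>j\<close> disjoint blocks of \<open>n div j\<close> balls,
  fewer than \<open>j\<close> hits leave a block without any. This reduces "fewer than
  \<open>j\<close> balls" to "no ball", to which \<open>miss_prob\<close> applies.\<close>

lemma few_balls_block:
  assumes "balls_in X n i \<omega> < j"
  shows "\<exists>b<j. \<forall>m\<in>{b * (n div j)..<Suc b * (n div j)}. X m (length i) \<omega> \<noteq> i"
proof (rule ccontr)
  let ?h = "n div j"
  let ?H = "{m. m < n \<and> X m (length i) \<omega> = i}"
  assume "\<not> ?thesis"
  then have "\<forall>b<j. \<exists>m. m \<in> {b * ?h..<Suc b * ?h} \<and> X m (length i) \<omega> = i" by blast
  then obtain f where f: "\<And>b. b < j \<Longrightarrow> b * ?h \<le> f b \<and> f b < Suc b * ?h \<and> X (f b) (length i) \<omega> = i"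
    by (metis atLeastLessThan_iff)
  have "f b < n" if "b < j" for b
  proof -
    have "Suc b * ?h \<le> j * ?h" using that by (intro mult_right_mono) auto
    also have "\<dots> \<le> n" by simp
    finally show ?thesis using f[OF that] by linarith
  qed
  moreover have "inj_on f {..<j}"
  proof (rule inj_onI)
    fix a b assume ab: "a \<in> {..<j}" "b \<in> {..<j}" "f a = f b"
    have "f c div ?h = c" if "c < j" for c
      using f[OF that] by (intro div_nat_eqI) (auto simp: mult.commute)
    then show "a = b" using ab by (metis lessThan_iff)
  qed
  moreover from calculation have "f ` {..<j} \<subseteq> ?H" using f by auto
  then have "card (f ` {..<j}) \<le> card ?H" by (intro card_mono) auto
  ultimately have "j \<le> card ?H" by (simp add: card_image)
  then show False using assms by (simp add: balls_in_def)
qed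

lemma underfull_prob_le:
  fixes t :: real
  assumes "t > 0" "L \<nu> (-t) < \<infinity>" "j \<ge> 1"
  obtains c where "c > 0"
    "\<And>n k. n \<ge> j \<Longrightarrow> prob {\<omega>\<in>space M. underfull j n k \<omega>} \<le> c * real n powr (-t) * Lr \<nu> (-t) ^ k"
proof -
  obtain c0 where c0: "c0 > 0" "\<And>x. x > 0 \<Longrightarrow> exp (- x) \<le> c0 * x powr (- t)"
    using powr_times_exp_bounded[OF assms(1)] by metis
  \<comment> \<open>The factor \<open>j\<close> counts the blocks, \<open>c0\<close> bounds the
    exponential by a power, and \<open>(2 * real j) powr t\<close> comes from the block length
    \<open>h \<ge> n / (2 * j)\<close>.\<close>
  define c where "c = j * c0 * (2 * real j) powr t"
  have "c > 0" using assms c0 by (simp add: c_def)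
  moreover have "prob {\<omega>\<in>space M. underfull j n k \<omega>} \<le> c * real n powr (-t) * Lr \<nu> (-t) ^ k"
    if n: "n \<ge> j" for n k
  proof -
    define h where "h = n div j"
    have h: "h > 0" using n assms by (simp add: h_def div_greater_zero_iff)
    have hn: "real n / (2 * j) \<le> real h"
    proof -
      have "n < Suc h * j" unfolding h_def using assms by (metis dividend_less_div_times mult_Suc add.commute less_le_trans zero_less_one)
      also have "\<dots> \<le> 2 * h * j" using h by (intro mult_right_mono) auto
      finally have "real n \<le> real (2 * h * j)" by (simp only: of_nat_le_iff less_imp_le)
      then show ?thesis using assms by (simp add: field_simps)
    qed
    let ?Z = "{i :: nat list. length i = k}"
    let ?E = "\<lambda>i. {\<omega>\<in>space M. 0 < size_at \<omega> i \<and> balls_in X n i \<omega> < j}"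
    let ?P = "\<lambda>i. {\<omega>\<in>space M. 0 < size_at \<omega> i}"
    have Pe: "?P i \<in> sets env" for i
    proof -
      have "{\<omega>\<in>space env. 0 < size_at \<omega> i} \<in> sets env" by measurable
      then show ?thesis by (simp add: space_env)
    qed
    have [measurable]: "?P i \<in> sets M" for i by (rule env_sets[OF Pe])
    have one: "emeasure M (?E i) \<le> ennreal (c * real n powr (-t)) * (\<integral>\<^sup>+\<omega>. ennreal (size_at \<omega> i powr (-t)) \<partial>M)"
      if i: "i \<in> ?Z" for i
    proof -
      let ?M = "\<lambda>b. {\<omega>\<in>space M. \<forall>m\<in>{b * h..<Suc b * h}. X m k \<omega> \<noteq> i}"
      have Mm: "?M b \<in> sets M" for b
      proof -
        have [measurable]: "X m k \<in> M \<rightarrow>\<^sub>M count_space UNIV" for m k by (rule ball_measurable)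
        show ?thesis by measurable
      qed
      have int: "integrable M (\<lambda>\<omega>. (1 - size_at \<omega> i) ^ h)"
        by (rule integrable_size[where f="\<lambda>x. (1 - x) ^ h"]) (auto simp: power_abs intro!: power_le_one)
      have "?E i \<subseteq> (\<Union>b\<in>{..<j}. ?P i \<inter> ?M b)"
        using few_balls_block[of n i _ j] i unfolding h_def[symmetric] by fastforce
      then have "emeasure M (?E i) \<le> emeasure M (\<Union>b\<in>{..<j}. ?P i \<inter> ?M b)"
        using Mm by (intro emeasure_mono) auto
      also have "\<dots> \<le> (\<Sum>b<j. emeasure M (?P i \<inter> ?M b))"
        using Mm by (intro emeasure_subadditive_finite) auto
      also have "\<dots> = (\<Sum>b<j. ennreal (\<integral>\<omega>\<in>?P i. (1 - size_at \<omega> i) ^ h \<partial>M))"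
      proof (intro sum.cong refl)
        fix b
        have "prob (?P i \<inter> ?M b) = (\<integral>\<omega>\<in>?P i. (1 - size_at \<omega> i) ^ card {b * h..<Suc b * h} \<partial>M)"
          using i by (intro miss_prob Pe) auto
        then show "emeasure M (?P i \<inter> ?M b) = ennreal (\<integral>\<omega>\<in>?P i. (1 - size_at \<omega> i) ^ h \<partial>M)"
          by (simp add: emeasure_eq_measure)
      qed
      also have "\<dots> = of_nat j * (\<integral>\<^sup>+\<omega>. ennreal (indicator (?P i) \<omega> * (1 - size_at \<omega> i) ^ h) \<partial>M)"
        using integrable_mult_indicator[OF _ int, of "?P i"] size_bounds
        by (subst nn_integral_eq_integral) (auto simp: set_lebesgue_integral_def)
      also have "\<dots> \<le> of_nat j * (\<integral>\<^sup>+\<omega>. ennreal (c0 * (2 * real j) powr t * real n powr (-t)) * ennreal (size_at \<omega> i powr (-t)) \<partial>M)"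
      proof (intro mult_left_mono nn_integral_mono)
        fix \<omega> assume \<omega>: "\<omega> \<in> space M"
        show "ennreal (indicator (?P i) \<omega> * (1 - size_at \<omega> i) ^ h) \<le>
          ennreal (c0 * (2 * real j) powr t * real n powr (-t)) * ennreal (size_at \<omega> i powr (-t))"
        proof (cases "size_at \<omega> i > 0")
          case True
          let ?s = "size_at \<omega> i"
          have "(1 - ?s) ^ h \<le> exp (- ?s) ^ h"
            using exp_ge_add_one_self[of "- ?s"] size_bounds(2)[OF \<omega>, of i] by (intro power_mono) auto
          also have "\<dots> = exp (- (?s * h))" by (simp add: exp_of_nat_mult[symmetric] mult.commute)
          also have "\<dots> \<le> exp (- (?s * (real n / (2 * j))))"
            using hn True by (simp only: exp_le_cancel_iff neg_le_iff_le) (intro mult_left_mono, auto)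
          also have "\<dots> \<le> c0 * (?s * (real n / (2 * j))) powr (- t)"
            using True n assms by (intro c0(2)) auto
          also have "\<dots> = c0 * (2 * real j) powr t * real n powr (-t) * ?s powr (-t)"
            using True n assms by (simp add: powr_mult powr_divide powr_minus field_simps)
          finally show ?thesis
            using True \<omega> c0 by (simp add: ennreal_mult'[symmetric] ennreal_leI)
        qed simp
      qed simp
      also have "\<dots> = ennreal (c * real n powr (-t)) * (\<integral>\<^sup>+\<omega>. ennreal (size_at \<omega> i powr (-t)) \<partial>M)"
        using c0 by (simp add: nn_integral_cmult c_def ennreal_mult' mult.assoc ennreal_of_nat_eq_real_of_nat)
      finally show ?thesis .
    qed
    have "emeasure M {\<omega>\<in>space M. underfull j n k \<omega>} = emeasure M (\<Union>i\<in>?Z. ?E i)"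
      by (intro arg_cong[where f="emeasure M"]) (auto simp: underfull_def)
    also have "\<dots> \<le> (\<integral>\<^sup>+i. emeasure M (?E i) \<partial>count_space ?Z)"
    proof -
      have "emeasure M (\<Union>i\<in>?Z. ?E i) = (\<integral>\<^sup>+\<omega>. indicator (\<Union>i\<in>?Z. ?E i) \<omega> \<partial>M)"
        by (intro nn_integral_indicator[symmetric] sets.countable_UN'') auto
      also have "\<dots> \<le> (\<integral>\<^sup>+\<omega>. \<integral>\<^sup>+i. indicator (?E i) \<omega> \<partial>count_space ?Z \<partial>M)"
      proof (intro nn_integral_mono)
        fix \<omega>
        show "indicator (\<Union>i\<in>?Z. ?E i) \<omega> \<le> (\<integral>\<^sup>+i. indicator (?E i) \<omega> \<partial>count_space ?Z)"
        proof (cases "\<omega> \<in> (\<Union>i\<in>?Z. ?E i)")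
          case True
          then obtain i where i: "i \<in> ?Z" "\<omega> \<in> ?E i" by blast
          have "(indicator (?E i) \<omega> :: ennreal) \<le> (\<integral>\<^sup>+i. indicator (?E i) \<omega> \<partial>count_space ?Z)"
            by (rule nn_integral_ge_point) (rule i)
          then show ?thesis using True i(2) by (simp only: indicator_simps)
        qed simp
      qed
      also have "\<dots> = (\<integral>\<^sup>+i. \<integral>\<^sup>+\<omega>. indicator (?E i) \<omega> \<partial>M \<partial>count_space ?Z)"
        by (rule nn_integral_count_space_nn_integral) auto
      also have "\<dots> = (\<integral>\<^sup>+i. emeasure M (?E i) \<partial>count_space ?Z)"
        by (intro nn_integral_cong nn_integral_indicator) measurable
      finally show ?thesis .
    qed
    also have "\<dots> \<le> (\<integral>\<^sup>+i. ennreal (c * real n powr (-t)) * (\<integral>\<^sup>+\<omega>. ennreal (size_at \<omega> i powr (-t)) \<partial>M) \<partial>count_space ?Z)"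
      using one by (intro nn_integral_mono) auto
    also have "\<dots> = ennreal (c * real n powr (-t)) * L \<nu> (-t) ^ k"
      by (simp add: nn_integral_cmult mean_powr)
    also have "\<dots> = ennreal (c * real n powr (-t) * Lr \<nu> (-t) ^ k)"
      using \<open>c > 0\<close> by (subst law.L_eq_Lr[OF assms(2)]) (simp add: ennreal_mult' ennreal_power)
    finally show ?thesis
      using \<open>c > 0\<close> by (simp add: emeasure_eq_measure)
  qed
  ultimately show ?thesis using that by blast
qed

text \<open>A union over all small boxes would be too expensive. Instead one small box is selected
  by the environment alone; each of the \<open>n\<close> balls falls into it with conditional
  probability at most \<open>exp s\<close>, and as \<open>j \<ge> 1\<close> an empty box is
  underfull.\<close>

lemma not_underfull_prob_le:
  assumes "j \<ge> 1"
  shows "prob {\<omega>\<in>space M. \<not> underfull j n k \<omega>} \<le> (1 - reach k s) + n * exp s"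
proof -
  define S where "S c \<omega> \<longleftrightarrow> length (from_nat c :: nat list) = k \<and> 0 < size_at \<omega> (from_nat c) \<and> size_at \<omega> (from_nat c) \<le> exp s" for c \<omega>
  \<comment> \<open>\<open>c\<close> is the code of the first small box in an enumeration of all
    words. These events are disjoint, so their probabilities sum to at most 1.\<close>
  define B where "B c = {\<omega>\<in>space M. S c \<omega> \<and> (\<forall>c'<c. \<not> S c' \<omega>)}" for c
  have Be: "B c \<in> sets env" for c
  proof -
    have [measurable]: "Measurable.pred env (S c)" for c unfolding S_def by measurable
    have "{\<omega>\<in>space env. S c \<omega> \<and> (\<forall>c'<c. \<not> S c' \<omega>)} \<in> sets env" by measurable
    then show ?thesis by (simp only: B_def space_env)
  qed
  have [measurable]: "B c \<in> sets M" for c by (rule env_sets[OF Be])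
  let ?H = "\<lambda>m c. {\<omega>\<in>space M. X m k \<omega> = from_nat c}"
  let ?C = "\<lambda>c. \<Union>m\<in>{..<n}. B c \<inter> ?H m c"
  have C[measurable]: "?C c \<in> sets M" for c by measurable
  have disj: "disjoint_family B"
    unfolding disjoint_family_on_def B_def by (auto) (metis linorder_neqE_nat)
  have C_le: "emeasure M (?C c) \<le> ennreal (n * exp s) * emeasure M (B c)" for c
  proof (cases "length (from_nat c :: nat list) = k")
    case True
    have "emeasure M (?C c) \<le> (\<Sum>m<n. emeasure M (B c \<inter> ?H m c))"
      by (intro emeasure_subadditive_finite) auto
    also have "\<dots> \<le> (\<Sum>m<n. ennreal (exp s * prob (B c)))"
    proof (intro sum_mono)
      fix m
      have "prob (B c \<inter> ?H m c) = (\<integral>\<omega>\<in>B c. size_at \<omega> (from_nat c) \<partial>M)"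
        by (rule hit_prob[OF True Be])
      also have "\<dots> \<le> (\<integral>\<omega>\<in>B c. exp s \<partial>M)"
        unfolding set_lebesgue_integral_def
      proof (rule integral_mono)
        show "integrable M (\<lambda>\<omega>. indicat_real (B c) \<omega> *\<^sub>R size_at \<omega> (from_nat c))"
          using integrable_mult_indicator[OF _ integrable_size[where f="\<lambda>x. x"]] by simp
        show "integrable M (\<lambda>\<omega>. indicat_real (B c) \<omega> *\<^sub>R exp s)"
          using integrable_indicator_events[of "B c"] by simp
        fix \<omega>
        have "\<omega> \<in> B c \<Longrightarrow> size_at \<omega> (from_nat c) \<le> exp s" by (simp add: B_def S_def)
        then show "indicat_real (B c) \<omega> *\<^sub>R size_at \<omega> (from_nat c) \<le> indicat_real (B c) \<omega> *\<^sub>R exp s"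
          by (simp add: indicator_def)
      qed
      also have "\<dots> = exp s * prob (B c)" by (simp add: set_lebesgue_integral_def)
      finally show "emeasure M (B c \<inter> ?H m c) \<le> ennreal (exp s * prob (B c))"
        by (simp add: emeasure_eq_measure ennreal_leI)
    qed
    also have "\<dots> = ennreal (n * exp s) * emeasure M (B c)"
      by (simp add: emeasure_eq_measure ennreal_mult'[symmetric] ennreal_of_nat_eq_real_of_nat mult.assoc)
    finally show ?thesis .
  next
    case False
    then have "B c = {}" by (auto simp: B_def S_def)
    then show ?thesis by simp
  qed
  have "{\<omega>\<in>space M. \<not> underfull j n k \<omega>} \<subseteq> {\<omega>\<in>space M. \<not> has_small k s (\<lambda>u. \<rho> u \<omega>)} \<union> (\<Union>c. ?C c)"
  proof safe
    fix \<omega> assume \<omega>: "\<omega> \<in> space M" "\<not> underfull j n k \<omega>" "\<omega> \<notin> (\<Union>c. ?C c)"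
      and "has_small k s (\<lambda>u. \<rho> u \<omega>)"
    then obtain i where "length i = k" "0 < size_at \<omega> i" "size_at \<omega> i \<le> exp s"
      by (auto simp: has_small_def)
    then have "S (to_nat i) \<omega>" by (simp add: S_def)
    then obtain c where c: "S c \<omega>" "\<forall>c'<c. \<not> S c' \<omega>"
      using exists_least_iff[of "\<lambda>c. S c \<omega>"] by blast
    then have "\<not> balls_in X n (from_nat c) \<omega> < j"
      using \<omega> by (auto simp: underfull_def S_def)
    then have "card {m. m < n \<and> X m k \<omega> = from_nat c} > 0"
      using assms c(1) by (simp add: balls_in_def S_def)
    then obtain m where "m < n" "X m k \<omega> = from_nat c" by (auto simp: card_gt_0_iff)
    then have "\<omega> \<in> ?C c" using c \<omega> by (auto simp: B_def)
    then show False using \<omega>(3) by blast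
  qed
  then have "prob {\<omega>\<in>space M. \<not> underfull j n k \<omega>} \<le>
      prob ({\<omega>\<in>space M. \<not> has_small k s (\<lambda>u. \<rho> u \<omega>)} \<union> (\<Union>c. ?C c))"
    by (intro finite_measure_mono) auto
  also have "\<dots> \<le> prob {\<omega>\<in>space M. \<not> has_small k s (\<lambda>u. \<rho> u \<omega>)} + prob (\<Union>c. ?C c)"
    by (intro measure_Un_le) auto
  also have "prob {\<omega>\<in>space M. \<not> has_small k s (\<lambda>u. \<rho> u \<omega>)} = 1 - reach k s"
    by (simp add: prob_neg reach_def)
  also have "prob (\<Union>c. ?C c) \<le> n * exp s"
  proof -
    have "emeasure M (\<Union>c. ?C c) \<le> (\<Sum>c. emeasure M (?C c))"
      by (intro emeasure_subadditive_countably) auto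
    also have "\<dots> \<le> (\<Sum>c. ennreal (n * exp s) * emeasure M (B c))"
      by (intro suminf_le C_le) auto
    also have "\<dots> = ennreal (n * exp s) * emeasure M (\<Union>c. B c)"
      using disj by (simp add: suminf_emeasure image_subset_iff)
    also have "\<dots> \<le> ennreal (n * exp s) * 1"
      by (intro mult_left_mono emeasure_le_1) auto
    finally show ?thesis by (simp add: emeasure_eq_measure)
  qed
  finally show ?thesis by simp
qed

lemma underfull_Suc:
  assumes "\<omega> \<in> space M" "underfull j n k \<omega>"
  shows "underfull j n (Suc k) \<omega>"
proof -
  obtain i where i: "length i = k" "0 < size_at \<omega> i" "balls_in X n i \<omega> < j"
    using assms(2) by (auto simp: underfull_def)
  obtain c where c: "mass (\<rho> i \<omega>) c > 0"
    using law.mass_pos_ex[OF env_space[OF assms(1)]] by blast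
  have "balls_in X n (i @ [c]) \<omega> \<le> balls_in X n i \<omega>"
    unfolding balls_in_def
  proof (rule card_mono)
    show "{m. m < n \<and> X m (length (i @ [c])) \<omega> = i @ [c]} \<subseteq> {m. m < n \<and> X m (length i) \<omega> = i}"
      using ball_child[OF assms(1)] by (auto, metis append1_eq_conv)
  qed auto
  then show ?thesis
    unfolding underfull_def using i c by (intro exI[of _ "i @ [c]"]) (auto simp: box_size_child)
qed

text \<open>Makes it possible to pass from powers of two to all \<open>n\<close>: every box has a
  child of positive size, and a child never holds more balls than its parent.\<close>

lemma underfull_mono:
  assumes "\<omega> \<in> space M" "underfull j n k \<omega>" "k \<le> k'" "n' \<le> n"
  shows "underfull j n' k' \<omega>"
proof -
  have "underfull j n k' \<omega>"
    using assms(3,2) by (induction rule: dec_induct) (auto intro: underfull_Suc[OF assms(1)])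
  moreover have "balls_in X n' i \<omega> \<le> balls_in X n i \<omega>" for i
    unfolding balls_in_def using assms(4) by (intro card_mono) auto
  ultimately show ?thesis
    unfolding underfull_def using le_less_trans by blast
qed

lemma saturation_level_le: "underfull j n k \<omega> \<Longrightarrow> saturation_level \<rho> X n j \<omega> \<le> k"
  unfolding saturation_level_def underfull_def by (rule Least_le)

text \<open>\<open>LEAST\<close> is informative only if some generation is underfull;
  \<open>k'\<close> certifies this.\<close>

lemma saturation_level_gt:
  assumes "\<omega> \<in> space M" "underfull j n k' \<omega>" "\<not> underfull j n k \<omega>"
  shows "saturation_level \<rho> X n j \<omega> > k"
proof -
  have "underfull j n (saturation_level \<rho> X n j \<omega>) \<omega>"
    using assms(2) unfolding saturation_level_def underfull_def by (rule LeastI)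
  then show ?thesis
    using underfull_mono[OF assms(1) _ _ order_refl] assms(3) by (metis not_le)
qed

end

section \<open>Small boxes at a subcritical speed\<close>

text \<open>The expected number of words of length \<open>l\<close> over the labels below
  \<open>J\<close> whose box has positive size at most \<open>exp s\<close>.\<close>

primrec truncated_mean :: "nat measure measure \<Rightarrow> nat \<Rightarrow> nat \<Rightarrow> real \<Rightarrow> real" where
  "truncated_mean \<nu> J 0 s = indicator {0..} s"
| "truncated_mean \<nu> J (Suc l) s =
    (\<integral>p. (\<Sum>j<J. if mass p j > 0 then truncated_mean \<nu> J l (s - ln (mass p j)) else 0) \<partial>\<nu>)"

context box_law
begin

definition moment :: "real \<Rightarrow> nat \<Rightarrow> real" where
  "moment \<theta> j = (\<integral>p. mass p j powr \<theta> \<partial>\<nu>)"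

lemma moment_nonneg: "moment \<theta> j \<ge> 0"
  by (simp add: moment_def)

lemma
  assumes "L \<nu> \<theta> < \<infinity>"
  shows integrable_mass_powr: "integrable \<nu> (\<lambda>p. mass p j powr \<theta>)"
    and moment_sums: "moment \<theta> sums Lr \<nu> \<theta>"
proof -
  have L: "L \<nu> \<theta> = (\<Sum>j. \<integral>\<^sup>+p. ennreal (mass p j powr \<theta>) \<partial>\<nu>)"
    unfolding L_def by (subst nn_integral_suminf) auto
  show i: "integrable \<nu> (\<lambda>p. mass p j powr \<theta>)" for j
  proof (rule integrableI_bounded)
    have "(\<integral>\<^sup>+p. ennreal (mass p j powr \<theta>) \<partial>\<nu>) \<le> L \<nu> \<theta>"
      unfolding L using sum_le_suminf[of "\<lambda>j. \<integral>\<^sup>+p. ennreal (mass p j powr \<theta>) \<partial>\<nu>" "{j}"] by simp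
    then show "(\<integral>\<^sup>+p. ennreal (norm (mass p j powr \<theta>)) \<partial>\<nu>) < \<infinity>"
      using assms by (simp add: order.strict_trans1)
  qed measurable
  have m: "ennreal (moment \<theta> j) = (\<integral>\<^sup>+p. ennreal (mass p j powr \<theta>) \<partial>\<nu>)" for j
    unfolding moment_def using i by (subst nn_integral_eq_integral) auto
  have "(\<lambda>j. ennreal (moment \<theta> j)) sums L \<nu> \<theta>"
    unfolding L m[symmetric] by (rule summable_sums[OF summableI])
  then have "(\<lambda>j. ennreal (moment \<theta> j)) sums ennreal (Lr \<nu> \<theta>)"
    using L_eq_Lr[OF assms] by simp
  then show "moment \<theta> sums Lr \<nu> \<theta>" by (simp add: sums_ennreal moment_nonneg)
qed

lemma truncated_mean_bounds:
  "truncated_mean \<nu> J l \<in> borel_measurable borel \<and> (\<forall>s. 0 \<le> truncated_mean \<nu> J l s \<and> truncated_mean \<nu> J l s \<le> real J ^ l)"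
proof (induction l)
  case 0
  have "truncated_mean \<nu> J 0 = indicator {0..}" by (rule ext) simp
  then show ?case by (auto simp: indicator_def)
next
  case (Suc l)
  then have [measurable]: "truncated_mean \<nu> J l \<in> borel_measurable borel" by blast
  have "truncated_mean \<nu> J (Suc l) = (\<lambda>s. \<integral>p. (\<Sum>j<J. if mass p j > 0 then truncated_mean \<nu> J l (s - ln (mass p j)) else 0) \<partial>\<nu>)"
    by (rule ext) simp
  moreover have "\<dots> \<in> borel_measurable borel" by measurable
  moreover have *: "0 \<le> (\<Sum>j<J. if mass p j > 0 then truncated_mean \<nu> J l (s - ln (mass p j)) else 0) \<and>
      (\<Sum>j<J. if mass p j > 0 then truncated_mean \<nu> J l (s - ln (mass p j)) else 0) \<le> J * real J ^ l" for p s
    using Suc sum_bounded_above[of "{..<J}" "\<lambda>j. if mass p j > 0 then truncated_mean \<nu> J l (s - ln (mass p j)) else 0" "real J ^ l"]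
    by (auto intro!: sum_nonneg)
  moreover have "(\<integral>p. (\<Sum>j<J. if mass p j > 0 then truncated_mean \<nu> J l (s - ln (mass p j)) else 0) \<partial>\<nu>) \<le> J * real J ^ l" for s
    using * by (intro integral_le_const integrable_const_bound[where B="J * real J ^ l"]) auto
  ultimately show ?case by (auto intro!: integral_nonneg_AE)
qed

text \<open>The functions \<open>exp (- \<theta> * s)\<close> are eigenfunctions of the recursion
  step, with eigenvalue the sum of \<open>moment \<theta> j\<close> over \<open>j < J\<close>. So a
  combination of exponentials below the initial indicator propagates explicitly.\<close>

lemma truncated_mean_ge_exp:
  fixes c :: "real \<Rightarrow> real"
  assumes fin: "finite R" and L: "\<And>\<theta>. \<theta> \<in> R \<Longrightarrow> L \<nu> \<theta> < \<infinity>"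
    and base: "\<And>s. (\<Sum>\<theta>\<in>R. c \<theta> * exp (- \<theta> * s)) \<le> indicator {0..} s"
  shows "truncated_mean \<nu> J l s \<ge> (\<Sum>\<theta>\<in>R. c \<theta> * exp (- \<theta> * s) * (\<Sum>j<J. moment \<theta> j) ^ l)"
proof (induction l arbitrary: s)
  case (Suc l)
  have [measurable]: "truncated_mean \<nu> J l \<in> borel_measurable borel" using truncated_mean_bounds by blast
  let ?M = "\<lambda>\<theta>. \<Sum>j<J. moment \<theta> j"
  let ?f = "\<lambda>p. \<Sum>\<theta>\<in>R. c \<theta> * exp (- \<theta> * s) * ?M \<theta> ^ l * (\<Sum>j<J. mass p j powr \<theta>)"
  have "(\<Sum>\<theta>\<in>R. c \<theta> * exp (- \<theta> * s) * ?M \<theta> ^ Suc l) = (\<integral>p. ?f p \<partial>\<nu>)"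
    using integrable_mass_powr[OF L] by (simp add: moment_def mult_ac)
  also have "\<dots> \<le> truncated_mean \<nu> J (Suc l) s"
    unfolding truncated_mean.simps
  proof (rule integral_mono)
    show "integrable \<nu> ?f" using integrable_mass_powr[OF L] by auto
    have b: "\<bar>\<Sum>j<J. if mass p j > 0 then truncated_mean \<nu> J l (s - ln (mass p j)) else 0\<bar> \<le> J * real J ^ l" for p
      using truncated_mean_bounds sum_bounded_above[of "{..<J}" "\<lambda>j. if mass p j > 0 then truncated_mean \<nu> J l (s - ln (mass p j)) else 0" "real J ^ l"]
      by (subst abs_of_nonneg) (auto intro!: sum_nonneg)
    show "integrable \<nu> (\<lambda>p. \<Sum>j<J. if mass p j > 0 then truncated_mean \<nu> J l (s - ln (mass p j)) else 0)"
      using b by (intro integrable_const_bound[where B="J * real J ^ l"]) auto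
    fix p
    have "?f p = (\<Sum>j<J. \<Sum>\<theta>\<in>R. c \<theta> * exp (- \<theta> * s) * ?M \<theta> ^ l * mass p j powr \<theta>)"
      by (simp add: sum_distrib_left) (rule sum.swap)
    also have "\<dots> \<le> (\<Sum>j<J. if mass p j > 0 then truncated_mean \<nu> J l (s - ln (mass p j)) else 0)"
    proof (rule sum_mono)
      fix j
      show "(\<Sum>\<theta>\<in>R. c \<theta> * exp (- \<theta> * s) * ?M \<theta> ^ l * mass p j powr \<theta>) \<le>
        (if mass p j > 0 then truncated_mean \<nu> J l (s - ln (mass p j)) else 0)"
      proof (cases "mass p j > 0")
        case True
        have e: "exp (- \<theta> * s) * mass p j powr \<theta> = exp (- \<theta> * (s - ln (mass p j)))" for \<theta>
          using True by (simp add: powr_def exp_add[symmetric] algebra_simps)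
        have "c \<theta> * exp (- \<theta> * s) * ?M \<theta> ^ l * mass p j powr \<theta> =
            c \<theta> * exp (- \<theta> * (s - ln (mass p j))) * ?M \<theta> ^ l" for \<theta>
          unfolding e[symmetric] by (simp only: mult_ac)
        then have "(\<Sum>\<theta>\<in>R. c \<theta> * exp (- \<theta> * s) * ?M \<theta> ^ l * mass p j powr \<theta>) =
            (\<Sum>\<theta>\<in>R. c \<theta> * exp (- \<theta> * (s - ln (mass p j))) * ?M \<theta> ^ l)"
          by (rule sum.cong[OF refl])
        also have "\<dots> \<le> truncated_mean \<nu> J l (s - ln (mass p j))" by (rule Suc)
        finally show ?thesis using True by simp
      next
        case False
        then have "mass p j = 0" by (simp add: zero_less_measure_iff)
        then show ?thesis by simp
      qed
    qed
    finally show "?f p \<le> (\<Sum>j<J. if mass p j > 0 then truncated_mean \<nu> J l (s - ln (mass p j)) else 0)" .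
  qed
  finally show ?case .
qed (use base in simp)

text \<open>A Chernoff-type lower bound: the indicator of the window \<open>[\<alpha> l, \<beta> l]\<close> is bounded below by a
  combination of three exponentials, whose expectations are explicit.\<close>

lemma truncated_mean_gt_1:
  assumes t: "t > 0" "theta_low \<nu> < ereal (-t)" and phi: "phi \<nu> (-t) > 0" and \<alpha>: "\<alpha> < speed (-t)"
  obtains J l where "l > 0" "truncated_mean \<nu> J l (- \<alpha> * l) > 1"
proof -
  have "speed (-t) < loglap (-t) / t" using phi t by (simp add: phi_eq field_simps)
  \<comment> \<open>Such a \<beta> exists because \<open>phi \<nu> (-t) > 0\<close>. The sizes aimed
    at lie between \<open>exp (- \<beta> * l)\<close> and \<open>exp (- \<alpha> * l)\<close>, and
    the tilted speed lies strictly between the two rates.\<close>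
  then obtain \<beta> where \<beta>: "speed (-t) < \<beta>" "\<beta> < loglap (-t) / t"
    using dense by blast
  then have \<beta>t: "loglap (-t) - t * \<beta> > 0" using t by (simp add: field_simps)
  have d: "((\<lambda>e. (loglap (-t + e) - loglap (-t)) / e) \<longlongrightarrow> - speed (-t)) (at 0)"
    using loglap_deriv[OF t(2)] by (simp add: DERIV_def)
  have d1: "((\<lambda>e. (loglap (-t + e) - loglap (-t)) / e) \<longlongrightarrow> - speed (-t)) (at_right 0)"
    by (rule tendsto_mono[OF _ d]) (simp add: at_within_le_at)
  have d2: "((\<lambda>e. (loglap (-t + - e) - loglap (-t)) / - e) \<longlongrightarrow> - speed (-t)) (at_right 0)"
  proof (rule filterlim_compose[OF d])
    show "filterlim (\<lambda>e :: real. - e) (at 0) (at_right 0)" by real_asymp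
  qed
  obtain \<theta>0 where \<theta>0: "\<theta>0 < -t" "theta_low \<nu> < ereal \<theta>0" using theta_low_less[OF t(2)] by metis
  have "\<forall>\<^sub>F e in at_right (0::real). 0 < e" by (simp add: eventually_at_right_less)
  moreover have "\<forall>\<^sub>F e in at_right (0::real). e < -t - \<theta>0"
    using \<theta>0 by (auto simp: eventually_at_right_field intro!: exI[of _ "-t-\<theta>0"])
  moreover have "\<forall>\<^sub>F e in at_right (0::real). (loglap (-t + e) - loglap (-t)) / e < - \<alpha>"
    by (rule order_tendstoD(2)[OF d1]) (use \<alpha> in simp)
  moreover have "\<forall>\<^sub>F e in at_right (0::real). (loglap (-t + - e) - loglap (-t)) / - e > - \<beta>"
    by (rule order_tendstoD(1)[OF d2]) (use \<beta> in simp)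
  ultimately have "\<forall>\<^sub>F e in at_right (0::real). 0 < e \<and> e < -t - \<theta>0 \<and>
      (loglap (-t + e) - loglap (-t)) / e < - \<alpha> \<and> (loglap (-t + - e) - loglap (-t)) / - e > - \<beta>"
    by eventually_elim blast
  then obtain e where e: "e > 0" "e < -t - \<theta>0"
    "(loglap (-t + e) - loglap (-t)) / e < - \<alpha>" "(loglap (-t + - e) - loglap (-t)) / - e > - \<beta>"
    using eventually_happens[of _ "at_right (0::real)"] trivial_limit_at_right_real by blast
  define \<theta>2 where "\<theta>2 = -t + - e"
  define \<theta>3 where "\<theta>3 = -t + e"
  have e2: "loglap \<theta>2 - loglap (-t) < e * \<beta>"
    using e(1,4) unfolding \<theta>2_def[symmetric] by (simp add: field_simps)
  have e3: "loglap \<theta>3 - loglap (-t) < - e * \<alpha>"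
    using e(1,3) unfolding \<theta>3_def[symmetric] by (simp add: field_simps)
  have low: "theta_low \<nu> < ereal \<theta>2" "theta_low \<nu> < ereal \<theta>3"
    using \<theta>0 e t by (auto simp: \<theta>2_def \<theta>3_def intro: order.strict_trans[OF \<theta>0(2)])
  let ?M = "\<lambda>J \<theta>. \<Sum>j<J. moment \<theta> j"
  have M: "(\<lambda>J. ?M J \<theta>) \<longlonglongrightarrow> exp (loglap \<theta>)" if "theta_low \<nu> < ereal \<theta>" for \<theta>
    using moment_sums[OF L_finite[OF that]] Lr_pos[OF L_finite[OF that]]
    by (simp add: sums_def loglap_def)
  \<comment> \<open>Growth factors per generation of the three exponentials. For large
    \<open>J\<close>, \<open>x1\<close> exceeds 1 as \<beta> lies below
    \<open>loglap (-t) / t\<close>, and exceeds \<open>x2\<close> and \<open>x3\<close> as the speed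
    lies below \<beta> and above \<alpha>.\<close>
  define x1 where "x1 J = ?M J (-t) * exp (- t * \<beta>)" for J
  define x2 where "x2 J = ?M J \<theta>2 * exp (- (t + e) * \<beta>)" for J
  define x3 where "x3 J = ?M J \<theta>3 * exp (- t * \<beta> + e * \<alpha>)" for J
  have lim1: "x1 \<longlonglongrightarrow> exp (loglap (-t) - t * \<beta>)"
    unfolding x1_def[abs_def] using tendsto_mult_right[OF M[OF t(2)], of "exp (- t * \<beta>)"]
    by (simp flip: exp_add)
  have lim2: "x2 \<longlonglongrightarrow> exp (loglap \<theta>2 - (t + e) * \<beta>)"
    unfolding x2_def[abs_def] using tendsto_mult_right[OF M[OF low(1)], of "exp (- (t + e) * \<beta>)"]
    by (simp flip: exp_add add: algebra_simps)
  have lim3: "x3 \<longlonglongrightarrow> exp (loglap \<theta>3 - t * \<beta> + e * \<alpha>)"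
    unfolding x3_def[abs_def] using tendsto_mult_right[OF M[OF low(2)], of "exp (- t * \<beta> + e * \<alpha>)"]
    by (simp flip: exp_add add: algebra_simps)
  have "\<forall>\<^sub>F J in sequentially. x1 J > 1"
    using order_tendstoD(1)[OF lim1] \<beta>t by simp
  moreover have "\<forall>\<^sub>F J in sequentially. x1 J - x2 J > 0"
    using order_tendstoD(1)[OF tendsto_diff[OF lim1 lim2], of 0] e2 by (simp add: algebra_simps)
  moreover have "\<forall>\<^sub>F J in sequentially. x1 J - x3 J > 0"
    using order_tendstoD(1)[OF tendsto_diff[OF lim1 lim3], of 0] e3 by (simp add: algebra_simps)
  ultimately have "\<forall>\<^sub>F J in sequentially. x1 J > 1 \<and> x1 J > x2 J \<and> x1 J > x3 J"
    by eventually_elim auto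
  then obtain J where J: "x1 J > 1" "x1 J > x2 J" "x1 J > x3 J"
    using eventually_happens[of _ sequentially] by auto
  have nn: "x2 J \<ge> 0" "x3 J \<ge> 0" by (auto simp: x2_def x3_def moment_def intro!: sum_nonneg mult_nonneg_nonneg)
  have bound: "truncated_mean \<nu> J l (- \<alpha> * l) \<ge> x1 J ^ l - x2 J ^ l - x3 J ^ l" for l
  proof -
    \<comment> \<open>Normalised so that the combination is \<open>exp ?a * (1 - exp (e * (\<alpha>
      * l + s - l * \<beta>)) - exp (- (e * s)))\<close>: one of the subtracted terms is at least 1
      outside the window, and inside it \<open>?a\<close> is negative.\<close>
    define c where "c \<theta> = (if \<theta> = -t then exp (- t * l * \<beta> + t * \<alpha> * l)
      else if \<theta> = \<theta>2 then - exp (- (t + e) * l * \<beta> + (t + e) * \<alpha> * l)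
      else - exp (- t * l * \<beta> + e * l * \<alpha> + (t - e) * \<alpha> * l))" for \<theta>
    have ne: "\<theta>2 \<noteq> -t" "\<theta>3 \<noteq> -t" "\<theta>2 \<noteq> \<theta>3" using e by (auto simp: \<theta>2_def \<theta>3_def)
    have S: "(\<Sum>\<theta>\<in>{-t, \<theta>2, \<theta>3}. c \<theta> * g \<theta>) = c (-t) * g (-t) + c \<theta>2 * g \<theta>2 + c \<theta>3 * g \<theta>3" for g
      using ne by simp
    have S': "(\<Sum>\<theta>\<in>{-t, \<theta>2, \<theta>3}. c \<theta> * f \<theta> * g \<theta>) =
        c (-t) * (f (-t) * g (-t)) + c \<theta>2 * (f \<theta>2 * g \<theta>2) + c \<theta>3 * (f \<theta>3 * g \<theta>3)" for f g
      using ne by simp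
    have "(\<Sum>\<theta>\<in>{-t, \<theta>2, \<theta>3}. c \<theta> * exp (- \<theta> * (- \<alpha> * l)) * ?M J \<theta> ^ l) \<le> truncated_mean \<nu> J l (- \<alpha> * l)"
    proof (rule truncated_mean_ge_exp)
      fix s :: real
      let ?a = "- t * l * \<beta> + t * (\<alpha> * l + s)"
      have eq: "(\<Sum>\<theta>\<in>{-t, \<theta>2, \<theta>3}. c \<theta> * exp (- \<theta> * s)) =
          exp ?a * (1 - exp (e * (\<alpha> * l + s - l * \<beta>)) - exp (- (e * s)))"
        unfolding S using ne by (simp add: c_def \<theta>2_def \<theta>3_def algebra_simps flip: exp_add)
      show "(\<Sum>\<theta>\<in>{-t, \<theta>2, \<theta>3}. c \<theta> * exp (- \<theta> * s)) \<le> indicator {0..} s"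
      proof (cases "s \<ge> 0")
        case False
        then have "exp (- (e * s)) \<ge> 1" using e by (simp add: mult_nonneg_nonpos)
        then have "1 - exp (e * (\<alpha> * l + s - l * \<beta>)) - exp (- (e * s)) \<le> 0" by (smt (verit) exp_ge_zero)
        then show ?thesis unfolding eq using False by (simp add: mult_nonneg_nonpos)
      next
        case True
        show ?thesis
        proof (cases "\<alpha> * l + s \<ge> l * \<beta>")
          case le: True
          then have "exp (e * (\<alpha> * l + s - l * \<beta>)) \<ge> 1" using e by simp
          then have "1 - exp (e * (\<alpha> * l + s - l * \<beta>)) - exp (- (e * s)) \<le> 0" by (smt (verit) exp_ge_zero)
          then show ?thesis unfolding eq by (smt (verit) exp_ge_zero indicator_pos_le mult_nonneg_nonpos)
        next
          case False
          have "?a = t * (\<alpha> * l + s - l * \<beta>)" by (simp add: algebra_simps)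
          then have "exp ?a \<le> 1" using False t by (simp add: mult_nonneg_nonpos)
          moreover have "1 - exp (e * (\<alpha> * l + s - l * \<beta>)) - exp (- (e * s)) \<le> 1" by (smt (verit) exp_ge_zero)
          ultimately have "exp ?a * (1 - exp (e * (\<alpha> * l + s - l * \<beta>)) - exp (- (e * s))) \<le> 1"
            by (smt (verit) exp_ge_zero mult_left_le mult_nonneg_nonpos)
          then show ?thesis unfolding eq using True by simp
        qed
      qed
    qed (use low t L_finite in auto)
    then have "c (-t) * (exp (- (-t) * (- \<alpha> * l)) * ?M J (-t) ^ l) + c \<theta>2 * (exp (- \<theta>2 * (- \<alpha> * l)) * ?M J \<theta>2 ^ l)
        + c \<theta>3 * (exp (- \<theta>3 * (- \<alpha> * l)) * ?M J \<theta>3 ^ l) \<le> truncated_mean \<nu> J l (- \<alpha> * l)"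
      unfolding S' .
    moreover have "c (-t) * (exp (- (-t) * (- \<alpha> * l)) * ?M J (-t) ^ l) = x1 J ^ l"
      by (simp add: c_def x1_def power_mult_distrib exp_of_nat_mult[symmetric] algebra_simps flip: exp_add)
    moreover have "c \<theta>2 * (exp (- \<theta>2 * (- \<alpha> * l)) * ?M J \<theta>2 ^ l) = - (x2 J ^ l)"
      using ne by (simp add: c_def x2_def power_mult_distrib exp_of_nat_mult[symmetric] \<theta>2_def algebra_simps flip: exp_add)
    moreover have "c \<theta>3 * (exp (- \<theta>3 * (- \<alpha> * l)) * ?M J \<theta>3 ^ l) = - (x3 J ^ l)"
      using ne by (simp add: c_def x3_def power_mult_distrib exp_of_nat_mult[symmetric] \<theta>3_def algebra_simps flip: exp_add)
    ultimately show ?thesis by linarith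
  qed
  have lim0: "(\<lambda>l. (x2 J / x1 J) ^ l) \<longlonglongrightarrow> 0" "(\<lambda>l. (x3 J / x1 J) ^ l) \<longlonglongrightarrow> 0"
    using J nn by (auto intro!: LIMSEQ_power_zero)
  have "\<forall>\<^sub>F l in sequentially. (x2 J / x1 J) ^ l < 1 / 4"
    by (rule order_tendstoD(2)[OF lim0(1)]) simp
  moreover have "\<forall>\<^sub>F l in sequentially. (x3 J / x1 J) ^ l < 1 / 4"
    by (rule order_tendstoD(2)[OF lim0(2)]) simp
  moreover have "\<forall>\<^sub>F l in sequentially. x1 J ^ l > 2"
  proof -
    obtain n where n: "2 < x1 J ^ n" using real_arch_pow[OF J(1)] by blast
    have "x1 J ^ l > 2" if "l \<ge> n" for l
      using n power_increasing[OF that, of "x1 J"] J by linarith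
    then show ?thesis by (auto simp: eventually_at_top_linorder)
  qed
  ultimately have "\<forall>\<^sub>F l in sequentially. l > 0 \<and> truncated_mean \<nu> J l (- \<alpha> * l) > 1"
    using eventually_gt_at_top[of 0]
  proof eventually_elim
    case (elim l)
    have "x2 J ^ l < x1 J ^ l / 4" "x3 J ^ l < x1 J ^ l / 4"
      using elim J by (auto simp: power_divide field_simps)
    then show ?case using elim bound[of l] by linarith
  qed
  then obtain l where "l > 0 \<and> truncated_mean \<nu> J l (- \<alpha> * l) > 1"
    using eventually_happens'[OF sequentially_bot] by blast
  then show ?thesis using that by blast
qed

end

context box_tree
begin

text \<open>Linearisation over \<open>l\<close> generations: starting from a success probability
  \<sigma>, the mean number of useful descendants acts up to an error quadratic in \<sigma>. The
  constant depends on \<open>l\<close> and \<open>J\<close> only, so blocks can be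
  concatenated.\<close>

lemma reach_block:
  "\<exists>c\<ge>0. \<forall>\<sigma> k s0 s. 0 \<le> \<sigma> \<longrightarrow> \<sigma> \<le> reach k s0 \<longrightarrow>
    reach (k + l) (s0 + s) \<ge> \<sigma> * truncated_mean \<nu> J l s - \<sigma>\<^sup>2 * c"
proof (induction l)
  case 0
  have "reach k (s0 + s) \<ge> \<sigma> * truncated_mean \<nu> J 0 s - \<sigma>\<^sup>2 * 0" if "0 \<le> \<sigma>" "\<sigma> \<le> reach k s0" for \<sigma> k s0 s
    using that reach_bounds[of k "s0 + s"] reach_mono[of s0 "s0 + s" k] by (auto simp: indicator_def)
  then show ?case by (intro exI[of _ 0]) auto
next
  case (Suc l)
  then obtain c where c: "c \<ge> 0" "\<And>\<sigma> k s0 s. 0 \<le> \<sigma> \<Longrightarrow> \<sigma> \<le> reach k s0 \<Longrightarrow>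
    reach (k + l) (s0 + s) \<ge> \<sigma> * truncated_mean \<nu> J l s - \<sigma>\<^sup>2 * c" by blast
  have [measurable]: "truncated_mean \<nu> J l \<in> borel_measurable borel" using law.truncated_mean_bounds by blast
  \<comment> \<open>Each of the \<open>J\<close> children contributes the previous error, and the
    new quadratic term uses the crude bound \<open>J * J ^ l\<close> on the sum of the children's
    means.\<close>
  let ?c = "J * c + (J * real J ^ l)\<^sup>2 / 2"
  have "reach (k + Suc l) (s0 + s) \<ge> \<sigma> * truncated_mean \<nu> J (Suc l) s - \<sigma>\<^sup>2 * ?c"
    if \<sigma>: "0 \<le> \<sigma>" "\<sigma> \<le> reach k s0" for \<sigma> k s0 s
  proof -
    define u where "u j p = (if mass p j > 0 then max 0 (\<sigma> * truncated_mean \<nu> J l (s - ln (mass p j)) - \<sigma>\<^sup>2 * c) else 0)" for j p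
    have [measurable]: "u j \<in> borel_measurable \<nu>" for j unfolding u_def by measurable
    let ?m = "\<lambda>j p. if mass p j > 0 then truncated_mean \<nu> J l (s - ln (mass p j)) else 0"
    have m: "0 \<le> ?m j p" "?m j p \<le> real J ^ l" for j p using law.truncated_mean_bounds by auto
    have summ: "0 \<le> (\<Sum>j<J. ?m j p)" "(\<Sum>j<J. ?m j p) \<le> J * real J ^ l" for p
      using m sum_bounded_above[of "{..<J}" "\<lambda>j. ?m j p" "real J ^ l"] by (auto intro!: sum_nonneg)
    have u0: "0 \<le> u j p" for j p by (simp add: u_def)
    have u1: "u j p \<le> \<sigma> * ?m j p" for j p
      using m[of p j] \<sigma> c by (auto simp: u_def split: if_splits)
    have u2: "u j p \<ge> \<sigma> * ?m j p - \<sigma>\<^sup>2 * c" for j p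
      using c by (auto simp: u_def)
    have sumu: "0 \<le> (\<Sum>j<J. u j p)" "(\<Sum>j<J. u j p) \<le> \<sigma> * (J * real J ^ l)" for p
    proof -
      show "0 \<le> (\<Sum>j<J. u j p)" using u0 by (intro sum_nonneg) auto
      have "(\<Sum>j<J. u j p) \<le> \<sigma> * (\<Sum>j<J. ?m j p)"
        unfolding sum_distrib_left by (intro sum_mono u1)
      also have "\<dots> \<le> \<sigma> * (J * real J ^ l)" using summ \<sigma> by (intro mult_left_mono) auto
      finally show "(\<Sum>j<J. u j p) \<le> \<sigma> * (J * real J ^ l)" .
    qed
    have intm: "integrable \<nu> (\<lambda>p. \<Sum>j<J. ?m j p)"
      using summ by (intro law.integrable_const_bound[where B="J * real J ^ l"]) auto
    have sq: "(\<Sum>j<J. u j p)\<^sup>2 \<le> (\<sigma> * (J * real J ^ l))\<^sup>2" for p using sumu by (intro power_mono) auto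
    have intu: "integrable \<nu> (\<lambda>p. (\<Sum>j<J. u j p) - (\<Sum>j<J. u j p)\<^sup>2 / 2)"
      using sumu sq
      by (intro Bochner_Integration.integrable_diff law.integrable_const_bound[where B="\<sigma> * (J * real J ^ l)"]
          law.integrable_const_bound[where B="(\<sigma> * (J * real J ^ l))\<^sup>2 / 2"]) auto
    have "\<sigma> * truncated_mean \<nu> J (Suc l) s - \<sigma>\<^sup>2 * ?c = (\<integral>p. \<sigma> * (\<Sum>j<J. ?m j p) - \<sigma>\<^sup>2 * ?c \<partial>\<nu>)"
      using intm by (simp add: law.prob_space)
    also have "\<dots> \<le> (\<integral>p. (\<Sum>j<J. u j p) - (\<Sum>j<J. u j p)\<^sup>2 / 2 \<partial>\<nu>)"
    proof (rule integral_mono[OF _ intu])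
      fix p
      have "(\<Sum>j<J. \<sigma> * ?m j p - \<sigma>\<^sup>2 * c) \<le> (\<Sum>j<J. u j p)" by (intro sum_mono u2)
      then have "\<sigma> * (\<Sum>j<J. ?m j p) - J * (\<sigma>\<^sup>2 * c) \<le> (\<Sum>j<J. u j p)"
        by (simp add: sum_subtractf sum_distrib_left)
      then show "\<sigma> * (\<Sum>j<J. ?m j p) - \<sigma>\<^sup>2 * ?c \<le> (\<Sum>j<J. u j p) - (\<Sum>j<J. u j p)\<^sup>2 / 2"
        using sq[of p] by (simp add: power_mult_distrib algebra_simps)
    qed (use intm in auto)
    also have "\<dots> \<le> reach (Suc (k + l)) (s0 + s)"
    proof (rule reach_Suc_ge)
      fix p j assume p: "p \<in> space \<nu>"
      show "0 \<le> u j p" by (rule u0)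
      show "u j p = 0" if "mass p j = 0" using that by (simp add: u_def)
      show "u j p \<le> reach (k + l) (s0 + s - ln (mass p j))" if "mass p j > 0"
        using that c(2)[OF \<sigma>, of "s - ln (mass p j)"] reach_bounds by (simp add: u_def add_diff_eq)
    qed measurable
    finally show ?thesis by simp
  qed
  then show ?case using c(1) by (intro exI[of _ ?c]) auto
qed

text \<open>A block mean above 1 keeps a small enough \<sigma> from decreasing from block to block,
  the replacement for survival of a supercritical process.\<close>

lemma reach_linear:
  assumes ng: "\<not> geometric \<nu>" and t: "t > 0" "theta_low \<nu> < ereal (-t)"
    and phi: "phi \<nu> (-t) > 0" and \<alpha>: "\<alpha> < law.speed (-t)"
  obtains \<sigma> c where "\<sigma> > 0" "\<And>k. reach k (- \<alpha> * k + c) \<ge> \<sigma>"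
proof -
  obtain J l where l: "l > 0" "truncated_mean \<nu> J l (- \<alpha> * l) > 1"
    using law.truncated_mean_gt_1[OF t phi \<alpha>] by metis
  let ?A = "truncated_mean \<nu> J l (- \<alpha> * l)"
  obtain c where c: "c \<ge> 0" "\<And>\<sigma> k s0 s. 0 \<le> \<sigma> \<Longrightarrow> \<sigma> \<le> reach k s0 \<Longrightarrow>
    reach (k + l) (s0 + s) \<ge> \<sigma> * truncated_mean \<nu> J l s - \<sigma>\<^sup>2 * c"
    using reach_block[where l=l and J=J] by blast
  \<comment> \<open>Small enough that the excess \<open>?A - 1\<close> pays for the quadratic loss;
    at most 1 so that generation 0 satisfies the bound.\<close>
  define \<sigma> where "\<sigma> = min 1 ((?A - 1) / (c + 1))"
  have \<sigma>: "0 < \<sigma>" "\<sigma> \<le> 1" using l c by (auto simp: \<sigma>_def)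
  have "\<sigma> * c \<le> (?A - 1) / (c + 1) * (c + 1)"
    using c l \<sigma> by (intro mult_mono) (auto simp: \<sigma>_def)
  then have "\<sigma> * c \<le> ?A - 1" using c by simp
  then have "\<sigma> * (\<sigma> * c) \<le> \<sigma> * (?A - 1)" using \<sigma> by (intro mult_left_mono) auto
  then have \<sigma>A: "\<sigma> * ?A - \<sigma>\<^sup>2 * c \<ge> \<sigma>" by (simp add: power2_eq_square algebra_simps)
  have block: "reach (l * q) (- \<alpha> * (l * q)) \<ge> \<sigma>" for q
  proof (induction q)
    case 0
    show ?case using \<sigma> reach_0[of 0] by simp
  next
    case (Suc q)
    have "\<sigma> \<le> reach (l * q + l) (- \<alpha> * (l * q) + - \<alpha> * l)"
      using c(2)[OF less_imp_le[OF \<sigma>(1)] Suc, of "- \<alpha> * l"] \<sigma>A by linarith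
    then show ?case by (simp add: algebra_simps)
  qed
  obtain r where mono: "\<And>k m s. reach k s \<le> reach (k + m) s"
    using reach_boost[OF ng] by metis
  \<comment> \<open>Other generations are rounded down to a multiple of \<open>l\<close>: the
    threshold moves by at most \<open>\<bar>\<alpha>\<bar> * l\<close>, and \<open>reach\<close>
    does not decrease in the generation.\<close>
  have "reach k (- \<alpha> * k + \<bar>\<alpha>\<bar> * l) \<ge> \<sigma>" for k
  proof -
    define q where "q = k div l"
    have k: "k = l * q + k mod l" by (simp add: q_def)
    have "\<sigma> \<le> reach (l * q) (- \<alpha> * (l * q))" by (rule block)
    also have "\<dots> \<le> reach (l * q) (- \<alpha> * k + \<bar>\<alpha>\<bar> * l)"
    proof (rule reach_mono)
      have "\<alpha> * (k mod l) \<le> \<bar>\<alpha>\<bar> * l" using l by (intro mult_mono) (auto simp: less_imp_le)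
      moreover have "real k = real (l * q) + real (k mod l)" using k by linarith
      ultimately show "- \<alpha> * (l * q) \<le> - \<alpha> * k + \<bar>\<alpha>\<bar> * l" by (simp add: algebra_simps)
    qed
    also have "\<dots> \<le> reach k (- \<alpha> * k + \<bar>\<alpha>\<bar> * l)"
      using mono[of "l * q" _ "k mod l"] k by metis
    finally show ?thesis .
  qed
  then show ?thesis using that \<sigma>(1) by blast
qed

end

section \<open>Small boxes at the critical speed\<close>

text \<open>The analogue of \<^const>\<open>survival\<close> for the tilted walk when the \<open>j\<close>-th child carries the reduced
  weight \<open>v j\<close>, and only the labels below \<open>J\<close> are used.\<close>

primrec killed_survival ::
    "(nat \<Rightarrow> nat measure \<Rightarrow> real) \<Rightarrow> nat measure measure \<Rightarrow> real \<Rightarrow> real \<Rightarrow> nat \<Rightarrow> real \<Rightarrow> nat \<Rightarrow> real \<Rightarrow> real" where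
  "killed_survival v \<nu> t h J c 0 x = indicator {0..c} x"
| "killed_survival v \<nu> t h J c (Suc l) x = indicator {0..} x *
     (\<integral>p. (\<Sum>j<J. v j p * killed_survival v \<nu> t h J c l (x + t * (h + ln (mass p j)))) \<partial>\<nu>)"

context box_law
begin

text \<open>Step law of the tilted line of descent, recentred by the speed. After \<open>k\<close>
  steps from 0 the walk sits at \<open>t * (speed (-t) * k + ln size)\<close>, so nonnegativity
  means that the box is not smaller than the critical speed predicts.\<close>

definition tilted :: "real \<Rightarrow> real measure" where
  "tilted t = distr (density intensity (\<lambda>x. ennreal (x powr (-t) / Lr \<nu> (-t)))) borel
     (\<lambda>x. t * (speed (-t) + ln x))"

lemma sets_tilted[measurable_cong]: "sets (tilted t) = sets borel"
  by (simp add: tilted_def)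

lemma nn_integral_tilted:
  assumes [measurable]: "f \<in> borel_measurable borel"
  shows "(\<integral>\<^sup>+\<xi>. f \<xi> \<partial>tilted t) =
    (\<integral>\<^sup>+x. ennreal (x powr (-t) / Lr \<nu> (-t)) * f (t * (speed (-t) + ln x)) \<partial>intensity)"
  unfolding tilted_def by (simp add: nn_integral_distr nn_integral_density)

lemma integral_tilted:
  fixes f :: "real \<Rightarrow> real"
  assumes [measurable]: "f \<in> borel_measurable borel"
  shows "(\<integral>\<xi>. f \<xi> \<partial>tilted t) = (\<integral>x. x powr (-t) / Lr \<nu> (-t) * f (t * (speed (-t) + ln x)) \<partial>intensity)"
  unfolding tilted_def by (simp add: integral_distr integral_density)

lemma integrable_tilted:
  fixes f :: "real \<Rightarrow> real"
  assumes [measurable]: "f \<in> borel_measurable borel"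
  shows "integrable (tilted t) f \<longleftrightarrow>
    integrable intensity (\<lambda>x. x powr (-t) / Lr \<nu> (-t) * f (t * (speed (-t) + ln x)))"
  unfolding tilted_def by (simp add: integrable_distr_eq integrable_density)

lemma integrable_powr_ln_square:
  assumes "theta_low \<nu> < ereal \<theta>"
  shows "integrable intensity (\<lambda>x. x powr \<theta> * (ln x)\<^sup>2)"
proof -
  obtain \<theta>0 where \<theta>0: "\<theta>0 < \<theta>" "L \<nu> \<theta>0 < \<infinity>" using theta_low_less[OF assms] by metis
  define \<delta> where "\<delta> = (\<theta> - \<theta>0) / 2"
  have \<delta>: "\<delta> > 0" "\<theta> = \<theta>0 + \<delta> + \<delta>" using \<theta>0 by (auto simp: \<delta>_def field_simps)
  have "integrable intensity (\<lambda>x. x powr \<theta>0 / \<delta> / \<delta>)" using \<theta>0 by (simp add: integrable_intensity_iff)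
  then show ?thesis
  proof (rule Bochner_Integration.integrable_bound)
    show "AE x in intensity. norm (x powr \<theta> * (ln x)\<^sup>2) \<le> norm (x powr \<theta>0 / \<delta> / \<delta>)"
      using AE_intensity_unit
    proof eventually_elim
      case (elim x)
      have "x powr \<theta> * (ln x)\<^sup>2 = x powr (\<theta>0 + \<delta> + \<delta>) * \<bar>ln x\<bar> * \<bar>ln x\<bar>"
        unfolding \<delta>(2) by (simp add: power2_eq_square)
      also have "\<dots> \<le> x powr (\<theta>0 + \<delta>) / \<delta> * \<bar>ln x\<bar>"
        using elim \<delta> by (intro mult_right_mono powr_abs_ln_le) auto
      also have "\<dots> = x powr (\<theta>0 + \<delta>) * \<bar>ln x\<bar> / \<delta>" by simp
      also have "\<dots> \<le> x powr \<theta>0 / \<delta> / \<delta>"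
        using elim \<delta> by (intro divide_right_mono powr_abs_ln_le) auto
      finally show ?case using \<delta> by simp
    qed
  qed simp
qed

text \<open>If all positive masses equalled \<open>exp (- h)\<close>, the law would be geometric
  with that ratio; for \<open>h \<le> 0\<close> the bound \<open>x \<le> 1\<close> forces all of
  them to be 1.\<close>

lemma nondegenerate_intensity:
  assumes ng: "\<not> geometric \<nu>" and low: "theta_low \<nu> < ereal \<theta>"
  shows "\<not> (AE x in intensity. x = 0 \<or> h + ln x = 0)"
proof
  assume ae: "AE x in intensity. x = 0 \<or> h + ln x = 0"
  show False
  proof (cases "h > 0")
    case True
    have "AE x in intensity. x = 0 \<or> x = exp (- h)"
      using ae AE_intensity_unit
    proof eventually_elim
      case (elim x)
      show ?case
      proof (cases "x = 0")
        case False
        then have "ln x = - h" "x > 0" using elim by auto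
        then show ?thesis by (metis exp_ln)
      qed simp
    qed
    then have "AE p in \<nu>. \<forall>j. mass p j = 0 \<or> mass p j = exp (- h)"
      by (subst (asm) AE_intensity_iff) auto
    then have "AE p in \<nu>. \<forall>i. mass p i > 0 \<longrightarrow> mass p i \<in> range (\<lambda>n::nat. exp (- h) ^ n)"
    proof eventually_elim
      case (elim p)
      have "exp (- h) = exp (- h) ^ (1::nat)" by simp
      then have "exp (- h) \<in> range (\<lambda>n::nat. exp (- h) ^ n)" by (rule range_eqI)
      with elim show ?case by (metis less_irrefl)
    qed
    then show False using ng True unfolding geometric_def by (auto dest!: spec[of _ "exp (- h)"])
  next
    case False
    have "AE x in intensity. x = 0 \<or> x = 1"
      using ae AE_intensity_unit
    proof eventually_elim
      case (elim x)
      show ?case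
      proof (cases "x = 0")
        case False
        then have "ln x \<le> 0" "ln x = - h" "x > 0" using elim by auto
        then have "ln x = 0" using \<open>\<not> h > 0\<close> by linarith
        then show ?thesis using \<open>x > 0\<close> by simp
      qed simp
    qed
    then have "AE p in \<nu>. \<forall>j. mass p j = 0 \<or> mass p j = 1"
      by (subst (asm) AE_intensity_iff) auto
    then show False using not_dirac ng by simp
  qed
qed

lemma centered_step_tilted:
  assumes ng: "\<not> geometric \<nu>" and t: "t > 0" "theta_low \<nu> < ereal (-t)"
  shows "centered_step (tilted t)"
proof -
  let ?L = "Lr \<nu> (-t)" and ?h = "speed (-t)"
  have fin: "L \<nu> (-t) < \<infinity>" by (rule L_finite[OF t(2)])
  have L: "?L > 0" by (rule Lr_pos[OF fin])
  have i0: "integrable intensity (\<lambda>x. x powr (-t))" using fin by (simp add: integrable_intensity_iff)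
  note i1 = integrable_powr_ln[OF t(2)] and i2 = integrable_powr_ln_square[OF t(2)]
  have "emeasure (tilted t) (space (tilted t)) = 1"
  proof -
    have "emeasure (tilted t) (space (tilted t)) = (\<integral>\<^sup>+\<xi>. 1 \<partial>tilted t)" by simp
    also have "\<dots> = (\<integral>\<^sup>+x. ennreal (x powr (-t) / ?L) \<partial>intensity)"
      by (subst nn_integral_tilted) auto
    also have "\<dots> = ennreal (\<integral>x. x powr (-t) / ?L \<partial>intensity)"
      using i0 L by (intro nn_integral_eq_integral) auto
    also have "(\<integral>x. x powr (-t) / ?L \<partial>intensity) = 1"
      using L by (simp add: Lr_eq[symmetric])
    finally show ?thesis by simp
  qed
  then interpret T: prob_space "tilted t" by (rule prob_spaceI)
  show ?thesis
  proof unfold_locales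
    show "sets (tilted t) = sets borel" by (rule sets_tilted)
    have "x powr (-t) / ?L * (t * (?h + ln x))\<^sup>2 =
        t\<^sup>2 / ?L * (?h\<^sup>2 * x powr (-t) + 2 * ?h * (x powr (-t) * ln x) + x powr (-t) * (ln x)\<^sup>2)" for x
      by (simp add: power2_eq_square algebra_simps add_divide_distrib)
    then show "integrable (tilted t) (\<lambda>x. x\<^sup>2)"
      using i0 i1 i2 by (subst integrable_tilted) auto
    have "(\<integral>x. x \<partial>tilted t) = (\<integral>x. t / ?L * (?h * x powr (-t) + x powr (-t) * ln x) \<partial>intensity)"
      by (subst integral_tilted) (auto intro!: Bochner_Integration.integral_cong simp: algebra_simps add_divide_distrib)
    also have "\<dots> = t / ?L * (?h * ?L + deriv (Lr \<nu>) (-t))"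
      using i0 i1 by (simp add: Lr_eq[symmetric] deriv_Lr[OF t(2)])
    also have "\<dots> = 0" using L by (simp add: speed_def)
    finally show "(\<integral>x. x \<partial>tilted t) = 0" .
    show "\<not> (AE x in tilted t. x = 0)"
    proof
      assume "AE x in tilted t. x = 0"
      then have "AE x in density intensity (\<lambda>x. ennreal (x powr (-t) / ?L)). t * (?h + ln x) = 0"
        unfolding tilted_def by (subst (asm) AE_distr_iff) auto
      then have "AE x in intensity. 0 < x powr (-t) / ?L \<longrightarrow> t * (?h + ln x) = 0"
        by (subst (asm) AE_density) auto
      then have "AE x in intensity. x = 0 \<or> ?h + ln x = 0"
        using AE_intensity_unit by eventually_elim (use L t in \<open>auto simp: zero_less_divide_iff\<close>)
      then show False using nondegenerate_intensity[OF ng t(2)] by simp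
    qed
  qed
qed

text \<open>Masses are at most 1, so the steps are bounded above; large negative steps have an
  exponential moment of order \<kappa> because \<open>L\<close> is finite slightly to the left of
  \<open>-t\<close>.\<close>

lemma tail_tilted:
  assumes t: "t > 0" and \<kappa>: "\<kappa> > 0" "L \<nu> (- t * (1 + \<kappa>)) < \<infinity>"
  obtains C where "C > 0" "\<And>u. measure (tilted t) {x. \<bar>x\<bar> > u} \<le> C * exp (- \<kappa> * u)"
proof -
  let ?h = "speed (-t)"
  have "L \<nu> (-t) < \<infinity>"
    using L_antimono[of "- t * (1 + \<kappa>)" "-t"] t \<kappa> by (simp add: algebra_simps order.strict_trans1)
  then have L: "Lr \<nu> (-t) > 0" and i0: "integrable intensity (\<lambda>x. x powr (-t))"
    by (auto intro: Lr_pos simp: integrable_intensity_iff)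
  let ?e = "\<lambda>x. exp (\<kappa> * t * \<bar>?h\<bar>) + exp (- \<kappa> * x)"
  have eq: "x powr (-t) / Lr \<nu> (-t) * exp (- \<kappa> * (t * (?h + ln x))) =
      exp (- \<kappa> * t * ?h) / Lr \<nu> (-t) * x powr (- t * (1 + \<kappa>))" if "x \<ge> 0" for x
    using that by (cases "x = 0") (auto simp: powr_def algebra_simps simp flip: exp_add)
  have i1: "integrable (tilted t) (\<lambda>x. exp (- \<kappa> * x))"
  proof (subst integrable_tilted)
    have "integrable intensity (\<lambda>x. exp (- \<kappa> * t * ?h) / Lr \<nu> (-t) * x powr (- t * (1 + \<kappa>)))"
      using \<kappa>(2) by (simp add: integrable_intensity_iff)
    then show "integrable intensity (\<lambda>x. x powr (-t) / Lr \<nu> (-t) * exp (- \<kappa> * (t * (?h + ln x))))"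
    proof (rule Bochner_Integration.integrable_bound)
      show "AE x in intensity. norm (x powr (-t) / Lr \<nu> (-t) * exp (- \<kappa> * (t * (?h + ln x)))) \<le>
          norm (exp (- \<kappa> * t * ?h) / Lr \<nu> (-t) * x powr (- t * (1 + \<kappa>)))"
        using AE_intensity_unit by eventually_elim (simp only: eq order_refl)
    qed simp
  qed simp
  have ic: "integrable (tilted t) (\<lambda>x. c)" for c :: real
    using i0 L by (subst integrable_tilted) auto
  have ie: "integrable (tilted t) ?e" using i1 ic by simp
  define C where "C = (\<integral>x. ?e x \<partial>tilted t)"
  have C0: "C \<ge> 0" unfolding C_def by (auto intro!: integral_nonneg_AE add_nonneg_nonneg)
  have upper: "AE x in tilted t. x \<le> t * \<bar>?h\<bar>"
  proof -
    have "AE x in intensity. 0 < ennreal (x powr (-t) / Lr \<nu> (-t)) \<longrightarrow> t * (?h + ln x) \<le> t * \<bar>?h\<bar>"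
      using AE_intensity_unit
    proof eventually_elim
      case (elim x)
      show ?case
      proof
        assume "0 < ennreal (x powr (-t) / Lr \<nu> (-t))"
        then have "x > 0" using elim by (cases "x = 0") auto
        then have "ln x \<le> 0" using elim by simp
        then show "t * (?h + ln x) \<le> t * \<bar>?h\<bar>" using t by (intro mult_left_mono) auto
      qed
    qed
    then show ?thesis unfolding tilted_def by (simp add: AE_distr_iff AE_density)
  qed
  have bound: "measure (tilted t) {x. \<bar>x\<bar> > u} \<le> C * exp (- \<kappa> * u)" for u
  proof -
    have "emeasure (tilted t) {x. \<bar>x\<bar> > u} = (\<integral>\<^sup>+x. indicator {x. \<bar>x\<bar> > u} x \<partial>tilted t)"
      by simp
    also have "\<dots> \<le> (\<integral>\<^sup>+x. ennreal (exp (- \<kappa> * u) * ?e x) \<partial>tilted t)"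
      using upper
    proof (intro nn_integral_mono_AE, eventually_elim)
      case (elim x)
      have "exp (- \<kappa> * u) * ?e x \<ge> 1" if "\<bar>x\<bar> > u"
      proof -
        have "exp (\<kappa> * \<bar>x\<bar>) \<le> ?e x"
        proof (cases "x \<ge> 0")
          case True
          have "exp (\<kappa> * x) \<le> exp (\<kappa> * (t * \<bar>?h\<bar>))" using elim \<kappa> by simp
          then show ?thesis using True by (simp add: mult.assoc add_increasing2)
        qed (simp add: add_increasing)
        then have "exp (- \<kappa> * u) * exp (\<kappa> * \<bar>x\<bar>) \<le> exp (- \<kappa> * u) * ?e x" by (intro mult_left_mono) auto
        moreover have "exp (- \<kappa> * u) * exp (\<kappa> * \<bar>x\<bar>) \<ge> 1"
          using that \<kappa> by (simp flip: exp_add)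
        ultimately show ?thesis by linarith
      qed
      then show ?case by (simp add: indicator_def)
    qed
    also have "\<dots> = ennreal (\<integral>x. exp (- \<kappa> * u) * ?e x \<partial>tilted t)"
      using ie by (intro nn_integral_eq_integral) (auto intro!: add_nonneg_nonneg)
    also have "(\<integral>x. exp (- \<kappa> * u) * ?e x \<partial>tilted t) = C * exp (- \<kappa> * u)"
      using ie unfolding C_def by simp
    finally show ?thesis using C0 by (simp add: measure_def enn2real_leI)
  qed
  show ?thesis
  proof (rule that[of "C + 1"])
    fix u
    have "C * exp (- \<kappa> * u) \<le> (C + 1) * exp (- \<kappa> * u)" by (intro mult_right_mono) auto
    with bound[of u] show "measure (tilted t) {x. \<bar>x\<bar> > u} \<le> (C + 1) * exp (- \<kappa> * u)" by linarith
  qed (use C0 in simp)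
qed

lemma survival_tilted:
  assumes ng: "\<not> geometric \<nu>" and t: "t > 0" "theta_low \<nu> < ereal (-t)"
  obtains K where "K \<ge> 0" "\<forall>\<^sub>F k in sequentially. survival (tilted t) (K * ln k) k 0 \<ge> real k powr (-5)"
proof -
  interpret T: centered_step "tilted t" by (rule centered_step_tilted[OF assms])
  obtain \<theta>0 where \<theta>0: "\<theta>0 < -t" "L \<nu> \<theta>0 < \<infinity>" using theta_low_less[OF t(2)] by metis
  define \<kappa> where "\<kappa> = - \<theta>0 / t - 1"
  have \<kappa>: "\<kappa> > 0" "- t * (1 + \<kappa>) = \<theta>0" using \<theta>0 t by (auto simp: \<kappa>_def field_simps)
  obtain C where C: "C > 0" "\<And>u. measure (tilted t) {x. \<bar>x\<bar> > u} \<le> C * exp (- \<kappa> * u)"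
    using tail_tilted[OF t(1) \<kappa>(1)] \<theta>0(2) unfolding \<kappa>(2) by metis
  \<comment> \<open>Makes the tail at half the window width of order \<open>k powr (-4)\<close>.
    Then \<open>2 * k\<close> times this tail is negligible against \<open>sign_prob\<close> squared
    over \<open>k\<close> squared, and dividing by \<open>k\<close> squared leaves order
    \<open>k powr (-4)\<close>, more than required.\<close>
  define K where "K = 8 / \<kappa>"
  have tail: "T.tail (K * ln k / 2) \<le> C * real k powr (-4)" if "k > 0" for k :: nat
  proof -
    have "- \<kappa> * (K * ln k / 2) = (-4) * ln k" using \<kappa> by (simp add: K_def)
    then have "exp (- \<kappa> * (K * ln k / 2)) = real k powr (-4)" using that by (simp add: powr_def)
    then show ?thesis using C(2)[of "K * ln k / 2"] unfolding T.tail_def by simp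
  qed
  define S where "S = T.sign_prob\<^sup>2"
  have S: "S > 0" using T.sign_prob_pos by (simp add: S_def)
  have "\<forall>\<^sub>F k in sequentially. (S / (real k)\<^sup>2 - 2 * real k * (C * real k powr (-4))) / (real k)\<^sup>2 \<ge> real k powr (-5)"
    using S by real_asymp
  then have "\<forall>\<^sub>F k in sequentially. survival (tilted t) (K * ln k) k 0 \<ge> real k powr (-5)"
    using eventually_gt_at_top[of 0]
  proof eventually_elim
    case (elim k)
    have "(S / (real k)\<^sup>2 - 2 * real k * (C * real k powr (-4))) / (real k)\<^sup>2 \<le>
        (S / (real k)\<^sup>2 - 2 * real k * T.tail (K * ln k / 2)) / (real k)\<^sup>2"
      using tail[of k] elim by (intro divide_right_mono diff_left_mono mult_left_mono) auto
    also have "\<dots> \<le> survival (tilted t) (K * ln k) k 0"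
      unfolding S_def by (rule T.survival_lower_bound) (use elim in simp)
    finally show ?case using elim by linarith
  qed
  moreover have "K \<ge> 0" using \<kappa> by (simp add: K_def)
  ultimately show ?thesis using that by blast
qed

end

section \<open>Second-moment recursion along the surviving lines of descent\<close>

context box_tree
begin

declare killed_survival.simps(2) [simp del]

text \<open>Here \<open>x\<close> is the current walk position and \<open>c\<close> the largest
  allowed final one. The factor \<open>exp (- x)\<close> comes from undoing the tilt; \<eta> is a
  free small parameter making the linear term dominate the quadratic error, which grows only
  linearly in \<open>l\<close>. Measurability and bounds ride along in the same induction.\<close>

lemma reach_ge_killed:
  fixes v :: "nat \<Rightarrow> nat measure \<Rightarrow> real"
  assumes t: "t > 0" and h: "ln Lt = t * h" and Lt: "Lt > 0" "L \<nu> (-t) = ennreal Lt"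
    and [measurable]: "\<And>j. v j \<in> borel_measurable \<nu>"
    and v0: "\<And>j p. 0 \<le> v j p" and v1: "\<And>j p. v j p \<le> mass p j powr (-t) / Lt"
    and V: "\<And>p. p \<in> space \<nu> \<Longrightarrow> (\<Sum>j<J. v j p)\<^sup>2 \<le> V"
    and \<eta>: "0 \<le> \<eta>" "\<eta> \<le> 1"
  shows "killed_survival v \<nu> t h J c l \<in> borel_measurable borel \<and>
    (\<forall>x. 0 \<le> killed_survival v \<nu> t h J c l x \<and> killed_survival v \<nu> t h J c l x \<le> 1) \<and>
    (\<forall>x. reach l ((c - x) / t - h * l) \<ge> \<eta> * exp (- x) * killed_survival v \<nu> t h J c l x - \<eta>\<^sup>2 * l * V * exp (- x) / 2) \<and>
    (\<forall>x<0. killed_survival v \<nu> t h J c l x = 0)"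
proof (induction l)
  case 0
  have "killed_survival v \<nu> t h J c 0 = indicator {0..c}" by (rule ext) simp
  moreover have "reach 0 ((c - x) / t - h * real 0) \<ge> \<eta> * exp (- x) * indicator {0..c} x" for x
  proof (cases "x \<in> {0..c}")
    case True
    then have "reach 0 ((c - x) / t - h * real 0) = 1" using t by (intro reach_0) simp
    moreover have "\<eta> * exp (- x) \<le> 1 * 1" using \<eta> True by (intro mult_mono) auto
    ultimately show ?thesis using True by simp
  qed (simp add: reach_bounds)
  ultimately show ?case by (auto simp: indicator_def)
next
  case (Suc l)
  let ?s = "killed_survival v \<nu> t h J c"
  have [measurable]: "?s l \<in> borel_measurable borel" using Suc by blast
  have s01: "0 \<le> ?s l x" "?s l x \<le> 1" for x using Suc by auto
  have IH: "reach l ((c - x) / t - h * l) \<ge> \<eta> * exp (- x) * ?s l x - \<eta>\<^sup>2 * l * V * exp (- x) / 2" for x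
    using Suc by blast
  have sneg: "?s l x = 0" if "x < 0" for x using Suc that by blast
  obtain p0 where "p0 \<in> space \<nu>" using law.not_empty by blast
  then have V0: "V \<ge> 0" using V[of p0] zero_le_power2 order.trans by blast
  let ?\<xi> = "\<lambda>j p. t * (h + ln (mass p j))"
  have intsum: "integrable \<nu> (\<lambda>p. \<Sum>j<J. v j p)"
  proof (rule law.integrable_const_bound[where B="1 + V"])
    show "AE p in \<nu>. norm (\<Sum>j<J. v j p) \<le> 1 + V"
    proof (rule AE_I2)
      fix p assume "p \<in> space \<nu>"
      have "\<bar>x\<bar> \<le> 1 + x\<^sup>2" for x :: real
        using zero_le_power2[of "\<bar>x\<bar> - 1"] abs_ge_zero[of x] unfolding power2_diff power2_abs by simp
      then show "norm (\<Sum>j<J. v j p) \<le> 1 + V"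
        using V[OF \<open>p \<in> space \<nu>\<close>] unfolding real_norm_def by (rule order.trans[OF _ add_left_mono])
    qed
  qed measurable
  have intvs: "integrable \<nu> (\<lambda>p. \<Sum>j<J. v j p * ?s l (x + ?\<xi> j p))" for x
  proof (rule Bochner_Integration.integrable_bound[OF intsum])
    show "AE p in \<nu>. norm (\<Sum>j<J. v j p * ?s l (x + ?\<xi> j p)) \<le> norm (\<Sum>j<J. v j p)"
      using v0 s01 by (intro AE_I2) (auto simp: abs_of_nonneg sum_nonneg intro!: sum_mono mult_left_le)
  qed measurable
  have sumv_le_1: "(\<integral>p. (\<Sum>j<J. v j p) \<partial>\<nu>) \<le> 1"
  proof -
    have Lfin: "L \<nu> (-t) < \<infinity>" using Lt by simp
    have "(\<integral>p. (\<Sum>j<J. v j p) \<partial>\<nu>) \<le> (\<integral>p. (\<Sum>j<J. mass p j powr (-t) / Lt) \<partial>\<nu>)"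
      using law.integrable_mass_powr[OF Lfin] v1 intsum by (intro integral_mono sum_mono) auto
    also have "\<dots> = (\<Sum>j<J. law.moment (-t) j) / Lt"
      using law.integrable_mass_powr[OF Lfin] by (simp add: law.moment_def sum_divide_distrib)
    also have "\<dots> \<le> Lt / Lt"
    proof (intro divide_right_mono)
      have "(\<Sum>j<J. law.moment (-t) j) \<le> (\<Sum>j. law.moment (-t) j)"
        using sums_summable[OF law.moment_sums[OF Lfin]]
        by (intro sum_le_suminf) (auto intro: law.moment_nonneg)
      then show "(\<Sum>j<J. law.moment (-t) j) \<le> Lt"
        using law.moment_sums[OF Lfin] Lt by (simp add: sums_iff)
    qed (use Lt in simp)
    finally show ?thesis using Lt by simp
  qed
  have Suc_eq: "?s (Suc l) x = indicator {0..} x * (\<integral>p. (\<Sum>j<J. v j p * ?s l (x + ?\<xi> j p)) \<partial>\<nu>)" for x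
    by (rule killed_survival.simps(2))
  have s1_01: "0 \<le> ?s (Suc l) x \<and> ?s (Suc l) x \<le> 1" for x
  proof -
    have "(\<integral>p. (\<Sum>j<J. v j p * ?s l (x + ?\<xi> j p)) \<partial>\<nu>) \<le> (\<integral>p. (\<Sum>j<J. v j p) \<partial>\<nu>)"
      using intsum intvs v0 s01 by (intro integral_mono sum_mono mult_left_le) auto
    moreover have "(\<integral>p. (\<Sum>j<J. v j p * ?s l (x + ?\<xi> j p)) \<partial>\<nu>) \<ge> 0"
      using v0 s01 by (intro integral_nonneg_AE AE_I2 sum_nonneg) auto
    ultimately show ?thesis using sumv_le_1 unfolding Suc_eq by (auto simp: indicator_def)
  qed
  have meas: "?s (Suc l) \<in> borel_measurable borel"
  proof -
    have "?s (Suc l) = (\<lambda>x. indicator {0..} x * (\<integral>p. (\<Sum>j<J. v j p * ?s l (x + ?\<xi> j p)) \<partial>\<nu>))"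
      by (rule ext) (rule Suc_eq)
    then show ?thesis by simp
  qed
  have main: "reach (Suc l) ((c - x) / t - h * Suc l) \<ge>
      \<eta> * exp (- x) * ?s (Suc l) x - \<eta>\<^sup>2 * Suc l * V * exp (- x) / 2" for x
  proof (cases "x \<ge> 0")
    case False
    then have a: "?s (Suc l) x = 0" unfolding Suc_eq by simp
    have "\<eta>\<^sup>2 * Suc l * V * exp (- x) / 2 \<ge> 0" using V0 by simp
    then show ?thesis
      using reach_bounds(1)[of "Suc l" "(c - x) / t - h * Suc l"] unfolding a by linarith
  next
    case True
    \<comment> \<open>The induction hypothesis for the child, scaled by the fraction of its full
      weight that \<open>v\<close> retains. This fraction is at most 1, so \<open>u\<close> remains
      a minorant.\<close>
    define u where "u j p = (if v j p > 0 then max 0 (\<eta> * exp (- (x + ?\<xi> j p)) * ?s l (x + ?\<xi> j p)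
      - \<eta>\<^sup>2 * l * V * exp (- (x + ?\<xi> j p)) / 2) * (v j p * Lt / mass p j powr (-t)) else 0)" for j p
    have [measurable]: "u j \<in> borel_measurable \<nu>" for j unfolding u_def by measurable
    have pos: "mass p j > 0" if "v j p > 0" for j p
      using v1[of j p] that by (cases "mass p j = 0") (auto simp: zero_less_measure_iff)
    \<comment> \<open>Criticality, \<open>ln Lt = t * h\<close>, is what turns the exponential of
      the step into the tilting weight.\<close>
    have w: "exp (- (x + ?\<xi> j p)) = exp (- x) * (mass p j powr (-t) / Lt)" if "mass p j > 0" for j p
    proof -
      have "?\<xi> j p = ln Lt + t * ln (mass p j)" by (simp add: h algebra_simps)
      then have "exp (- (x + ?\<xi> j p)) = exp (- x) * exp (- ln Lt) * exp (- t * ln (mass p j))"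
        by (simp flip: exp_add)
      then show ?thesis using that Lt by (simp add: powr_def exp_minus divide_inverse)
    qed
    have u_eq: "u j p = max 0 (\<eta> * exp (- x) * (v j p * ?s l (x + ?\<xi> j p)) - \<eta>\<^sup>2 * l * V * exp (- x) / 2 * v j p)" for j p
    proof (cases "v j p > 0")
      case True
      have m: "mass p j powr (-t) > 0" using pos[OF True] by simp
      let ?r = "v j p * Lt / mass p j powr (-t)"
      have r: "?r \<ge> 0" using True m Lt by simp
      have "u j p = max 0 ((\<eta> * exp (- (x + ?\<xi> j p)) * ?s l (x + ?\<xi> j p) - \<eta>\<^sup>2 * l * V * exp (- (x + ?\<xi> j p)) / 2) * ?r)"
      proof -
        have mx: "max 0 e * d = max 0 (e * d)" if "d \<ge> 0" for e d :: real
          using that by (simp add: max_mult_distrib_right)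
        show ?thesis unfolding mx[OF r, symmetric] u_def using True by simp
      qed
      also have "(\<eta> * exp (- (x + ?\<xi> j p)) * ?s l (x + ?\<xi> j p) - \<eta>\<^sup>2 * l * V * exp (- (x + ?\<xi> j p)) / 2) * ?r =
         \<eta> * exp (- x) * (v j p * ?s l (x + ?\<xi> j p)) - \<eta>\<^sup>2 * l * V * exp (- x) / 2 * v j p"
        unfolding w[OF pos[OF True]] using m Lt by (simp add: field_simps)
      finally show ?thesis .
    next
      case False
      then have "v j p = 0" using v0[of j p] by simp
      then show ?thesis by (simp add: u_def)
    qed
    have u0: "0 \<le> u j p" for j p unfolding u_eq by simp
    have u1: "u j p \<le> \<eta> * exp (- x) * v j p" for j p
    proof -
      have "v j p * ?s l (x + ?\<xi> j p) \<le> v j p" using v0 s01 by (intro mult_left_le) auto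
      then have "\<eta> * exp (- x) * (v j p * ?s l (x + ?\<xi> j p)) \<le> \<eta> * exp (- x) * v j p"
        using \<eta> by (intro mult_left_mono) auto
      moreover have "\<eta>\<^sup>2 * l * V * exp (- x) / 2 * v j p \<ge> 0" using V0 v0[of j p] by simp
      moreover have "\<eta> * exp (- x) * v j p \<ge> 0" using \<eta> v0[of j p] by simp
      ultimately show ?thesis unfolding u_eq by linarith
    qed
    have sumu: "0 \<le> (\<Sum>j<J. u j p)" "(\<Sum>j<J. u j p) \<le> \<eta> * exp (- x) * (\<Sum>j<J. v j p)" for p
      using u0 u1 by (auto intro!: sum_nonneg sum_mono simp: sum_distrib_left)
    \<comment> \<open>Killing at 0 pays off here: for \<open>x \<ge> 0\<close> the square of
      \<open>exp (- x)\<close> is at most \<open>exp (- x)\<close>, so each generation adds an error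
      of the same form.\<close>
    have sq: "(\<Sum>j<J. u j p)\<^sup>2 \<le> \<eta>\<^sup>2 * exp (- x) * V" if "p \<in> space \<nu>" for p
    proof -
      have "(\<Sum>j<J. u j p)\<^sup>2 \<le> (\<eta> * exp (- x) * (\<Sum>j<J. v j p))\<^sup>2" using sumu by (intro power_mono) auto
      also have "\<dots> = \<eta>\<^sup>2 * ((exp (- x))\<^sup>2 * (\<Sum>j<J. v j p)\<^sup>2)" by (simp add: power_mult_distrib mult.assoc)
      also have "\<dots> \<le> \<eta>\<^sup>2 * (exp (- x) * V)"
        using True V[OF that] by (intro mult_left_mono mult_mono) (auto simp: power2_eq_square)
      finally show ?thesis by (simp add: mult.assoc)
    qed
    have intu1: "integrable \<nu> (\<lambda>p. \<Sum>j<J. u j p)"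
    proof (rule Bochner_Integration.integrable_bound)
      show "integrable \<nu> (\<lambda>p. \<eta> * exp (- x) * (\<Sum>j<J. v j p))" using intsum by simp
      show "AE p in \<nu>. norm (\<Sum>j<J. u j p) \<le> norm (\<eta> * exp (- x) * (\<Sum>j<J. v j p))"
        using sumu by (intro AE_I2) (auto intro: order.trans[OF _ abs_ge_self])
    qed measurable
    have intu2: "integrable \<nu> (\<lambda>p. (\<Sum>j<J. u j p)\<^sup>2)"
      by (rule law.integrable_const_bound[where B="\<eta>\<^sup>2 * exp (- x) * V"]) (use sq in \<open>auto intro: AE_I2\<close>)
    let ?b = "\<lambda>p. \<eta> * exp (- x) * (\<Sum>j<J. v j p * ?s l (x + ?\<xi> j p)) - \<eta>\<^sup>2 * l * V * exp (- x) / 2 * (\<Sum>j<J. v j p)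
        - \<eta>\<^sup>2 * exp (- x) * V / 2"
    have "\<eta> * exp (- x) * ?s (Suc l) x - \<eta>\<^sup>2 * Suc l * V * exp (- x) / 2 \<le> (\<integral>p. ?b p \<partial>\<nu>)"
    proof -
      have "(\<integral>p. ?b p \<partial>\<nu>) = \<eta> * exp (- x) * ?s (Suc l) x -
          \<eta>\<^sup>2 * l * V * exp (- x) / 2 * (\<integral>p. (\<Sum>j<J. v j p) \<partial>\<nu>) - \<eta>\<^sup>2 * exp (- x) * V / 2"
        using intsum intvs True unfolding Suc_eq
        by (simp add: law.prob_space del: Bochner_Integration.integral_sum Bochner_Integration.integral_sum')
      moreover have "\<eta>\<^sup>2 * l * V * exp (- x) / 2 * (\<integral>p. (\<Sum>j<J. v j p) \<partial>\<nu>) \<le> \<eta>\<^sup>2 * l * V * exp (- x) / 2 * 1"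
        using sumv_le_1 V0 by (intro mult_left_mono) auto
      moreover have "\<eta>\<^sup>2 * Suc l * V * exp (- x) / 2 = \<eta>\<^sup>2 * l * V * exp (- x) / 2 * 1 + \<eta>\<^sup>2 * exp (- x) * V / 2"
        by (simp add: algebra_simps add_divide_distrib)
      ultimately show ?thesis by linarith
    qed
    also have "\<dots> \<le> (\<integral>p. (\<Sum>j<J. u j p) - (\<Sum>j<J. u j p)\<^sup>2 / 2 \<partial>\<nu>)"
    proof (rule integral_mono)
      show "integrable \<nu> ?b" using intsum intvs by (intro Bochner_Integration.integrable_diff integrable_mult_right) auto
      show "integrable \<nu> (\<lambda>p. (\<Sum>j<J. u j p) - (\<Sum>j<J. u j p)\<^sup>2 / 2)" using intu1 intu2 by auto
      fix p assume p: "p \<in> space \<nu>"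
      have "(\<Sum>j<J. \<eta> * exp (- x) * (v j p * ?s l (x + ?\<xi> j p)) - \<eta>\<^sup>2 * l * V * exp (- x) / 2 * v j p) \<le> (\<Sum>j<J. u j p)"
        unfolding u_eq by (intro sum_mono) simp
      then have "\<eta> * exp (- x) * (\<Sum>j<J. v j p * ?s l (x + ?\<xi> j p)) - \<eta>\<^sup>2 * l * V * exp (- x) / 2 * (\<Sum>j<J. v j p) \<le> (\<Sum>j<J. u j p)"
        by (simp only: sum_subtractf sum_distrib_left)
      then show "?b p \<le> (\<Sum>j<J. u j p) - (\<Sum>j<J. u j p)\<^sup>2 / 2"
        using sq[OF p] by linarith
    qed
    also have "\<dots> \<le> reach (Suc l) ((c - x) / t - h * Suc l)"
    proof (rule reach_Suc_ge)
      fix p j assume "p \<in> space \<nu>"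
      show "0 \<le> u j p" by (rule u0)
      show "u j p = 0" if "mass p j = 0" using pos[of j p] that by (auto simp: u_def)
      assume m: "mass p j > 0"
      have arg: "(c - (x + ?\<xi> j p)) / t - h * l = (c - x) / t - h * Suc l - ln (mass p j)"
        using t by (simp add: field_simps)
      show "u j p \<le> reach l ((c - x) / t - h * Suc l - ln (mass p j))"
      proof (cases "v j p > 0")
        case True
        let ?e = "\<eta> * exp (- (x + ?\<xi> j p)) * ?s l (x + ?\<xi> j p) - \<eta>\<^sup>2 * l * V * exp (- (x + ?\<xi> j p)) / 2"
        have "v j p * Lt / mass p j powr (-t) \<le> 1" using v1[of j p] m Lt by (simp add: field_simps)
        then have "max 0 ?e * (v j p * Lt / mass p j powr (-t)) \<le> max 0 ?e" by (intro mult_left_le) auto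
        then have "u j p \<le> max 0 ?e" unfolding u_def using True by simp
        also have "\<dots> \<le> reach l ((c - (x + ?\<xi> j p)) / t - h * l)"
          using IH[of "x + ?\<xi> j p"] reach_bounds(1) by simp
        finally show ?thesis unfolding arg .
      qed (simp add: u_def reach_bounds)
    qed measurable
    finally show ?thesis .
  qed
  have "?s (Suc l) x = 0" if "x < 0" for x using that unfolding Suc_eq by simp
  then show ?case using meas s1_01 main by blast
qed

text \<open>Many-to-one formula for one generation; it is an inequality because \<open>v\<close> may
  keep only part of the weights and only the labels below \<open>J\<close>.\<close>

lemma integral_tilted_ge:
  fixes v :: "nat \<Rightarrow> nat measure \<Rightarrow> real" and f :: "real \<Rightarrow> real"
  assumes [measurable]: "f \<in> borel_measurable borel" and f: "\<And>x. 0 \<le> f x"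
    and int: "integrable (law.tilted t) f"
    and [measurable]: "\<And>j. v j \<in> borel_measurable \<nu>"
    and v0: "\<And>j p. 0 \<le> v j p" and v1: "\<And>j p. v j p \<le> mass p j powr (-t) / Lr \<nu> (-t)"
    and intv: "integrable \<nu> (\<lambda>p. \<Sum>j<J. v j p * f (t * (law.speed (-t) + ln (mass p j))))"
  shows "(\<integral>p. (\<Sum>j<J. v j p * f (t * (law.speed (-t) + ln (mass p j)))) \<partial>\<nu>) \<le> (\<integral>\<xi>. f \<xi> \<partial>law.tilted t)"
proof -
  let ?\<xi> = "\<lambda>j p. t * (law.speed (-t) + ln (mass p j))"
  let ?w = "\<lambda>j p. mass p j powr (-t) / Lr \<nu> (-t)"
  have "ennreal (\<integral>p. (\<Sum>j<J. v j p * f (?\<xi> j p)) \<partial>\<nu>) = (\<integral>\<^sup>+p. ennreal (\<Sum>j<J. v j p * f (?\<xi> j p)) \<partial>\<nu>)"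
    using intv v0 f by (intro nn_integral_eq_integral[symmetric] AE_I2 sum_nonneg) auto
  also have "\<dots> \<le> (\<integral>\<^sup>+p. (\<Sum>j. ennreal (?w j p) * ennreal (f (?\<xi> j p))) \<partial>\<nu>)"
  proof (intro nn_integral_mono)
    fix p
    have "ennreal (\<Sum>j<J. v j p * f (?\<xi> j p)) = (\<Sum>j<J. ennreal (v j p * f (?\<xi> j p)))"
      using v0 f by (simp add: sum_ennreal)
    also have "\<dots> \<le> (\<Sum>j<J. ennreal (?w j p) * ennreal (f (?\<xi> j p)))"
    proof (intro sum_mono)
      fix j
      have "v j p * f (?\<xi> j p) \<le> ?w j p * f (?\<xi> j p)" using v1 f by (intro mult_right_mono) auto
      then show "ennreal (v j p * f (?\<xi> j p)) \<le> ennreal (?w j p) * ennreal (f (?\<xi> j p))"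
        using f by (simp add: ennreal_mult''[symmetric] ennreal_leI)
    qed
    also have "\<dots> \<le> (\<Sum>j. ennreal (?w j p) * ennreal (f (?\<xi> j p)))"
      by (intro sum_le_suminf) auto
    finally show "ennreal (\<Sum>j<J. v j p * f (?\<xi> j p)) \<le> (\<Sum>j. ennreal (?w j p) * ennreal (f (?\<xi> j p)))" .
  qed
  also have "\<dots> = (\<integral>\<^sup>+\<xi>. ennreal (f \<xi>) \<partial>law.tilted t)"
    by (subst law.nn_integral_tilted, simp, subst law.nn_integral_intensity) simp_all
  also have "\<dots> = ennreal (\<integral>\<xi>. f \<xi> \<partial>law.tilted t)"
    using int f by (intro nn_integral_eq_integral) auto
  finally show ?thesis using f by (simp add: integral_nonneg_AE)
qed

text \<open>Each generation loses at most the discarded weight \<open>d\<close>, since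
  \<open>survival\<close> is bounded by 1; the losses add up.\<close>

lemma killed_ge_survival:
  fixes v :: "nat \<Rightarrow> nat measure \<Rightarrow> real"
  assumes ng: "\<not> geometric \<nu>" and t: "t > 0" "theta_low \<nu> < ereal (-t)"
    and h: "law.loglap (-t) = t * law.speed (-t)"
    and [measurable]: "\<And>j. v j \<in> borel_measurable \<nu>"
    and v0: "\<And>j p. 0 \<le> v j p" and v1: "\<And>j p. v j p \<le> mass p j powr (-t) / Lr \<nu> (-t)"
    and V: "\<And>p. p \<in> space \<nu> \<Longrightarrow> (\<Sum>j<J. v j p)\<^sup>2 \<le> V"
    and d: "0 \<le> d" "(\<integral>p. (\<Sum>j<J. v j p) \<partial>\<nu>) \<ge> 1 - d"
  shows "killed_survival v \<nu> t (law.speed (-t)) J c l x \<ge> survival (law.tilted t) c l x - l * d"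
proof -
  let ?h = "law.speed (-t)" and ?\<mu> = "law.tilted t"
  interpret T: centered_step ?\<mu> by (rule law.centered_step_tilted[OF ng t])
  have fin: "L \<nu> (-t) < \<infinity>" by (rule law.L_finite[OF t(2)])
  have Lt: "Lr \<nu> (-t) > 0" "ln (Lr \<nu> (-t)) = t * ?h" "L \<nu> (-t) = ennreal (Lr \<nu> (-t))"
    using h law.Lr_pos[OF fin] law.L_eq_Lr[OF fin] by (auto simp: law.loglap_def)
  \<comment> \<open>Taken at \<eta> = 0, merely to obtain measurability and the bounds of
    \<open>killed_survival\<close>.\<close>
  note K = reach_ge_killed[OF t(1) Lt(2,1,3) _ v0 v1 V, of 0]
  have int: "integrable \<nu> (\<lambda>p. \<Sum>j<J. v j p * f (t * (?h + ln (mass p j))))"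
    if [measurable]: "f \<in> borel_measurable borel" and f: "\<And>x. \<bar>f x\<bar> \<le> 1" for f :: "real \<Rightarrow> real"
  proof (rule Bochner_Integration.integrable_bound)
    show "integrable \<nu> (\<lambda>p. \<Sum>j<J. mass p j powr (-t) / Lr \<nu> (-t))"
      using law.integrable_mass_powr[OF fin] by auto
    show "AE p in \<nu>. norm (\<Sum>j<J. v j p * f (t * (?h + ln (mass p j)))) \<le> norm (\<Sum>j<J. mass p j powr (-t) / Lr \<nu> (-t))"
    proof (rule AE_I2)
      fix p
      have "norm (\<Sum>j<J. v j p * f (t * (?h + ln (mass p j)))) \<le> (\<Sum>j<J. norm (v j p * f (t * (?h + ln (mass p j)))))"
        by (rule norm_sum)
      also have "\<dots> \<le> (\<Sum>j<J. mass p j powr (-t) / Lr \<nu> (-t))"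
      proof (rule sum_mono)
        fix j
        have "norm (v j p * f (t * (?h + ln (mass p j)))) \<le> v j p * 1"
          unfolding real_norm_def abs_mult abs_of_nonneg[OF v0] using f v0 by (intro mult_left_mono) auto
        then show "norm (v j p * f (t * (?h + ln (mass p j)))) \<le> mass p j powr (-t) / Lr \<nu> (-t)"
          using v1[of j p] by linarith
      qed
      finally show "norm (\<Sum>j<J. v j p * f (t * (?h + ln (mass p j)))) \<le> norm (\<Sum>j<J. mass p j powr (-t) / Lr \<nu> (-t))"
        by simp
    qed
  qed measurable
  have intv: "integrable \<nu> (\<lambda>p. \<Sum>j<J. v j p)" using int[of "\<lambda>_. 1"] by simp
  have sumv: "(\<integral>p. (\<Sum>j<J. v j p) \<partial>\<nu>) \<le> 1"
  proof -
    have "(\<integral>p. (\<Sum>j<J. v j p * 1) \<partial>\<nu>) \<le> (\<integral>\<xi>. 1 \<partial>?\<mu>)"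
    proof (rule integral_tilted_ge[where f="\<lambda>_. 1", OF _ _ _ _ v0 v1])
      show "integrable \<nu> (\<lambda>p. \<Sum>j<J. v j p * 1)" unfolding mult_1_right by (rule intv)
    qed auto
    also have "(\<integral>\<xi>. 1 \<partial>?\<mu>) = (1::real)" using T.prob_space by simp
    finally show ?thesis by (simp only: mult_1_right)
  qed
  show ?thesis
  proof (induction l arbitrary: x)
    case (Suc l)
    let ?S = "survival ?\<mu> c l" and ?K = "killed_survival v \<nu> t ?h J c l"
    have [measurable]: "?S \<in> borel_measurable borel" "?K \<in> borel_measurable borel"
      using T.survival_bounds K by auto
    have S: "0 \<le> ?S y" "?S y \<le> 1" for y using T.survival_bounds by auto
    have K01: "0 \<le> ?K y" "?K y \<le> 1" for y using K by auto
    show ?case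
    proof (cases "x \<ge> 0")
      case False
      then show ?thesis using d by (simp add: killed_survival.simps)
    next
      case True
      have intS: "integrable ?\<mu> (\<lambda>\<xi>. ?S (x + \<xi>))"
        using S by (intro T.integrable_const_bound[where B=1]) auto
      let ?\<xi> = "\<lambda>j p. t * (?h + ln (mass p j))"
      have iS: "integrable \<nu> (\<lambda>p. \<Sum>j<J. v j p * ?S (x + ?\<xi> j p))"
        using S by (intro int[of "\<lambda>y. ?S (x + y)"]) auto
      have iK: "integrable \<nu> (\<lambda>p. \<Sum>j<J. v j p * ?K (x + ?\<xi> j p))"
        using K01 by (intro int[of "\<lambda>y. ?K (x + y)"]) auto
      \<comment> \<open>The comparison bounds weighted sums from above only. Applied to
        \<open>1 - ?S\<close> it yields the lower bound for \<open>?S\<close>, at the price of the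
        missing weight \<open>d\<close>.\<close>
      have "(\<integral>p. (\<Sum>j<J. v j p * (1 - ?S (x + ?\<xi> j p))) \<partial>\<nu>) \<le> (\<integral>\<xi>. 1 - ?S (x + \<xi>) \<partial>?\<mu>)"
        using S v0 v1 intS by (intro integral_tilted_ge[where f="\<lambda>y. 1 - ?S (x + y)"] int[of "\<lambda>y. 1 - ?S (x + y)"]) auto
      also have "\<dots> = 1 - (\<integral>\<xi>. ?S (x + \<xi>) \<partial>?\<mu>)" using intS by (simp add: T.prob_space)
      also have "(\<integral>p. (\<Sum>j<J. v j p * (1 - ?S (x + ?\<xi> j p))) \<partial>\<nu>) =
          (\<integral>p. (\<Sum>j<J. v j p) \<partial>\<nu>) - (\<integral>p. (\<Sum>j<J. v j p * ?S (x + ?\<xi> j p)) \<partial>\<nu>)"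
        using Bochner_Integration.integral_diff[OF intv iS] by (simp only: right_diff_distrib mult_1_right sum_subtractf)
      finally have 1: "(\<integral>\<xi>. ?S (x + \<xi>) \<partial>?\<mu>) - d \<le> (\<integral>p. (\<Sum>j<J. v j p * ?S (x + ?\<xi> j p)) \<partial>\<nu>)"
        using d by linarith
      have "(\<integral>p. (\<Sum>j<J. v j p * ?S (x + ?\<xi> j p)) - l * d * (\<Sum>j<J. v j p) \<partial>\<nu>) \<le> (\<integral>p. (\<Sum>j<J. v j p * ?K (x + ?\<xi> j p)) \<partial>\<nu>)"
      proof (rule integral_mono)
        show "integrable \<nu> (\<lambda>p. (\<Sum>j<J. v j p * ?S (x + ?\<xi> j p)) - l * d * (\<Sum>j<J. v j p))"
          using iS intv by (intro Bochner_Integration.integrable_diff integrable_mult_right)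
        fix p
        have "(\<Sum>j<J. v j p * (?S (x + ?\<xi> j p) - l * d)) \<le> (\<Sum>j<J. v j p * ?K (x + ?\<xi> j p))"
          using Suc v0 by (intro sum_mono mult_left_mono) auto
        moreover have "(\<Sum>j<J. v j p * (?S (x + ?\<xi> j p) - l * d)) =
            (\<Sum>j<J. v j p * ?S (x + ?\<xi> j p)) - l * d * (\<Sum>j<J. v j p)"
          by (simp add: right_diff_distrib sum_subtractf sum_distrib_left mult.commute)
        ultimately show "(\<Sum>j<J. v j p * ?S (x + ?\<xi> j p)) - l * d * (\<Sum>j<J. v j p) \<le> (\<Sum>j<J. v j p * ?K (x + ?\<xi> j p))"
          by linarith
      qed (rule iK)
      moreover have "(\<integral>p. (\<Sum>j<J. v j p * ?S (x + ?\<xi> j p)) - l * d * (\<Sum>j<J. v j p) \<partial>\<nu>) =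
          (\<integral>p. (\<Sum>j<J. v j p * ?S (x + ?\<xi> j p)) \<partial>\<nu>) - l * d * (\<integral>p. (\<Sum>j<J. v j p) \<partial>\<nu>)"
        using Bochner_Integration.integral_diff[OF iS integrable_mult_right[OF intv, of "l * d"]] by simp
      moreover have "l * d * (\<integral>p. (\<Sum>j<J. v j p) \<partial>\<nu>) \<le> l * d * 1"
        using sumv d by (intro mult_left_mono) auto
      moreover have "killed_survival v \<nu> t ?h J c (Suc l) x = (\<integral>p. (\<Sum>j<J. v j p * ?K (x + ?\<xi> j p)) \<partial>\<nu>)"
        using True by (simp add: killed_survival.simps)
      moreover have "survival ?\<mu> c (Suc l) x = (\<integral>\<xi>. ?S (x + \<xi>) \<partial>?\<mu>)" using True by simp
      moreover have "Suc l * d = l * d + d" by (simp add: algebra_simps)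
      ultimately show ?thesis using 1 by linarith
    qed
  qed simp
qed

end

section \<open>Truncated weights and the critical lower bound for \<open>reach\<close>\<close>

context box_tree
begin

text \<open>Discarding the offspring of boxes with more than \<open>D\<close> children, and the children of weight above
  \<open>D'\<close>, bounds the second moment; the moment assumption on the number of children makes the
  loss polynomially small.\<close>

definition kept :: "real \<Rightarrow> nat \<Rightarrow> real \<Rightarrow> real \<Rightarrow> nat \<Rightarrow> nat measure \<Rightarrow> real" where
  "kept t J D D' j p = (if real (card {i. i < J \<and> mass p i > 0}) \<le> D \<and> mass p j powr (-t) \<le> D'
     then mass p j powr (-t) / Lr \<nu> (-t) else 0)"

lemma card_measurable[measurable]: "(\<lambda>p. real (card {i. i < J \<and> mass p i > 0})) \<in> borel_measurable \<nu>"
proof -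
  have eq: "real (card {i. i < J \<and> mass p i > 0}) = (\<Sum>i<J. if mass p i > 0 then 1 else 0)" for p
    by (simp add: sum.If_cases Int_def conj_commute)
  show ?thesis unfolding eq by measurable
qed

lemma kept_measurable[measurable]: "kept t J D D' j \<in> borel_measurable \<nu>"
  unfolding kept_def by measurable

lemma kept_bounds:
  assumes "Lr \<nu> (-t) > 0"
  shows "0 \<le> kept t J D D' j p" "kept t J D D' j p \<le> mass p j powr (-t) / Lr \<nu> (-t)"
  using assms by (auto simp: kept_def)

lemma sum_kept_le:
  assumes Lt: "Lr \<nu> (-t) > 0" and D: "D \<ge> 0" "D' \<ge> 0"
  shows "(\<Sum>j<J. kept t J D D' j p) \<le> D * D' / Lr \<nu> (-t)"
proof (cases "real (card {i. i < J \<and> mass p i > 0}) \<le> D")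
  case True
  have "(\<Sum>j<J. kept t J D D' j p) \<le> (\<Sum>j<J. if mass p j > 0 then D' / Lr \<nu> (-t) else 0)"
    using Lt D by (intro sum_mono) (auto simp: kept_def divide_right_mono zero_less_measure_iff)
  also have "\<dots> = real (card {i. i < J \<and> mass p i > 0}) * (D' / Lr \<nu> (-t))"
    by (simp add: sum.If_cases Int_def conj_commute)
  also have "\<dots> \<le> D * (D' / Lr \<nu> (-t))" using True Lt D by (intro mult_right_mono) auto
  finally show ?thesis by simp
next
  case False
  then have "(\<Sum>j<J. kept t J D D' j p) = 0" by (simp add: kept_def)
  then show ?thesis using Lt D by simp
qed

lemma integral_card_powr_le:
  assumes fin: "atoms_moment \<nu> a < \<infinity>" and "a \<ge> 0"
  shows "integrable \<nu> (\<lambda>p. real (card {i. i < J \<and> mass p i > 0}) powr a)"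
    and "(\<integral>p. real (card {i. i < J \<and> mass p i > 0}) powr a \<partial>\<nu>) \<le> enn2real (atoms_moment \<nu> a)"
proof -
  let ?f = "\<lambda>p. real (card {i. i < J \<and> mass p i > 0}) powr a"
  have le: "(\<integral>\<^sup>+p. ennreal (?f p) \<partial>\<nu>) \<le> atoms_moment \<nu> a"
    unfolding atoms_moment_def
  proof (intro nn_integral_mono)
    fix p
    show "ennreal (?f p) \<le> (if finite {i. mass p i > 0} then ennreal (real (card {i. mass p i > 0}) powr a) else \<infinity>)"
    proof (cases "finite {i. mass p i > 0}")
      case True
      then have "card {i. i < J \<and> mass p i > 0} \<le> card {i. mass p i > 0}" by (intro card_mono) auto
      then have "?f p \<le> real (card {i. mass p i > 0}) powr a" using assms by (intro powr_mono2) auto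
      then show ?thesis using True by (simp add: ennreal_leI)
    qed simp
  qed
  show i: "integrable \<nu> ?f"
    using le fin by (intro integrableI_bounded) (auto intro: order.strict_trans1)
  have "ennreal (\<integral>p. ?f p \<partial>\<nu>) \<le> atoms_moment \<nu> a"
    using le i by (subst nn_integral_eq_integral[symmetric]) auto
  then have "enn2real (ennreal (\<integral>p. ?f p \<partial>\<nu>)) \<le> enn2real (atoms_moment \<nu> a)"
    using fin by (intro enn2real_mono) auto
  then show "(\<integral>p. ?f p \<partial>\<nu>) \<le> enn2real (atoms_moment \<nu> a)"
    by (simp add: integral_nonneg_AE)
qed

text \<open>A discarded weight \<open>w\<close> either exceeds \<open>D'\<close>, and then
  \<open>w \<le> D' powr (-\<kappa>) * w powr (1 + \<kappa>)\<close>, or has more than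
  \<open>D\<close> siblings counting itself, and then
  \<open>w \<le> D' * (N / D) powr \<delta>\<close>. Summing the latter over the \<open>N\<close>
  children produces the moment of order \<open>1 + \<delta>\<close>.\<close>

lemma kept_deficit:
  assumes t: "t > 0" and \<kappa>: "\<kappa> > 0" "L \<nu> (- t * (1 + \<kappa>)) < \<infinity>"
    and \<delta>: "\<delta> > 0" "atoms_moment \<nu> (1 + \<delta>) < \<infinity>" and D: "D > 0" "D' > 0"
  shows "(\<integral>p. (\<Sum>j<J. kept t J D D' j p) \<partial>\<nu>) \<ge> (\<Sum>j<J. law.moment (-t) j) / Lr \<nu> (-t) -
    (D' powr (-\<kappa>) * Lr \<nu> (- t * (1 + \<kappa>)) + D' * D powr (-\<delta>) * enn2real (atoms_moment \<nu> (1 + \<delta>))) / Lr \<nu> (-t)"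
proof -
  let ?\<theta> = "- t * (1 + \<kappa>)" and ?E = "enn2real (atoms_moment \<nu> (1 + \<delta>))"
  let ?N = "\<lambda>p. real (card {i. i < J \<and> mass p i > 0})"
  have fin: "L \<nu> (-t) < \<infinity>"
    using law.L_antimono[of ?\<theta> "-t"] t \<kappa> by (simp add: algebra_simps order.strict_trans1)
  have Lt: "Lr \<nu> (-t) > 0" by (rule law.Lr_pos[OF fin])
  let ?g = "\<lambda>p. ((\<Sum>j<J. mass p j powr (-t)) - (D' powr (-\<kappa>) * (\<Sum>j<J. mass p j powr ?\<theta>) + D' * D powr (-\<delta>) * ?N p powr (1 + \<delta>))) / Lr \<nu> (-t)"
  note i1 = law.integrable_mass_powr[OF fin] and i2 = law.integrable_mass_powr[OF \<kappa>(2)]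
  have i3: "integrable \<nu> (\<lambda>p. ?N p powr (1 + \<delta>))" using \<delta> by (intro integral_card_powr_le) auto
  have ig: "integrable \<nu> ?g" using i1 i2 i3 by auto
  have ik: "integrable \<nu> (\<lambda>p. \<Sum>j<J. kept t J D D' j p)"
  proof (rule law.integrable_const_bound[where B="D * D' / Lr \<nu> (-t)"])
    show "AE p in \<nu>. norm (\<Sum>j<J. kept t J D D' j p) \<le> D * D' / Lr \<nu> (-t)"
      using sum_kept_le[OF Lt, of D D' J] kept_bounds(1)[OF Lt] D by (intro AE_I2) (simp add: abs_of_nonneg sum_nonneg)
  qed measurable
  have pt: "?g p \<le> (\<Sum>j<J. kept t J D D' j p)" for p
  proof -
    have "(mass p j powr (-t) - (D' powr (-\<kappa>) * mass p j powr ?\<theta> + D' * D powr (-\<delta>) * (?N p powr \<delta> * (if mass p j > 0 then 1 else 0)))) / Lr \<nu> (-t)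
        \<le> kept t J D D' j p" if "j < J" for j
    proof -
      have nn: "D' powr (-\<kappa>) * mass p j powr ?\<theta> \<ge> 0" "D' * D powr (-\<delta>) * (?N p powr \<delta> * (if mass p j > 0 then 1 else 0)) \<ge> 0"
        using D by auto
      have "mass p j = 0 \<or> (?N p \<le> D \<and> mass p j powr (-t) \<le> D') \<or> (mass p j > 0 \<and> mass p j powr (-t) > D')
          \<or> (mass p j > 0 \<and> mass p j powr (-t) \<le> D' \<and> ?N p > D)"
        using zero_less_measure_iff[of p "{j}"] by argo
      then consider "mass p j = 0" | "?N p \<le> D \<and> mass p j powr (-t) \<le> D'" | "mass p j > 0" "mass p j powr (-t) > D'"
        | "mass p j > 0" "mass p j powr (-t) \<le> D'" "?N p > D"
        by blast
      then show ?thesis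
      proof cases
        case 1
        then show ?thesis by (simp add: kept_def)
      next
        case 2
        then have k: "kept t J D D' j p = mass p j powr (-t) / Lr \<nu> (-t)" by (simp add: kept_def)
        show ?thesis unfolding k using nn Lt by (intro divide_right_mono) linarith+
      next
        case 3
        have "1 \<le> (mass p j powr (-t) / D') powr \<kappa>"
          using 3 D \<kappa> by (intro ge_one_powr_ge_zero) auto
        then have "mass p j powr (-t) * 1 \<le> mass p j powr (-t) * (mass p j powr (-t) / D') powr \<kappa>"
          by (intro mult_left_mono) auto
        also have "\<dots> = D' powr (-\<kappa>) * mass p j powr ?\<theta>"
        proof -
          have e1: "(mass p j powr (-t) / D') powr \<kappa> = mass p j powr (-t * \<kappa>) * D' powr (-\<kappa>)"
            using D by (simp add: powr_divide powr_powr powr_minus_divide[of D'])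
          have e2: "mass p j powr (-t) * mass p j powr (-t * \<kappa>) = mass p j powr ?\<theta>"
            unfolding powr_add[symmetric] by (simp add: algebra_simps)
          show ?thesis unfolding e1 e2[symmetric] by (simp only: mult_ac)
        qed
        finally have "mass p j powr (-t) - (D' powr (-\<kappa>) * mass p j powr ?\<theta> + D' * D powr (-\<delta>) * (?N p powr \<delta> * (if mass p j > 0 then 1 else 0))) \<le> 0"
          using nn by linarith
        then show ?thesis using kept_bounds(1)[OF Lt, of J D D' j p] Lt
          by (meson divide_nonpos_pos order.trans)
      next
        case 4
        have "1 \<le> (?N p / D) powr \<delta>" using 4 D \<delta> by (intro ge_one_powr_ge_zero) auto
        then have "mass p j powr (-t) * 1 \<le> D' * (?N p / D) powr \<delta>"
          using 4 D by (intro mult_mono) auto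
        also have "\<dots> = D' * D powr (-\<delta>) * (?N p powr \<delta> * (if mass p j > 0 then 1 else 0))"
          using 4 D by (simp add: powr_divide powr_minus_divide)
        finally have "mass p j powr (-t) - (D' powr (-\<kappa>) * mass p j powr ?\<theta> + D' * D powr (-\<delta>) * (?N p powr \<delta> * (if mass p j > 0 then 1 else 0))) \<le> 0"
          using nn by linarith
        then show ?thesis using kept_bounds(1)[OF Lt, of J D D' j p] Lt
          by (meson divide_nonpos_pos order.trans)
      qed
    qed
    then have "(\<Sum>j<J. (mass p j powr (-t) - (D' powr (-\<kappa>) * mass p j powr ?\<theta> + D' * D powr (-\<delta>) * (?N p powr \<delta> * (if mass p j > 0 then 1 else 0)))) / Lr \<nu> (-t))
        \<le> (\<Sum>j<J. kept t J D D' j p)" by (intro sum_mono) auto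
    moreover have "(\<Sum>j<J. ?N p powr \<delta> * (if mass p j > 0 then 1 else 0)) = ?N p powr (1 + \<delta>)"
    proof -
      have "(\<Sum>j<J. (if mass p j > 0 then 1 else 0)) = ?N p" by (simp add: sum.If_cases Int_def conj_commute)
      then have "(\<Sum>j<J. ?N p powr \<delta> * (if mass p j > 0 then 1 else 0)) = ?N p powr \<delta> * ?N p"
        by (simp only: sum_distrib_left[symmetric])
      then show ?thesis by (cases "?N p = 0") (auto simp: powr_add mult.commute)
    qed
    ultimately show ?thesis
      by (simp only: sum_divide_distrib[symmetric] sum_subtractf sum.distrib sum_distrib_left[symmetric])
  qed
  have "(\<Sum>j<J. law.moment (-t) j) / Lr \<nu> (-t) -
    (D' powr (-\<kappa>) * Lr \<nu> ?\<theta> + D' * D powr (-\<delta>) * ?E) / Lr \<nu> (-t) \<le>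
    ((\<Sum>j<J. law.moment (-t) j) - (D' powr (-\<kappa>) * (\<Sum>j<J. law.moment ?\<theta> j) + D' * D powr (-\<delta>) * (\<integral>p. ?N p powr (1 + \<delta>) \<partial>\<nu>))) / Lr \<nu> (-t)"
  proof -
    have "(\<Sum>j<J. law.moment ?\<theta> j) \<le> Lr \<nu> ?\<theta>"
      using law.moment_sums[OF \<kappa>(2)] sum_le_suminf[OF sums_summable[OF law.moment_sums[OF \<kappa>(2)]], of "{..<J}"]
      by (simp add: law.moment_nonneg sums_iff)
    then have "D' powr (-\<kappa>) * (\<Sum>j<J. law.moment ?\<theta> j) \<le> D' powr (-\<kappa>) * Lr \<nu> ?\<theta>"
      by (intro mult_left_mono) auto
    moreover have "D' * D powr (-\<delta>) * (\<integral>p. ?N p powr (1 + \<delta>) \<partial>\<nu>) \<le> D' * D powr (-\<delta>) * ?E"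
      using \<delta> D by (intro mult_left_mono integral_card_powr_le) auto
    ultimately show ?thesis
      unfolding diff_divide_distrib[symmetric] using Lt by (intro divide_right_mono) auto
  qed
  also have "\<dots> = (\<integral>p. ?g p \<partial>\<nu>)"
    using i1 i2 i3 by (simp add: law.moment_def)
  also have "\<dots> \<le> (\<integral>p. (\<Sum>j<J. kept t J D D' j p) \<partial>\<nu>)"
    by (intro integral_mono ig ik pt)
  finally show ?thesis .
qed

lemma reach_critical:
  assumes ng: "\<not> geometric \<nu>" and t: "t > 0" "theta_low \<nu> < ereal (-t)"
    and h: "law.loglap (-t) = t * law.speed (-t)"
    and \<delta>: "\<delta> > 0" "atoms_moment \<nu> (1 + \<delta>) < \<infinity>"
  obtains K1 K2 where "K1 \<ge> 0" "K2 \<ge> 0"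
    "\<forall>\<^sub>F k in sequentially. reach k (- law.speed (-t) * k + K1 * ln k) \<ge> real k powr (-K2)"
proof -
  obtain K where K: "K \<ge> 0" "\<forall>\<^sub>F k in sequentially. survival (law.tilted t) (K * ln k) k 0 \<ge> real k powr (-5)"
    by (rule law.survival_tilted[OF ng t])
  obtain \<theta>0 where \<theta>0: "\<theta>0 < -t" "L \<nu> \<theta>0 < \<infinity>" using law.theta_low_less[OF t(2)] by metis
  define \<kappa> where "\<kappa> = - \<theta>0 / t - 1"
  have \<kappa>: "\<kappa> > 0" "- t * (1 + \<kappa>) = \<theta>0" using \<theta>0 t by (auto simp: \<kappa>_def field_simps)
  have fin: "L \<nu> (-t) < \<infinity>" by (rule law.L_finite[OF t(2)])
  define Lt where "Lt = Lr \<nu> (-t)"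
  have Lt: "Lt > 0" "ln Lt = t * law.speed (-t)" "L \<nu> (-t) = ennreal Lt"
    using h law.Lr_pos[OF fin] law.L_eq_Lr[OF fin] by (auto simp: law.loglap_def Lt_def)
  \<comment> \<open>The thresholds are \<open>D' = k powr a\<close> and \<open>D = k powr b\<close>;
    the exponents make both parts of the loss of order \<open>k powr (-8)\<close>. After
    \<open>k\<close> generations the total loss is of order \<open>k powr (-7)\<close>, negligible
    against \<open>k powr (-5)\<close>. \<open>B\<close> is the exponent of \<open>(D * D')\<close>
    squared.\<close>
  define a where "a = 8 / \<kappa>"
  define b where "b = (8 + a) / \<delta>"
  have "a > 0" using \<kappa>(1) by (simp add: a_def)
  moreover from this have "b > 0" unfolding b_def using \<delta>(1) by (intro divide_pos_pos) auto
  ultimately have ab: "a > 0" "b > 0" by auto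
  define E where "E = (Lr \<nu> \<theta>0 + enn2real (atoms_moment \<nu> (1 + \<delta>))) / Lt"
  have E: "E \<ge> 0" using Lt by (simp add: E_def)
  define B where "B = 2 * (a + b)"
  have main: "reach k (- law.speed (-t) * k + (K / t) * ln k) \<ge> real k powr (- (B + 13))"
    if k: "real k \<ge> 8" "real k \<ge> 2 * (E + 1)" "real k \<ge> 1 / Lt\<^sup>2"
      and surv: "survival (law.tilted t) (K * ln k) k 0 \<ge> real k powr (-5)" for k
  proof -
    let ?y = "real k"
    have y: "?y > 0" using k by linarith
    define D where "D = ?y powr b"
    define D' where "D' = ?y powr a"
    have D: "D > 0" "D' > 0" using y by (auto simp: D_def D'_def)
    have "(\<lambda>J. (\<Sum>j<J. law.moment (-t) j) / Lt) \<longlonglongrightarrow> Lt / Lt"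
      using law.moment_sums[OF fin] Lt unfolding sums_def Lt_def by (intro tendsto_intros) auto
    then have "\<forall>\<^sub>F J in sequentially. (\<Sum>j<J. law.moment (-t) j) / Lt > 1 - ?y powr (-8)"
      by (rule order_tendstoD) (use Lt y in simp)
    \<comment> \<open>The number of labels used may depend on \<open>k\<close>, because the bound to
      be proved for \<open>reach\<close> does not involve it.\<close>
    then obtain J where J: "(\<Sum>j<J. law.moment (-t) j) / Lt > 1 - ?y powr (-8)"
      using eventually_happens'[OF sequentially_bot] by blast
    let ?v = "kept t J D D'"
    let ?d = "(E + 1) * ?y powr (-8)"
    have "D' powr (-\<kappa>) = ?y powr (-8)" using \<kappa> by (simp add: D'_def powr_powr a_def)
    moreover have "D' * D powr (-\<delta>) = ?y powr (-8)"
    proof -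
      have "b * \<delta> = 8 + a" using \<delta> by (simp add: b_def)
      then show ?thesis by (simp add: D_def D'_def powr_powr powr_add[symmetric])
    qed
    ultimately have "(\<integral>p. (\<Sum>j<J. ?v j p) \<partial>\<nu>) \<ge> (\<Sum>j<J. law.moment (-t) j) / Lt -
        (?y powr (-8) * Lr \<nu> \<theta>0 + ?y powr (-8) * enn2real (atoms_moment \<nu> (1 + \<delta>))) / Lt"
      using kept_deficit[OF t(1) \<kappa>(1) _ \<delta> D, of J] \<theta>0(2) unfolding \<kappa>(2) Lt_def[symmetric] by simp
    also have "(?y powr (-8) * Lr \<nu> \<theta>0 + ?y powr (-8) * enn2real (atoms_moment \<nu> (1 + \<delta>))) / Lt = ?y powr (-8) * E"
      by (simp add: E_def algebra_simps)
    finally have deficit: "(\<integral>p. (\<Sum>j<J. ?v j p) \<partial>\<nu>) \<ge> 1 - ?d" using J by (simp add: algebra_simps)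
    define V where "V = ?y powr B / Lt\<^sup>2"
    have V: "(\<Sum>j<J. ?v j p)\<^sup>2 \<le> V" if "p \<in> space \<nu>" for p
    proof -
      have "(\<Sum>j<J. ?v j p)\<^sup>2 \<le> (D * D' / Lt)\<^sup>2"
        using sum_kept_le[of t D D' J p] kept_bounds(1)[of t J D D' _ p] Lt D unfolding Lt_def
        by (intro power_mono sum_nonneg) auto
      also have "\<dots> = V"
      proof -
        have "(D * D')\<^sup>2 = ?y powr B"
          by (simp add: D_def D'_def B_def powr_add[symmetric] power2_eq_square algebra_simps)
        then show ?thesis by (simp add: V_def power_divide)
      qed
      finally show ?thesis .
    qed
    let ?z = "?y powr (-5)"
    define P where "P = ?y powr (- (B + 2))"
    \<comment> \<open>\<open>P\<close> outweighs the factor \<open>k * V\<close>, so the quadratic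
      error takes at most half of the linear term. What remains is \<open>\<eta> * (?z / 4)\<close>,
      of order \<open>k powr (- (B + 12))\<close>; the last exponent absorbs the factor 8.\<close>
    define \<eta> where "\<eta> = ?z / 2 * P"
    have z1: "?z \<le> 1" using powr_mono[of "-5" 0 ?y] k by simp
    have P1: "P \<le> 1" using powr_mono[of "- (B + 2)" 0 ?y] k ab by (simp add: P_def B_def)
    have zP: "?z > 0" "P > 0" using y by (auto simp: P_def)
    have \<eta>: "0 \<le> \<eta>" "\<eta> \<le> 1"
    proof -
      have "?z / 2 * P \<le> 1 * 1" using z1 P1 zP by (intro mult_mono) auto
      then show "0 \<le> \<eta>" "\<eta> \<le> 1" using zP by (auto simp: \<eta>_def)
    qed
    let ?kill = "killed_survival ?v \<nu> t (law.speed (-t)) J (K * ln k) k 0"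
    have "Lr \<nu> (-t) > 0" using Lt(1) by (simp only: Lt_def)
    note v01 = kept_bounds[OF this, of J D D']
    have "?kill \<ge> survival (law.tilted t) (K * ln k) k 0 - k * ?d"
      by (rule killed_ge_survival[OF ng t h _ v01 V _ deficit]) (use E in auto)
    moreover have "k * ?d \<le> ?z / 2"
    proof -
      have "k * ?d = (E + 1) * (?y powr 1 * ?y powr (-8))" using y by simp
      also have "?y powr 1 * ?y powr (-8) = ?y powr (-5) * ?y powr (-1) * ?y powr (-1)"
        unfolding powr_add[symmetric] by simp
      also have "\<dots> = ?z / ?y / ?y" using y by (simp add: powr_minus_divide)
      finally have "k * ?d = ?z * ((E + 1) / ?y / ?y)" by simp
      also have "\<dots> \<le> ?z * (1 / 2)"
      proof (intro mult_left_mono)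
        have "(E + 1) / ?y \<le> 1 / 2" using k y by (simp add: field_simps)
        then have "(E + 1) / ?y / ?y \<le> 1 / 2 / ?y" using y by (intro divide_right_mono) auto
        also have "\<dots> \<le> 1 / 2" using k by (simp add: field_simps)
        finally show "(E + 1) / ?y / ?y \<le> 1 / 2" .
      qed simp
      finally show ?thesis by simp
    qed
    ultimately have kill: "?kill \<ge> ?z / 2" using surv by linarith
    have R: "reach k ((K * ln k - 0) / t - law.speed (-t) * k) \<ge> \<eta> * exp (- 0) * ?kill - \<eta>\<^sup>2 * k * V * exp (- 0) / 2"
      using reach_ge_killed[OF t(1) Lt(2,1,3) kept_measurable v01[folded Lt_def] V \<eta>, where c="K * ln k" and l=k] by blast
    have "\<eta> * k * V / 2 \<le> ?z / 4"
    proof -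
      have "P * ?y * ?y powr B = 1 / ?y"
      proof -
        have "P * ?y * ?y powr B = P * ?y powr B * ?y" by simp
        also have "P * ?y powr B = ?y powr (-2)" by (simp add: P_def powr_add[symmetric])
        also have "?y powr (-2) * ?y = ?y powr (-2) * ?y powr 1" using y by simp
        also have "\<dots> = ?y powr (-1)" by (simp only: powr_add[symmetric]) simp
        finally show ?thesis using y by (simp add: powr_minus_divide)
      qed
      moreover have "\<eta> * k * V / 2 = ?z / 4 * ((P * ?y * ?y powr B) / Lt\<^sup>2)"
        by (simp add: \<eta>_def V_def)
      ultimately have "\<eta> * k * V / 2 = ?z / 4 * (1 / Lt\<^sup>2 / ?y)" by simp
      also have "\<dots> \<le> ?z / 4 * 1"
      proof (intro mult_left_mono)
        show "1 / Lt\<^sup>2 / ?y \<le> 1" unfolding pos_divide_le_eq[OF y] mult_1_left by (rule k(3))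
      qed (use zP in simp)
      finally show ?thesis by simp
    qed
    then have "\<eta> * (\<eta> * k * V / 2) \<le> \<eta> * (?z / 4)" using \<eta> by (intro mult_left_mono) auto
    moreover have "\<eta> * (?z / 2) \<le> \<eta> * ?kill" using kill \<eta> by (intro mult_left_mono)
    moreover have "\<eta>\<^sup>2 * k * V * exp (- 0) / 2 = \<eta> * (\<eta> * k * V / 2)" by (simp add: power2_eq_square)
    moreover have "\<eta> * exp (- 0) * ?kill = \<eta> * ?kill" by simp
    moreover have "\<eta> * (?z / 2) = \<eta> * (?z / 4) + \<eta> * (?z / 4)" by simp
    ultimately have "reach k ((K * ln k - 0) / t - law.speed (-t) * k) \<ge> \<eta> * (?z / 4)"
      using R by linarith
    moreover have "\<eta> * (?z / 4) = ?y powr (- (B + 12)) / 8"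
    proof -
      have "?z * ?z * P = ?y powr (- (B + 12))" by (simp add: P_def powr_add[symmetric] algebra_simps)
      moreover have "\<eta> * (?z / 4) = ?z * ?z * P / 8" by (simp add: \<eta>_def)
      ultimately show ?thesis by simp
    qed
    moreover have "?y powr (- (B + 13)) \<le> ?y powr (- (B + 12)) / 8"
    proof -
      have "?y powr (- (B + 13)) = ?y powr (- (B + 12)) * ?y powr (-1)"
        unfolding powr_add[symmetric] by (simp add: algebra_simps)
      moreover have "?y powr (-1) \<le> 1 / 8" using k y by (simp add: powr_minus_divide field_simps)
      then have "?y powr (- (B + 12)) * ?y powr (-1) \<le> ?y powr (- (B + 12)) * (1 / 8)"
        by (intro mult_left_mono) auto
      ultimately show ?thesis by linarith
    qed
    ultimately have "reach k ((K * ln k - 0) / t - law.speed (-t) * k) \<ge> ?y powr (- (B + 13))" by linarith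
    moreover have "(K * ln k - 0) / t - law.speed (-t) * k = - law.speed (-t) * k + (K / t) * ln k" by simp
    ultimately show ?thesis by simp
  qed
  have ev: "\<forall>\<^sub>F k in sequentially. real k \<ge> x" for x
    by (rule eventually_sequentiallyI[of "nat \<lceil>x\<rceil>"]) linarith
  have "\<forall>\<^sub>F k in sequentially. reach k (- law.speed (-t) * k + (K / t) * ln k) \<ge> real k powr (- (B + 13))"
    using ev[of 8] ev[of "2 * (E + 1)"] ev[of "1 / Lt\<^sup>2"] K(2)
    by eventually_elim (rule main)
  moreover have "K / t \<ge> 0" "B + 13 \<ge> 0" using K t ab by (auto simp: B_def)
  ultimately show ?thesis using that by blast
qed

end

section \<open>The saturation level\<close>

lemma ceil_log2_bounds:
  fixes n :: nat
  assumes "n \<ge> 1"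
  defines "q \<equiv> nat \<lceil>log 2 n\<rceil>"
  shows "n \<le> 2 ^ q" "real q \<le> log 2 n + 1"
proof -
  have l: "log 2 n \<ge> 0" using assms(1) by simp
  have "log 2 n \<le> q" using l by (simp add: q_def)
  then have "2 powr log 2 n \<le> 2 powr q" by simp
  then have "real n \<le> 2 ^ q" using assms(1) by (simp add: powr_realpow)
  then show "n \<le> 2 ^ q" by (metis of_nat_le_iff of_nat_numeral of_nat_power)
  show "real q \<le> log 2 n + 1" using l unfolding q_def by linarith
qed

lemma floor_log2_bounds:
  fixes n :: nat
  assumes "n \<ge> 1"
  defines "q \<equiv> nat \<lfloor>log 2 n\<rfloor>"
  shows "2 ^ q \<le> n" "real q \<ge> log 2 n - 1" "real q \<le> log 2 n"
proof -
  have l: "log 2 n \<ge> 0" using assms(1) by simp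
  show q: "real q \<le> log 2 n" using l by (simp add: q_def)
  then have "2 powr q \<le> 2 powr log 2 n" by simp
  then have "2 ^ q \<le> real n" using assms(1) by (simp add: powr_realpow)
  then show "2 ^ q \<le> n" by (metis of_nat_le_iff of_nat_numeral of_nat_power)
  show "real q \<ge> log 2 n - 1" using l unfolding q_def by linarith
qed

lemma filterlim_ceil_log2: "filterlim (\<lambda>n::nat. nat \<lceil>log 2 n\<rceil>) at_top at_top"
  by real_asymp

lemma filterlim_floor_log2: "filterlim (\<lambda>n::nat. nat \<lfloor>log 2 n\<rfloor>) at_top at_top"
  by real_asymp

context nested_boxes
begin

text \<open>Borel-Cantelli along powers of two. Rounding \<open>n\<close> up is the right direction,
  since an underfull generation remains underfull with fewer balls.\<close>

lemma AE_saturation_le: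
  assumes sum: "summable (\<lambda>q. prob {\<omega>\<in>space M. \<not> underfull j (2 ^ q) (\<kappa> q) \<omega>})"
  shows "AE \<omega> in M. \<forall>\<^sub>F n in sequentially. saturation_level \<rho> X n j \<omega> \<le> \<kappa> (nat \<lceil>log 2 (real n)\<rceil>)"
proof -
  have "AE \<omega> in M. \<forall>\<^sub>F q in sequentially. \<omega> \<in> space M - {\<omega>\<in>space M. \<not> underfull j (2 ^ q) (\<kappa> q) \<omega>}"
    by (rule borel_cantelli_AE1) (use sum in \<open>auto simp: emeasure_eq_measure\<close>)
  then show ?thesis
    using AE_space
  proof eventually_elim
    case (elim \<omega>)
    have "\<forall>\<^sub>F n in sequentially. \<omega> \<in> space M -
        {\<omega>\<in>space M. \<not> underfull j (2 ^ nat \<lceil>log 2 (real n)\<rceil>) (\<kappa> (nat \<lceil>log 2 (real n)\<rceil>)) \<omega>}"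
      by (rule eventually_compose_filterlim[OF elim(1) filterlim_ceil_log2])
    then show ?case
      using eventually_ge_at_top[of 1]
    proof eventually_elim
      case (elim n)
      then show ?case
        using ceil_log2_bounds(1)[of n] underfull_mono[OF \<open>\<omega> \<in> space M\<close> _ order_refl]
        by (intro saturation_level_le) auto
    qed
  qed
qed

text \<open>Here \<open>n\<close> is rounded down. The second summability supplies some underfull
  generation, without which the least one would carry no information.\<close>

lemma AE_saturation_gt:
  assumes sum: "summable (\<lambda>q. prob {\<omega>\<in>space M. underfull j (2 ^ q) (\<kappa> q) \<omega>})"
    and ex: "summable (\<lambda>q. prob {\<omega>\<in>space M. \<not> underfull j (2 ^ q) (\<kappa>' q) \<omega>})"
  shows "AE \<omega> in M. \<forall>\<^sub>F n in sequentially. saturation_level \<rho> X n j \<omega> > \<kappa> (nat \<lfloor>log 2 (real n)\<rfloor>)"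
proof -
  have "AE \<omega> in M. \<forall>\<^sub>F q in sequentially. \<omega> \<in> space M - {\<omega>\<in>space M. underfull j (2 ^ q) (\<kappa> q) \<omega>}"
    by (rule borel_cantelli_AE1) (use sum in \<open>auto simp: emeasure_eq_measure\<close>)
  moreover have "AE \<omega> in M. \<forall>\<^sub>F q in sequentially. \<omega> \<in> space M - {\<omega>\<in>space M. \<not> underfull j (2 ^ q) (\<kappa>' q) \<omega>}"
    by (rule borel_cantelli_AE1) (use ex in \<open>auto simp: emeasure_eq_measure\<close>)
  ultimately show ?thesis
    using AE_space
  proof eventually_elim
    case (elim \<omega>)
    have "\<forall>\<^sub>F n in sequentially. \<omega> \<in> space M -
        {\<omega>\<in>space M. underfull j (2 ^ nat \<lfloor>log 2 (real n)\<rfloor>) (\<kappa> (nat \<lfloor>log 2 (real n)\<rfloor>)) \<omega>}"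
      by (rule eventually_compose_filterlim[OF elim(1) filterlim_floor_log2])
    moreover have "\<forall>\<^sub>F n in sequentially. \<omega> \<in> space M -
        {\<omega>\<in>space M. \<not> underfull j (2 ^ nat \<lceil>log 2 (real n)\<rceil>) (\<kappa>' (nat \<lceil>log 2 (real n)\<rceil>)) \<omega>}"
      by (rule eventually_compose_filterlim[OF elim(2) filterlim_ceil_log2])
    ultimately show ?case
      using eventually_ge_at_top[of 1]
    proof eventually_elim
      case (elim n)
      note \<omega> = \<open>\<omega> \<in> space M\<close>
      have "underfull j n (\<kappa>' (nat \<lceil>log 2 (real n)\<rceil>)) \<omega>"
        using elim ceil_log2_bounds(1)[of n] underfull_mono[OF \<omega> _ order_refl] by auto
      moreover have "\<not> underfull j n (\<kappa> (nat \<lfloor>log 2 (real n)\<rfloor>)) \<omega>"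
        using elim floor_log2_bounds(1)[of n] underfull_mono[OF \<omega> _ order_refl] by auto
      ultimately show ?case by (rule saturation_level_gt[OF \<omega>])
    qed
  qed
qed

lemma exp_powr_two: "real ((2::nat) ^ q) = exp (q * ln 2)"
  by (simp add: exp_of_nat_mult)

lemma summable_exp_linear: "c < 0 \<Longrightarrow> summable (\<lambda>q::nat. exp (c * q))" for c :: real
proof -
  assume "c < 0"
  then have "summable (\<lambda>q. exp c ^ q)" by (intro summable_geometric) simp
  then show ?thesis by (simp add: exp_of_nat_mult[symmetric] mult.commute)
qed

text \<open>After about \<open>x * q\<close> generations boxes of size
  \<open>exp (- \<alpha> * x * q + c)\<close> exist with probability at least \<sigma>, and they are
  far smaller than \<open>2 ^ -q\<close>; the further \<open>\<epsilon> * q\<close> generations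
  raise this probability to 1 minus an exponentially small amount.\<close>

lemma linear_rate_summable:
  fixes t \<alpha> x \<epsilon> :: real
  assumes ng: "\<not> geometric \<nu>" and j: "j \<ge> 1" and t: "t > 0" "theta_low \<nu> < ereal (-t)"
    and phi: "phi \<nu> (-t) > 0" and \<alpha>: "\<alpha> < law.speed (-t)" and x: "x > 0" "\<alpha> * x > ln 2" and \<epsilon>: "\<epsilon> > 0"
  shows "summable (\<lambda>q. prob {\<omega>\<in>space M. \<not> underfull j (2 ^ q) (nat \<lceil>x * q\<rceil> + nat \<lceil>\<epsilon> * q\<rceil>) \<omega>})"
proof -
  obtain \<sigma> c where \<sigma>: "\<sigma> > 0" "\<And>k. reach k (- \<alpha> * k + c) \<ge> \<sigma>"
  proof (rule reach_linear[OF ng t phi \<alpha>])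
    fix \<sigma> c assume "\<sigma> > 0" "\<And>k. reach k (- \<alpha> * k + c) \<ge> \<sigma>"
    then show thesis by (rule that)
  qed
  obtain r where r: "0 < r" "r < 1"
    "\<And>k m s. reach k s > 0 \<Longrightarrow> 1 - reach (k + m) s \<le> r ^ m / reach k s"
  proof (rule reach_boost[OF ng])
    fix r :: real
    assume "0 < r" "r < 1" "\<And>k m s. reach k s > 0 \<Longrightarrow> 1 - reach (k + m) s \<le> r ^ m / reach k s"
    then show thesis by (rule that)
  qed
  have \<alpha>0: "\<alpha> > 0" 
  proof -
    have "(0::real) < ln 2" by simp
    then have "0 < \<alpha> * x" using x(2) by linarith
    then show ?thesis using x(1) by (rule zero_less_mult_pos2)
  qed
  have bound: "prob {\<omega>\<in>space M. \<not> underfull j (2 ^ q) (nat \<lceil>x * q\<rceil> + nat \<lceil>\<epsilon> * q\<rceil>) \<omega>} \<le>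
      (1 / \<sigma>) * exp (\<epsilon> * ln r * q) + exp c * exp ((ln 2 - \<alpha> * x) * q)" for q
  proof -
    let ?k = "nat \<lceil>x * q\<rceil>" and ?m = "nat \<lceil>\<epsilon> * q\<rceil>"
    let ?s = "- \<alpha> * ?k + c"
    have km: "real ?k \<ge> x * q" "real ?m \<ge> \<epsilon> * q" by linarith+
    have R: "reach ?k ?s \<ge> \<sigma>" by (rule \<sigma>(2))
    have "1 - reach (?k + ?m) ?s \<le> r ^ ?m / reach ?k ?s" using R \<sigma>(1) by (intro r(3)) linarith
    also have "\<dots> \<le> r ^ ?m / \<sigma>" using R \<sigma>(1) r by (intro divide_left_mono mult_pos_pos) auto
    also have "r ^ ?m = exp (?m * ln r)" using r by (simp add: exp_of_nat_mult)
    also have "exp (?m * ln r) \<le> exp (\<epsilon> * ln r * q)"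
    proof -
      have "real ?m * ln r \<le> (\<epsilon> * q) * ln r" using km r by (intro mult_right_mono_neg) auto
      then show ?thesis by (simp add: mult_ac)
    qed
    finally have 1: "1 - reach (?k + ?m) ?s \<le> (1 / \<sigma>) * exp (\<epsilon> * ln r * q)"
      using \<sigma>(1) by (simp add: divide_right_mono)
    have "real (2 ^ q) * exp ?s = exp (q * ln 2 - \<alpha> * ?k + c)"
      unfolding exp_powr_two by (simp flip: exp_add)
    also have "\<dots> \<le> exp (c + (ln 2 - \<alpha> * x) * q)"
    proof -
      have "\<alpha> * (x * q) \<le> \<alpha> * ?k" using km \<alpha>0 by (intro mult_left_mono) auto
      then show ?thesis by (simp add: algebra_simps)
    qed
    finally have 2: "real (2 ^ q) * exp ?s \<le> exp c * exp ((ln 2 - \<alpha> * x) * q)" by (simp add: exp_add)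
    show ?thesis using not_underfull_prob_le[OF j, of "2 ^ q" "?k + ?m" ?s] 1 2 by linarith
  qed
  have "summable (\<lambda>q. (1 / \<sigma>) * exp (\<epsilon> * ln r * q) + exp c * exp ((ln 2 - \<alpha> * x) * q))"
    using r x \<epsilon> by (intro summable_add summable_mult summable_exp_linear) (auto simp: mult_pos_neg)
  then show ?thesis
    by (rule summable_comparison_test') (use bound in auto)
qed

lemma saturation_linear_upper:
  assumes ng: "\<not> geometric \<nu>" and j: "j \<ge> 1" and H: "law.critical H" and a: "a > 1 / H"
  shows "AE \<omega> in M. \<forall>\<^sub>F n in sequentially. real (saturation_level \<rho> X n j \<omega>) \<le> a * ln n"
    and "\<exists>\<kappa>. summable (\<lambda>q. prob {\<omega>\<in>space M. \<not> underfull j (2 ^ q) (\<kappa> q) \<omega>})"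
proof -
  have H0: "H > 0" using H by (simp add: law.critical_def)
  obtain a1 where a1: "1 / H < a1" "a1 < a" using dense[OF a] by blast
  have "1 / H > 0" using H0 by simp
  then have a1pos: "a1 > 0" using a1 by linarith
  have "1 / a1 < H" using a1 H0 a1pos by (simp add: field_simps)
  then obtain \<alpha> where \<alpha>: "1 / a1 < \<alpha>" "\<alpha> < H" using dense by blast
  obtain t where t: "t > 0" "theta_low \<nu> < ereal (-t)" "phi \<nu> (-t) > 0" "\<alpha> < law.speed (-t)"
    using H \<alpha>(2) unfolding law.critical_def by blast
  \<comment> \<open>Half of the gap between \<open>a1\<close> and \<open>a\<close> is spent on
    boosting, the other half absorbs the rounding.\<close>
  define \<epsilon> where "\<epsilon> = (a - a1) * ln 2 / 2"
  define \<kappa> where "\<kappa> q = nat \<lceil>a1 * ln 2 * real q\<rceil> + nat \<lceil>\<epsilon> * real q\<rceil>" for q :: nat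
  have \<epsilon>: "\<epsilon> > 0" using a1 by (simp add: \<epsilon>_def)
  have "\<alpha> * a1 > 1" using \<alpha>(1) a1pos by (simp add: field_simps)
  then have "\<alpha> * (a1 * ln 2) > ln 2" using mult_strict_right_mono[of 1 "\<alpha> * a1" "ln 2"] by (simp add: mult.assoc)
  then have S: "summable (\<lambda>q. prob {\<omega>\<in>space M. \<not> underfull j (2 ^ q) (\<kappa> q) \<omega>})"
    unfolding \<kappa>_def using a1pos by (intro linear_rate_summable[OF ng j t _ _ \<epsilon>]) simp_all
  then show "\<exists>\<kappa>. summable (\<lambda>q. prob {\<omega>\<in>space M. \<not> underfull j (2 ^ q) (\<kappa> q) \<omega>})" by blast
  have c: "(a1 * ln 2 + \<epsilon>) / ln 2 = (a + a1) / 2" by (simp add: \<epsilon>_def field_simps)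
  have lim: "\<forall>\<^sub>F n :: nat in sequentially. ln n \<ge> (a1 * ln 2 + \<epsilon> + 2) * 2 / (a - a1)"
  proof -
    have "filterlim (\<lambda>n::nat. ln (real n)) at_top at_top" by real_asymp
    then show ?thesis by (simp add: filterlim_at_top)
  qed
  from AE_saturation_le[OF S] show "AE \<omega> in M. \<forall>\<^sub>F n in sequentially. real (saturation_level \<rho> X n j \<omega>) \<le> a * ln n"
  proof eventually_elim
    case (elim \<omega>)
    then show ?case
      using lim eventually_ge_at_top[of 1]
    proof eventually_elim
      case (elim n)
      let ?q = "nat \<lceil>log 2 (real n)\<rceil>"
      have q: "real ?q \<le> log 2 n + 1" using ceil_log2_bounds(2)[of n] elim by simp
      have "real (saturation_level \<rho> X n j \<omega>) \<le> real (\<kappa> ?q)" using elim by simp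
      also have "\<dots> \<le> a1 * ln 2 * ?q + \<epsilon> * ?q + 2"
      proof -
        have "a1 * ln 2 * ?q \<ge> 0" "\<epsilon> * ?q \<ge> 0" using a1pos \<epsilon> by auto
        then show ?thesis unfolding \<kappa>_def of_nat_add by linarith
      qed
      also have "\<dots> = (a1 * ln 2 + \<epsilon>) * ?q + 2" by (simp add: algebra_simps)
      also have "\<dots> \<le> (a1 * ln 2 + \<epsilon>) * (log 2 n + 1) + 2"
        using q a1pos \<epsilon> by (intro add_right_mono mult_left_mono) (auto intro!: add_nonneg_nonneg)
      also have "\<dots> = (a1 * ln 2 + \<epsilon>) / ln 2 * ln n + (a1 * ln 2 + \<epsilon> + 2)"
        by (simp add: log_def algebra_simps)
      also have "\<dots> \<le> (a + a1) / 2 * ln n + (a - a1) / 2 * ln n"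
        unfolding c using elim(2) a1 by (simp add: field_simps)
      also have "\<dots> = a * ln n" by (simp add: field_simps)
      finally show ?case .
    qed
  qed
qed

lemma saturation_linear_lower:
  assumes ng: "\<not> geometric \<nu>" and j: "j \<ge> 1" and H: "law.critical H" and a: "a < 1 / H"
  shows "AE \<omega> in M. \<forall>\<^sub>F n in sequentially. real (saturation_level \<rho> X n j \<omega>) \<ge> a * ln n"
proof (cases "a \<le> 0")
  case True
  have "\<forall>\<^sub>F n in sequentially. real (saturation_level \<rho> X n j \<omega>) \<ge> a * ln n" for \<omega>
    using eventually_ge_at_top[of 1]
  proof eventually_elim
    case (elim n)
    have "a * ln n \<le> 0" using True elim by (intro mult_nonpos_nonneg) auto
    then show ?case by linarith
  qed
  then show ?thesis by simp
next
  case False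
  obtain a1 where a1: "a < a1" "a1 < 1 / H" using dense[OF a] by blast
  obtain t where t: "t > 0" "L \<nu> (-t) < \<infinity>" "a1 * law.loglap (-t) < t"
    using H a1(2) unfolding law.critical_def by blast
  obtain c where c: "c > 0"
    "\<And>n k. n \<ge> j \<Longrightarrow> prob {\<omega>\<in>space M. underfull j n k \<omega>} \<le> c * real n powr (-t) * Lr \<nu> (-t) ^ k"
  proof (rule underfull_prob_le[OF t(1,2) j])
    fix c :: real
    assume "c > 0" "\<And>n k. n \<ge> j \<Longrightarrow> prob {\<omega>\<in>space M. underfull j n k \<omega>} \<le> c * real n powr (-t) * Lr \<nu> (-t) ^ k"
    then show thesis by (rule that)
  qed
  let ?g = "law.loglap (-t)"
  have Lg: "Lr \<nu> (-t) = exp ?g" using law.Lr_pos[OF t(2)] by (simp add: law.loglap_def)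
  define \<kappa> where "\<kappa> q = nat \<lfloor>a1 * ln 2 * real q\<rfloor>" for q :: nat
  have bound: "prob {\<omega>\<in>space M. underfull j (2 ^ q) (\<kappa> q) \<omega>} \<le> c * exp \<bar>?g\<bar> * exp (ln 2 * (a1 * ?g - t) * q)"
    if q: "q \<ge> j" for q
  proof -
    have "j \<le> 2 ^ q" using q less_exp[of q] by linarith
    then have "prob {\<omega>\<in>space M. underfull j (2 ^ q) (\<kappa> q) \<omega>} \<le> c * real (2 ^ q) powr (-t) * Lr \<nu> (-t) ^ \<kappa> q"
      by (rule c(2))
    also have "real (2 ^ q) powr (-t) = exp (- t * (q * ln 2))"
      unfolding exp_powr_two by (simp add: powr_def)
    also have "Lr \<nu> (-t) ^ \<kappa> q = exp (\<kappa> q * ?g)" unfolding Lg by (simp add: exp_of_nat_mult)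
    also have "exp (\<kappa> q * ?g) \<le> exp (a1 * ln 2 * q * ?g + \<bar>?g\<bar>)"
    proof -
      have "a1 * ln 2 * q \<ge> 0" using False a1 by simp
      then have "\<bar>real (\<kappa> q) - a1 * ln 2 * q\<bar> \<le> 1" unfolding \<kappa>_def by linarith
      then have "\<bar>(real (\<kappa> q) - a1 * ln 2 * q) * ?g\<bar> \<le> 1 * \<bar>?g\<bar>" unfolding abs_mult by (intro mult_right_mono) auto
      then show ?thesis by (simp add: algebra_simps)
    qed
    finally have "prob {\<omega>\<in>space M. underfull j (2 ^ q) (\<kappa> q) \<omega>} \<le>
        c * exp (- t * (q * ln 2)) * exp (a1 * ln 2 * q * ?g + \<bar>?g\<bar>)"
      using c(1) by simp
    also have "\<dots> = c * exp \<bar>?g\<bar> * exp (ln 2 * (a1 * ?g - t) * q)"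
      by (simp add: mult.assoc exp_add[symmetric] algebra_simps)
    finally show ?thesis .
  qed
  have "summable (\<lambda>q. c * exp \<bar>?g\<bar> * exp (ln 2 * (a1 * ?g - t) * q))"
    using t by (intro summable_mult summable_exp_linear) (simp add: mult_pos_neg)
  then have S: "summable (\<lambda>q. prob {\<omega>\<in>space M. underfull j (2 ^ q) (\<kappa> q) \<omega>})"
    by (rule summable_comparison_test'[where N=j]) (use bound in auto)
  \<comment> \<open>Any admissible rate will do: this only guarantees that some generation is
    underfull.\<close>
  obtain \<kappa>' where S': "summable (\<lambda>q. prob {\<omega>\<in>space M. \<not> underfull j (2 ^ q) (\<kappa>' q) \<omega>})"
    using saturation_linear_upper(2)[OF ng j H, of "1 / H + 1"] by auto
  have lim: "\<forall>\<^sub>F n :: nat in sequentially. ln n \<ge> (a1 * ln 2 + 1) / (a1 - a)"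
  proof -
    have "filterlim (\<lambda>n::nat. ln (real n)) at_top at_top" by real_asymp
    then show ?thesis by (simp add: filterlim_at_top)
  qed
  from AE_saturation_gt[OF S S'] show ?thesis
  proof eventually_elim
    case (elim \<omega>)
    then show ?case
      using lim eventually_ge_at_top[of 1]
    proof eventually_elim
      case (elim n)
      let ?q = "nat \<lfloor>log 2 (real n)\<rfloor>"
      have q: "real ?q \<ge> log 2 n - 1" using floor_log2_bounds(2)[of n] elim by simp
      have "a * ln n \<le> a1 * ln n - (a1 * ln 2 + 1)"
        using elim(2) a1 by (simp add: field_simps)
      also have "\<dots> = a1 * ln 2 * (log 2 n - 1) - 1" by (simp add: log_def algebra_simps)
      also have "\<dots> \<le> a1 * ln 2 * ?q - 1"
        using q False a1 by (intro diff_right_mono mult_left_mono) auto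
      also have "\<dots> \<le> real (\<kappa> ?q)" unfolding \<kappa>_def by linarith
      also have "\<dots> \<le> real (saturation_level \<rho> X n j \<omega>)" using elim(1) by simp
      finally show ?case .
    qed
  qed
qed

lemma saturation_asymp_equiv:
  assumes ng: "\<not> geometric \<nu>" and j: "j \<ge> 1" and H: "law.critical H"
  shows "AE \<omega> in M. (\<lambda>n. real (saturation_level \<rho> X n j \<omega>)) \<sim>[at_top] (\<lambda>n. 1 / H * ln (real n))"
proof -
  have H0: "H > 0" using H by (simp add: law.critical_def)
  have "AE \<omega> in M. \<forall>i. (\<forall>\<^sub>F n in sequentially. real (saturation_level \<rho> X n j \<omega>) \<le> (1 / H + 1 / Suc i) * ln n) \<and>
      (\<forall>\<^sub>F n in sequentially. real (saturation_level \<rho> X n j \<omega>) \<ge> (1 / H - 1 / Suc i) * ln n)"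
    unfolding AE_all_countable
    using saturation_linear_upper(1)[OF ng j H] saturation_linear_lower[OF ng j H]
    by (intro allI AE_conjI) simp_all
  then show ?thesis
  proof eventually_elim
    case (elim \<omega>)
    let ?G = "\<lambda>n. real (saturation_level \<rho> X n j \<omega>)"
    have "(\<lambda>n. ?G n / ln n) \<longlonglongrightarrow> 1 / H"
    proof (rule order_tendstoI)
      fix a assume "a < 1 / H"
      then obtain i where i: "1 / Suc i < 1 / H - a"
        using reals_Archimedean[of "1 / H - a"] by (auto simp: inverse_eq_divide)
      have "\<forall>\<^sub>F n in sequentially. ?G n \<ge> (1 / H - 1 / Suc i) * ln n" using elim by blast
      then show "\<forall>\<^sub>F n in sequentially. a < ?G n / ln n"
        using eventually_ge_at_top[of 2]
      proof eventually_elim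
        case (elim n)
        have "a * ln n < (1 / H - 1 / Suc i) * ln n" using i elim by (intro mult_strict_right_mono) auto
        then have "a * ln n < ?G n" using elim by linarith
        moreover have "ln n > 0" using elim by simp
        ultimately show ?case by (subst pos_less_divide_eq)
      qed
    next
      fix a assume "1 / H < a"
      then obtain i where i: "1 / Suc i < a - 1 / H"
        using reals_Archimedean[of "a - 1 / H"] by (auto simp: inverse_eq_divide)
      have "\<forall>\<^sub>F n in sequentially. ?G n \<le> (1 / H + 1 / Suc i) * ln n" using elim by blast
      then show "\<forall>\<^sub>F n in sequentially. ?G n / ln n < a"
        using eventually_ge_at_top[of 2]
      proof eventually_elim
        case (elim n)
        have "(1 / H + 1 / Suc i) * ln n < a * ln n" using i elim by (intro mult_strict_right_mono) auto
        then have "?G n < a * ln n" using elim by linarith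
        moreover have "ln n > 0" using elim by simp
        ultimately show ?case by (subst pos_divide_less_eq)
      qed
    qed
    then have "(\<lambda>n. ?G n / ln n * H) \<longlonglongrightarrow> 1 / H * H" by (rule tendsto_mult_right)
    moreover have "(\<lambda>n. ?G n / ln n * H) = (\<lambda>n. ?G n / (1 / H * ln (real n)))" by simp
    ultimately have "(\<lambda>n. ?G n / (1 / H * ln (real n))) \<longlonglongrightarrow> 1" using H0 by simp
    then show ?case by (rule asymp_equivI')
  qed
qed

lemma eventually_ln_ln_ge: "\<forall>\<^sub>F n :: nat in sequentially. ln (ln (real n)) \<ge> c"
proof -
  have "filterlim (\<lambda>n::nat. ln (ln (real n))) at_top at_top" by real_asymp
  then show ?thesis by (simp add: filterlim_at_top)
qed

lemma eventually_ln_log2_le: "\<forall>\<^sub>F n :: nat in sequentially. ln (log 2 n + 1) \<le> ln (ln n) + 1"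
proof -
  have "filterlim (\<lambda>n::nat. ln (real n)) at_top at_top" by real_asymp
  then have "\<forall>\<^sub>F n :: nat in sequentially. ln (real n) \<ge> 2" by (simp add: filterlim_at_top)
  then show ?thesis
  proof eventually_elim
    case (elim n)
    have l2: "2 / 3 \<le> ln (2::real)" by (rule ln2_ge_two_thirds)
    then have "ln (real n) * (2 / 3) \<le> ln (real n) * ln 2" using elim by (intro mult_left_mono) auto
    then have "log 2 n \<le> 3 / 2 * ln n" using l2 by (simp add: log_def divide_le_eq)
    then have "log 2 n + 1 \<le> 2 * ln n" using elim by linarith
    moreover have "log 2 n \<ge> 0" using elim by (simp add: log_def)
    ultimately have "ln (log 2 n + 1) \<le> ln (2 * ln n)" by (intro ln_mono) auto
    also have "\<dots> = ln 2 + ln (ln n)" using elim by (simp add: ln_mult)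
    also have "ln 2 \<le> (1::real)" using ln_le_minus_one[of "2::real"] by simp
    finally show ?case by simp
  qed
qed

lemma summable_powr_minus_2: "summable (\<lambda>q::nat. c * real q powr (-2))"
  by (intro summable_mult) (simp add: summable_real_powr_iff)

lemma saturation_critical_lower:
  assumes ng: "\<not> geometric \<nu>" and j: "j \<ge> 1" and t: "t > 0" "theta_low \<nu> < ereal (-t)"
    and h: "law.speed (-t) > 0" "law.loglap (-t) = t * law.speed (-t)" and H: "law.critical (law.speed (-t))"
  shows "AE \<omega> in M. \<exists>K::real. \<forall>\<^sub>F n in sequentially.
      real (saturation_level \<rho> X n j \<omega>) \<ge> 1 / law.speed (-t) * ln (real n) - K * ln (ln (real n))"
proof -
  let ?h = "law.speed (-t)"
  have fin: "L \<nu> (-t) < \<infinity>" by (rule law.L_finite[OF t(2)])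
  obtain c where c: "c > 0"
    "\<And>n k. n \<ge> j \<Longrightarrow> prob {\<omega>\<in>space M. underfull j n k \<omega>} \<le> c * real n powr (-t) * Lr \<nu> (-t) ^ k"
  proof (rule underfull_prob_le[OF t(1) fin j])
    fix c :: real
    assume "c > 0" "\<And>n k. n \<ge> j \<Longrightarrow> prob {\<omega>\<in>space M. underfull j n k \<omega>} \<le> c * real n powr (-t) * Lr \<nu> (-t) ^ k"
    then show thesis by (rule that)
  qed
  have Lg: "Lr \<nu> (-t) = exp (t * ?h)"
    unfolding h(2)[symmetric] law.loglap_def by (simp only: exp_ln[OF law.Lr_pos[OF fin]])
  \<comment> \<open>At \<open>ln 2 / ?h * q\<close> generations the first-moment bound is merely
    bounded; retreating by \<open>K * ln q\<close> generations gains the factor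
    \<open>q powr (-2)\<close>.\<close>
  define K where "K = 2 / (t * ?h)"
  have K: "K > 0" using t h by (simp add: K_def)
  define \<kappa> where "\<kappa> q = nat \<lfloor>ln 2 / ?h * real q - K * ln q\<rfloor>" for q :: nat
  have pos: "\<forall>\<^sub>F q :: nat in sequentially. ln 2 / ?h * real q - K * ln q \<ge> 0"
    using h K by real_asymp
  have bound: "\<forall>\<^sub>F q in sequentially. norm (prob {\<omega>\<in>space M. underfull j (2 ^ q) (\<kappa> q) \<omega>}) \<le> c * real q powr (-2)"
    using pos eventually_ge_at_top[of j] eventually_gt_at_top[of 0]
  proof eventually_elim
    case (elim q)
    have "j \<le> 2 ^ q" using elim(2) less_exp[of q] by linarith
    then have "prob {\<omega>\<in>space M. underfull j (2 ^ q) (\<kappa> q) \<omega>} \<le> c * real (2 ^ q) powr (-t) * Lr \<nu> (-t) ^ \<kappa> q"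
      by (rule c(2))
    also have "real (2 ^ q) powr (-t) = exp (- t * (q * ln 2))"
      unfolding exp_powr_two by (simp add: powr_def)
    also have "Lr \<nu> (-t) ^ \<kappa> q = exp (\<kappa> q * (t * ?h))" unfolding Lg by (simp add: exp_of_nat_mult)
    also have "c * exp (- t * (q * ln 2)) * exp (\<kappa> q * (t * ?h)) = c * exp (- t * (q * ln 2) + \<kappa> q * (t * ?h))"
      by (simp only: mult.assoc exp_add)
    also have "\<dots> \<le> c * exp (-2 * ln q)"
    proof -
      have "real (\<kappa> q) \<le> ln 2 / ?h * real q - K * ln q" unfolding \<kappa>_def using elim(1) by linarith
      then have "\<kappa> q * (t * ?h) \<le> (ln 2 / ?h * real q - K * ln q) * (t * ?h)"
        using t h by (intro mult_right_mono) auto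
      also have "\<dots> = t * (q * ln 2) - 2 * ln q" using t h by (simp add: K_def field_simps)
      finally show ?thesis using c(1) by simp
    qed
    also have "exp (-2 * ln q) = real q powr (-2)" using elim(3) by (simp add: powr_def)
    finally show ?case by simp
  qed
  have S: "summable (\<lambda>q. prob {\<omega>\<in>space M. underfull j (2 ^ q) (\<kappa> q) \<omega>})"
    by (rule summable_comparison_test_ev[OF bound summable_powr_minus_2])
  obtain \<kappa>' where S': "summable (\<lambda>q. prob {\<omega>\<in>space M. \<not> underfull j (2 ^ q) (\<kappa>' q) \<omega>})"
    using saturation_linear_upper(2)[OF ng j H, of "1 / ?h + 1"] by auto
  have q1: "\<forall>\<^sub>F n :: nat in sequentially. log 2 n \<ge> 2" by real_asymp
  from AE_saturation_gt[OF S S'] show ?thesis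
  proof eventually_elim
    case (elim \<omega>)
    then have "\<forall>\<^sub>F n in sequentially. real (saturation_level \<rho> X n j \<omega>) \<ge> 1 / ?h * ln n - (K + 1) * ln (ln n)"
      using eventually_ln_log2_le q1 eventually_ln_ln_ge[of "ln 2 / ?h + K + 1"] eventually_ge_at_top[of 1]
    proof eventually_elim
      case (elim n)
      let ?q = "nat \<lfloor>log 2 (real n)\<rfloor>"
      have q: "real ?q \<ge> log 2 n - 1" "real ?q \<le> log 2 n"
        using floor_log2_bounds(2,3)[of n] elim by auto
      have "ln ?q \<le> ln (log 2 n + 1)" using q elim(3) by (intro ln_mono) linarith+
      then have lq: "ln ?q \<le> ln (ln n) + 1" using elim(2) by linarith
      have "1 / ?h * ln n - (K + 1) * ln (ln n) \<le> 1 / ?h * ln n - ln 2 / ?h - K * (ln (ln n) + 1) - 1"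
        using elim(4) by (simp add: algebra_simps)
      also have "1 / ?h * ln n - ln 2 / ?h = ln 2 / ?h * (log 2 n - 1)" using h by (simp add: log_def field_simps)
      also have "ln 2 / ?h * (log 2 n - 1) - K * (ln (ln n) + 1) - 1 \<le> ln 2 / ?h * ?q - K * ln ?q - 1"
        using q lq h K by (intro diff_mono mult_left_mono) auto
      also have "\<dots> \<le> real (\<kappa> ?q)" unfolding \<kappa>_def by linarith
      also have "\<dots> \<le> real (saturation_level \<rho> X n j \<omega>)" using elim(1) by simp
      finally show ?case .
    qed
    then show ?case by blast
  qed
qed

lemma saturation_critical_upper:
  assumes ng: "\<not> geometric \<nu>" and j: "j \<ge> 1" and t: "t > 0" "theta_low \<nu> < ereal (-t)"
    and h: "law.speed (-t) > 0" "law.loglap (-t) = t * law.speed (-t)"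
    and \<delta>: "\<delta> > 0" "atoms_moment \<nu> (1 + \<delta>) < \<infinity>"
  shows "AE \<omega> in M. \<exists>K::real. \<forall>\<^sub>F n in sequentially.
      real (saturation_level \<rho> X n j \<omega>) \<le> 1 / law.speed (-t) * ln (real n) + K * ln (ln (real n))"
proof -
  let ?h = "law.speed (-t)"
  obtain K1 K2 where K12: "K1 \<ge> 0" "K2 \<ge> 0"
    "\<forall>\<^sub>F k in sequentially. reach k (- ?h * k + K1 * ln k) \<ge> real k powr (-K2)"
    by (rule reach_critical[OF ng t h(2) \<delta>])
  obtain r where r: "0 < r" "r < 1"
    "\<And>k m s. reach k s > 0 \<Longrightarrow> 1 - reach (k + m) s \<le> r ^ m / reach k s"
  proof (rule reach_boost[OF ng])
    fix r :: real
    assume "0 < r" "r < 1" "\<And>k m s. reach k s > 0 \<Longrightarrow> 1 - reach (k + m) s \<le> r ^ m / reach k s"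
    then show thesis by (rule that)
  qed
  \<comment> \<open>Going \<open>A * ln q\<close> generations deeper compensates the loss
    \<open>K1 * ln k\<close> in size and gains \<open>q powr (-2)\<close>; the
    \<open>A' * ln q\<close> boosting generations compensate the polynomial probability with the
    same gain.\<close>
  define A where "A = (K1 + 2) / ?h"
  define A' where "A' = (K2 + 2) / (- ln r)"
  have lr: "ln r < 0" using r by simp
  have hd: "ln 2 / ?h > 0" using h(1) by simp
  have A: "A > 0" "A' > 0"
    unfolding A_def A'_def using K12 h lr by (auto intro!: divide_pos_pos simp del: divide_minus_right)
  \<comment> \<open>Ensures \<open>k q \<le> D * q\<close>, which converts powers of the generation
    into powers of \<open>q\<close>.\<close>
  define D where "D = ln 2 / ?h + A + 1"
  have D: "D > 1" unfolding D_def using A h by (simp add: add_pos_pos)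
  define k where "k q = nat \<lceil>ln 2 / ?h * real q + A * ln q\<rceil>" for q :: nat
  define m where "m q = nat \<lceil>A' * ln q\<rceil>" for q :: nat
  have klow: "real (k q) \<ge> ln 2 / ?h * real q + A * ln q" for q unfolding k_def by linarith
  have kinf: "filterlim k at_top at_top"
  proof -
    have "filterlim (\<lambda>q::nat. ln 2 / ?h * real q + A * ln q) at_top at_top" using h A by real_asymp
    then have "filterlim (\<lambda>q. real (k q)) at_top at_top"
      by (rule filterlim_at_top_mono) (use klow in auto)
    then show ?thesis by (simp add: filterlim_sequentially_iff_filterlim_real)
  qed
  have bound: "\<forall>\<^sub>F q in sequentially. norm (prob {\<omega>\<in>space M. \<not> underfull j (2 ^ q) (k q + m q) \<omega>}) \<le>
      (D powr K2 + D powr K1) * real q powr (-2)"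
    using eventually_compose_filterlim[OF K12(3) kinf] eventually_gt_at_top[of 0]
  proof eventually_elim
    case (elim q)
    let ?s = "- ?h * k q + K1 * ln (k q)"
    have q: "real q \<ge> 1" using elim by simp
    have lnq: "0 \<le> ln q" "ln q \<le> q" using q ln_bound[of "real q"] by auto
    have kup: "real (k q) \<le> D * q"
    proof -
      have "ln 2 / ?h * real q + A * ln q \<ge> 0"
        by (intro add_nonneg_nonneg mult_nonneg_nonneg less_imp_le[OF hd] less_imp_le[OF A(1)] lnq(1)) simp
      then have "real (k q) \<le> ln 2 / ?h * real q + A * ln q + 1" unfolding k_def by linarith
      also have "\<dots> \<le> ln 2 / ?h * real q + A * q + q"
      proof -
        have "A * ln q \<le> A * q" using lnq A by (intro mult_left_mono) auto
        then show ?thesis using q by linarith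
      qed
      finally show ?thesis by (simp add: D_def algebra_simps)
    qed
    have kpos: "real (k q) > 0"
    proof -
      have "ln 2 / ?h * real q + A * ln q > 0" 
        by (intro add_pos_nonneg mult_nonneg_nonneg mult_pos_pos hd less_imp_le[OF A(1)] lnq(1)) (use q in simp)
      then show ?thesis using klow[of q] by linarith
    qed
    have R: "reach (k q) ?s \<ge> real (k q) powr (-K2)" using elim(1) .
    have Rpos: "real (k q) powr (-K2) > 0" using kpos by simp
    have reach0: "reach (k q) ?s > 0" using R Rpos by linarith
    have "1 - reach (k q + m q) ?s \<le> r ^ m q / reach (k q) ?s" by (rule r(3)[OF reach0])
    also have "\<dots> \<le> r ^ m q / real (k q) powr (-K2)"
      using R mult_pos_pos[OF reach0 Rpos] r(1) by (intro divide_left_mono) (simp_all add: less_imp_le)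
    also have "\<dots> = r ^ m q * real (k q) powr K2" by (simp add: powr_minus divide_inverse)
    also have "\<dots> \<le> real q powr (- (K2 + 2)) * (D powr K2 * real q powr K2)"
    proof (intro mult_mono)
      have "r ^ m q = exp (m q * ln r)" using r by (simp add: exp_of_nat_mult)
      also have "\<dots> \<le> exp (A' * ln q * ln r)"
      proof -
        have "real (m q) \<ge> A' * ln q" unfolding m_def by linarith
        then have "m q * ln r \<le> A' * ln q * ln r" using lr by (intro mult_right_mono_neg) auto
        then show ?thesis by simp
      qed
      also have "A' * ln q * ln r = - (K2 + 2) * ln q"
      proof -
        have "A' * ln r = - (K2 + 2)" using lr by (simp add: A'_def)
        then show ?thesis by (metis mult.assoc mult.commute)
      qed
      also have "exp (- (K2 + 2) * ln q) = real q powr (- (K2 + 2))" using q by (simp add: powr_def)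
      finally show "r ^ m q \<le> real q powr (- (K2 + 2))" .
      have "real (k q) powr K2 \<le> (D * q) powr K2" using kup kpos K12 by (intro powr_mono2) auto
      then show "real (k q) powr K2 \<le> D powr K2 * real q powr K2" using D by (simp add: powr_mult)
    qed auto
    also have "\<dots> = D powr K2 * (real q powr (- (K2 + 2)) * real q powr K2)" by (simp only: mult_ac)
    also have "real q powr (- (K2 + 2)) * real q powr K2 = real q powr (-2)"
      unfolding powr_add[symmetric] by simp
    finally have 1: "1 - reach (k q + m q) ?s \<le> D powr K2 * real q powr (-2)" .
    have "real (2 ^ q) * exp ?s = exp (q * ln 2 - ?h * k q + K1 * ln (k q))"
      unfolding exp_powr_two by (simp flip: exp_add)
    also have "\<dots> \<le> exp (K1 * ln D + - 2 * ln q)"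
    proof -
      have "?h * (ln 2 / ?h * real q + A * ln q) \<le> ?h * k q" using klow[of q] h by (intro mult_left_mono) auto
      moreover have "?h * (ln 2 / ?h * real q + A * ln q) = q * ln 2 + (K1 + 2) * ln q"
        using h by (simp add: A_def field_simps)
      moreover have "K1 * ln (k q) \<le> K1 * (ln D + ln q)"
      proof -
        have "ln (k q) \<le> ln (D * q)" using kup kpos by (intro ln_mono) auto
        also have "\<dots> = ln D + ln q" using D q by (simp add: ln_mult)
        finally show ?thesis using K12 by (intro mult_left_mono)
      qed
      ultimately show ?thesis by (simp add: algebra_simps)
    qed
    also have "\<dots> = D powr K1 * real q powr (-2)" using D q unfolding exp_add by (simp add: powr_def)
    finally have 2: "real (2 ^ q) * exp ?s \<le> D powr K1 * real q powr (-2)" .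
    show ?case
      using not_underfull_prob_le[OF j, of "2 ^ q" "k q + m q" ?s] 1 2
      unfolding real_norm_def abs_of_nonneg[OF measure_nonneg] distrib_right by linarith
  qed
  have S: "summable (\<lambda>q. prob {\<omega>\<in>space M. \<not> underfull j (2 ^ q) (k q + m q) \<omega>})"
    by (rule summable_comparison_test_ev[OF bound summable_powr_minus_2])
  have q1: "\<forall>\<^sub>F n :: nat in sequentially. log 2 n \<ge> 2" by real_asymp
  from AE_saturation_le[OF S] show ?thesis
  proof eventually_elim
    case (elim \<omega>)
    then have "\<forall>\<^sub>F n in sequentially. real (saturation_level \<rho> X n j \<omega>) \<le> 1 / ?h * ln n + (A + A' + 1) * ln (ln n)"
      using eventually_ln_log2_le q1 eventually_ln_ln_ge[of "ln 2 / ?h + (A + A') + 2"] eventually_ge_at_top[of 1]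
    proof eventually_elim
      case (elim n)
      let ?q = "nat \<lceil>log 2 (real n)\<rceil>"
      have q: "real ?q \<le> log 2 n + 1" using ceil_log2_bounds(2)[of n] elim by simp
      have q2: "real ?q \<ge> 1" using elim(3) by linarith
      have "ln ?q \<le> ln (log 2 n + 1)" using q q2 by (intro ln_mono) linarith+
      then have lq: "ln ?q \<le> ln (ln n) + 1" "ln ?q \<ge> 0" using elim(2) q2 by auto
      have "real (saturation_level \<rho> X n j \<omega>) \<le> real (k ?q + m ?q)" using elim(1) by (simp only: of_nat_le_iff)
      also have "\<dots> \<le> ln 2 / ?h * ?q + A * ln ?q + A' * ln ?q + 2"
      proof -
        have "ln 2 / ?h * ?q + A * ln ?q \<ge> 0" "A' * ln ?q \<ge> 0"
          by (intro add_nonneg_nonneg mult_nonneg_nonneg less_imp_le[OF hd] less_imp_le[OF A(1)] less_imp_le[OF A(2)] lq(2) of_nat_0_le_iff)+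
        then show ?thesis unfolding k_def m_def of_nat_add by linarith
      qed
      also have "\<dots> = ln 2 / ?h * ?q + (A + A') * ln ?q + 2" by (simp add: algebra_simps)
      also have "\<dots> \<le> ln 2 / ?h * (log 2 n + 1) + (A + A') * (ln (ln n) + 1) + 2"
        
        by (intro add_mono mult_left_mono q lq(1) less_imp_le[OF hd] order_refl) (use A in simp)
      also have "ln 2 / ?h * (log 2 n + 1) = 1 / ?h * ln n + ln 2 / ?h" using h by (simp add: log_def field_simps)
      also have "1 / ?h * ln n + ln 2 / ?h + (A + A') * (ln (ln n) + 1) + 2 \<le> 1 / ?h * ln n + (A + A' + 1) * ln (ln n)"
        using elim(4) by (simp add: algebra_simps)
      finally show ?case .
    qed
    then show ?case by blast
  qed
qed

end

theorem theorem2: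
  fixes M :: "'a measure"
    and \<nu> :: "nat measure measure"
    and \<rho> :: "nat list \<Rightarrow> 'a \<Rightarrow> nat measure"
    and X :: "nat \<Rightarrow> nat \<Rightarrow> 'a \<Rightarrow> nat list"
    and j :: nat
  assumes "nested_boxes M \<nu> \<rho> X"
    and "\<not> geometric \<nu>"
    and "j \<ge> 1"
  shows
    "(theta_star \<nu> = -\<infinity> \<longrightarrow>
        (AE \<omega> in M. (\<lambda>n. real (saturation_level \<rho> X n j \<omega>))
                      \<sim>[at_top] (\<lambda>n. C_star \<nu> * ln (real n)))) \<and>
     (-\<infinity> < theta_star \<nu> \<and> theta_star \<nu> < 0 \<and>
      theta_low \<nu> < theta_star \<nu> \<and> phi \<nu> (real_of_ereal (theta_star \<nu>)) = 0 \<longrightarrow>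
        (AE \<omega> in M. (\<lambda>n. real (saturation_level \<rho> X n j \<omega>))
                      \<sim>[at_top] (\<lambda>n. C_star \<nu> * ln (real n))) \<and>
        (AE \<omega> in M. \<exists>K::real. \<forall>\<^sub>F n in at_top.
            real (saturation_level \<rho> X n j \<omega>) \<ge> C_star \<nu> * ln (real n) - K * ln (ln (real n))) \<and>
        ((\<exists>\<delta>>0. L \<nu> (-\<delta>) < \<infinity> \<and> atoms_moment \<nu> (1 + \<delta>) < \<infinity>) \<longrightarrow>
          (AE \<omega> in M. \<exists>K::real. \<forall>\<^sub>F n in at_top.
            \<bar>real (saturation_level \<rho> X n j \<omega>) - C_star \<nu> * ln (real n)\<bar> \<le> K * ln (ln (real n)))))"
proof -
  interpret nested_boxes M \<nu> \<rho> X
    "vimage_algebra (space M) (\<lambda>\<omega> i. \<rho> i \<omega>) (\<Pi>\<^sub>M i\<in>UNIV. prob_measures)"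
    by (rule assms(1)) (rule reflexive)
  note ng = assms(2) and j = assms(3)
  show ?thesis
  proof (intro conjI impI)
    assume "theta_star \<nu> = -\<infinity>"
    then obtain H where "C_star \<nu> = 1 / H" "law.critical H"
      using law.critical_infinite[OF ng] by blast
    then show "AE \<omega> in M. (\<lambda>n. real (saturation_level \<rho> X n j \<omega>)) \<sim>[at_top] (\<lambda>n. C_star \<nu> * ln (real n))"
      using saturation_asymp_equiv[OF ng j] by simp
  next
    assume *: "-\<infinity> < theta_star \<nu> \<and> theta_star \<nu> < 0 \<and>
      theta_low \<nu> < theta_star \<nu> \<and> phi \<nu> (real_of_ereal (theta_star \<nu>)) = 0"
    then have fin: "-\<infinity> < theta_star \<nu>" "theta_star \<nu> < 0" "theta_low \<nu> < theta_star \<nu>"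
      "phi \<nu> (real_of_ereal (theta_star \<nu>)) = 0" by auto
    obtain t where t: "t > 0" "theta_low \<nu> < ereal (-t)" and C: "C_star \<nu> = 1 / law.speed (-t)"
      and h1: "law.speed (-t) > 0" and H: "law.critical (law.speed (-t))"
      and h2: "law.loglap (-t) = t * law.speed (-t)"
      by (rule law.critical_finite[OF ng fin])
    note h = h1 h2
    show "AE \<omega> in M. (\<lambda>n. real (saturation_level \<rho> X n j \<omega>)) \<sim>[at_top] (\<lambda>n. C_star \<nu> * ln (real n))"
      unfolding C by (rule saturation_asymp_equiv[OF ng j H])
    show lower: "AE \<omega> in M. \<exists>K::real. \<forall>\<^sub>F n in at_top.
        real (saturation_level \<rho> X n j \<omega>) \<ge> C_star \<nu> * ln (real n) - K * ln (ln (real n))"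
      unfolding C by (rule saturation_critical_lower[OF ng j t h H])
    assume "\<exists>\<delta>>0. L \<nu> (-\<delta>) < \<infinity> \<and> atoms_moment \<nu> (1 + \<delta>) < \<infinity>"
    then obtain \<delta> where \<delta>: "\<delta> > 0" "atoms_moment \<nu> (1 + \<delta>) < \<infinity>" by blast
    from saturation_critical_upper[OF ng j t h \<delta>] lower
    show "AE \<omega> in M. \<exists>K::real. \<forall>\<^sub>F n in at_top.
        \<bar>real (saturation_level \<rho> X n j \<omega>) - C_star \<nu> * ln (real n)\<bar> \<le> K * ln (ln (real n))"
      unfolding C[symmetric]
    proof eventually_elim
      case (elim \<omega>)
      then obtain K K' where
        "\<forall>\<^sub>F n in sequentially. real (saturation_level \<rho> X n j \<omega>) \<le> C_star \<nu> * ln (real n) + K * ln (ln (real n))"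
        "\<forall>\<^sub>F n in sequentially. real (saturation_level \<rho> X n j \<omega>) \<ge> C_star \<nu> * ln (real n) - K' * ln (ln (real n))"
        by blast
      \<comment> \<open>The two constants may be merged by a maximum because
        \<open>ln (ln n)\<close> is eventually nonnegative.\<close>
      then have "\<forall>\<^sub>F n in sequentially.
          \<bar>real (saturation_level \<rho> X n j \<omega>) - C_star \<nu> * ln (real n)\<bar> \<le> max K K' * ln (ln (real n))"
        using eventually_ln_ln_ge[of 0]
      proof eventually_elim
        case (elim n)
        have "K * ln (ln (real n)) \<le> max K K' * ln (ln (real n))" "K' * ln (ln (real n)) \<le> max K K' * ln (ln (real n))"
          using elim(3) by (auto intro: mult_right_mono)
        then show ?case using elim by linarith
      qed
      then show ?case by blast
    qed
  qed
qed

end
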